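(* Let $\Bbbk$ be a principal ideal domain of characteristic $0$, $\ell\ge1$, and let $Z$ be the extended zigzag algebra over $\Bbbk$ with the standard idempotents $e_0,e_1,\dots,e_\ell$ and $\mathfrak z:=\mathrm{span}_\Bbbk(e_0,\dots,e_\ell)$. Set $e:=e_0+\cdots+e_{\ell-1}$, so that $eZe$ is the zigzag algebra. Then $e$ is a double centralizer idempotent for $Z$, and $\xi^e$ is a double centralizer idempotent for $T^Z_{\mathfrak z}(n,d)$ provided $d\le n$.
   Context: For a $\Bbbk$-algebra $S$ and an idempotent $f\in S$, regard $Sf$ as a right $fSf$-module; $f$ is a double centralizer idempotent for $S$ if the algebra homomorphism $S\to\mathrm{End}_{fSf}(Sf)$, $s\mapsto(s'f\mapsto ss'f)$, is an isomorphism. Extended zigzag algebra: let $\Gamma$ be the quiver with vertices $0,1,\dots,\ell$ and arrows $a_{j,j-1},a_{j-1,j}$ for $j=1,\dots,\ell$. $Z$ is the path algebra $\Bbbk\Gamma$ modulo the relations: all paths of length $\ge3$ are zero; all paths of length two that are not cycles are zero; all length-two cycles based at the same vertex are equal; $a_{\ell,\ell-1}a_{\ell-1,\ell}=0$. The length-zero paths are the idempotents $e_0,\dots,e_\ell$, with $e_ia_{i,j}e_j=a_{i,j}$. $Z$ is a superalgebra with $Z_{\bar0}$ spanned by paths of even length and $Z_{\bar1}$ by paths of length one. With $c_j:=a_{j,j+1}a_{j+1,j}$ for $0\le j\le\ell-1$, $Z$ has basis $B=B_{\mathfrak z}\sqcup B_{\mathfrak c}\sqcup B_{\bar1}$, $B_{\mathfrak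 z}=\{e_0,\dots,e_\ell\}$, $B_{\mathfrak c}=\{c_0,\dots,c_{\ell-1}\}$, $B_{\bar1}=\{a_{j,j+1},a_{j+1,j}\mid 0\le j\le\ell-1\}$. Generalized Schur algebra: let $n\ge1$, $d\ge0$. For $a\in Z$ put $\xi^a_{r,s}:=aE_{r,s}\in M_n(Z)$ ($E_{r,s}$ the matrix units; $M_n(Z)$ is a superalgebra via parities of entries). Tensor products of superalgebras carry the product $(x\otimes y)(z\otimes w)=(-1)^{\bar y\bar z}xz\otimes yw$. $\mathfrak S_d$ acts on the right on words by $(x_1\cdots x_d)\sigma=x_{\sigma 1}\cdots x_{\sigma d}$, diagonally on tuples of words, and on $M_n(Z)^{\otimes d}$ by $(\xi^{a_1}_{r_1,s_1}\otimes\cdots\otimes\xi^{a_d}_{r_d,s_d})^\sigma=(-1)^{\langle\sigma;\boldsymbol a\rangle}\xi^{a_{\sigma1}}_{r_{\sigma1},s_{\sigma1}}\otimes\cdots\otimes\xi^{a_{\sigma d}}_{r_{\sigma d},s_{\sigma d}}$ for homogeneous $a_i$, where $\langle\sigma;\boldsymbol a\rangle=\#\{(k,l): k<l,\ \sigma^{-1}k>\sigma^{-1}l,\ a_k,a_l \text{ odd}\}$. $S^Z(n,d):=(M_n(Z)^{\otimes d})^{\mathfrak S_d}$. $\mathrm{Tri}^B(n,d)$ is the set of triples $(\boldsymbol b,\boldsymbol r,\boldsymbol s)\in B^d\times[1,n]^d\times[1,n]^d$ (with $[1,n]=\{1,\dots,n\}$) such that for $k\ne l$ the equality $(b_k,r_k,s_k)=(b_l,r_l,s_l)$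 holds only if $b_k$ is even. For such a triple, $\xi^{\boldsymbol b}_{\boldsymbol r,\boldsymbol s}:=\sum_\sigma(\xi^{b_1}_{r_1,s_1}\otimes\cdots\otimes\xi^{b_d}_{r_d,s_d})^\sigma$, $\sigma$ over representatives of the cosets of the stabilizer of the triple, $\mathfrak S_{\boldsymbol b,\boldsymbol r,\boldsymbol s}\backslash\mathfrak S_d$; $[\boldsymbol b,\boldsymbol r,\boldsymbol s]^b_{r,s}:=\#\{k:(b_k,r_k,s_k)=(b,r,s)\}$; $\eta^{\boldsymbol b}_{\boldsymbol r,\boldsymbol s}:=\big(\prod_{b\in B_{\mathfrak c},\,r,s\in[1,n]}[\boldsymbol b,\boldsymbol r,\boldsymbol s]^b_{r,s}!\big)\,\xi^{\boldsymbol b}_{\boldsymbol r,\boldsymbol s}$. $T^Z_{\mathfrak z}(n,d)$ is the $\Bbbk$-span of all these $\eta^{\boldsymbol b}_{\boldsymbol r,\boldsymbol s}$, a unital subalgebra of $S^Z(n,d)$. Finally $\xi^e:=E^e\otimes\cdots\otimes E^e$ ($d$ factors), where $E^e:=\sum_{r=1}^n\xi^e_{r,r}$; this is an idempotent in $T^Z_{\mathfrak z}(n,d)$. *)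

theory Defs
  imports
    Complex_Main
    "HOL-Library.Poly_Mapping"
    "HOL-Algebra.QuotRing"
    "HOL-Combinatorics.Permutations"
begin

section \<open>Double centralizer idempotents\<close>

definition left_ideal_of :: "('a, 'm) ring_scheme \<Rightarrow> 'a \<Rightarrow> 'a set"
  where "left_ideal_of S f = {s \<otimes>\<^bsub>S\<^esub> f | s. s \<in> carrier S}"

definition corner :: "('a, 'm) ring_scheme \<Rightarrow> 'a \<Rightarrow> 'a set"
  where "corner S f = {f \<otimes>\<^bsub>S\<^esub> s \<otimes>\<^bsub>S\<^esub> f | s. s \<in> carrier S}"

text \<open>
  The endomorphism ring of the right module \<open>S f\<close> over \<open>f S f\<close>. If \<open>S\<close> is an algebra over a
  commutative ring \<open>k\<close>, then \<open>f S f\<close> contains \<open>k f\<close>, so these maps are automatically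
  \<open>k\<close>-linear. Maps are made canonical outside \<open>S f\<close> by extensionality.
\<close>

definition End_right :: "('a, 'm) ring_scheme \<Rightarrow> 'a \<Rightarrow> ('a \<Rightarrow> 'a) ring"
  where "End_right S f =
    \<lparr>carrier = {\<phi> \<in> left_ideal_of S f \<rightarrow>\<^sub>E left_ideal_of S f.
        (\<forall>x \<in> left_ideal_of S f. \<forall>y \<in> left_ideal_of S f.
            \<phi> (x \<oplus>\<^bsub>S\<^esub> y) = \<phi> x \<oplus>\<^bsub>S\<^esub> \<phi> y) \<and>
        (\<forall>x \<in> left_ideal_of S f. \<forall>y \<in> corner S f.
            \<phi> (x \<otimes>\<^bsub>S\<^esub> y) = \<phi> x \<otimes>\<^bsub>S\<^esub> y)},
     monoid.mult = (\<lambda>\<phi> \<psi>. compose (left_ideal_of S f) \<phi> \<psi>),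
     one = (\<lambda>x \<in> left_ideal_of S f. x),
     zero = (\<lambda>x \<in> left_ideal_of S f. \<zero>\<^bsub>S\<^esub>),
     add = (\<lambda>\<phi> \<psi>. \<lambda>x \<in> left_ideal_of S f. \<phi> x \<oplus>\<^bsub>S\<^esub> \<psi> x)\<rparr>"

definition double_centralizer_idempotent :: "('a, 'm) ring_scheme \<Rightarrow> 'a \<Rightarrow> bool"
  where "double_centralizer_idempotent S f \<longleftrightarrow>
    ring S \<and> f \<in> carrier S \<and> f \<otimes>\<^bsub>S\<^esub> f = f \<and>
    (\<lambda>s. \<lambda>x \<in> left_ideal_of S f. s \<otimes>\<^bsub>S\<^esub> x) \<in> ring_iso S (End_right S f)"


section \<open>Free modules\<close>

text \<open>
  The type \<open>'a \<Rightarrow>\<^sub>0 'k\<close> is the free \<open>'k\<close>-module with basis \<open>'a\<close>; the basis vector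
  of \<open>a\<close> is \<open>Poly_Mapping.single a 1\<close>.
\<close>

definition scale :: "'k::comm_ring_1 \<Rightarrow> ('a \<Rightarrow>\<^sub>0 'k) \<Rightarrow> ('a \<Rightarrow>\<^sub>0 'k)"
  where "scale c x = Poly_Mapping.map ((*) c) x"

definition lin_extend :: "('a \<Rightarrow> ('b \<Rightarrow>\<^sub>0 'k)) \<Rightarrow> ('a \<Rightarrow>\<^sub>0 'k::comm_ring_1) \<Rightarrow> ('b \<Rightarrow>\<^sub>0 'k)"
  where "lin_extend g x = (\<Sum>a\<in>Poly_Mapping.keys x. scale (Poly_Mapping.lookup x a) (g a))"

definition bilin_extend ::
    "('a \<Rightarrow> 'b \<Rightarrow> ('c \<Rightarrow>\<^sub>0 'k)) \<Rightarrow> ('a \<Rightarrow>\<^sub>0 'k::comm_ring_1) \<Rightarrow> ('b \<Rightarrow>\<^sub>0 'k) \<Rightarrow> ('c \<Rightarrow>\<^sub>0 'k)"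
  where "bilin_extend g x y = lin_extend (\<lambda>a. lin_extend (g a) y) x"


section \<open>The extended zigzag algebra\<close>

text \<open>
  Between two vertices of the quiver there is at most one arrow in each direction, so a path is
  given by the list of vertices it visits. Following \<open>e\<^sub>i a\<^sub>i\<^sub>j e\<^sub>j = a\<^sub>i\<^sub>j\<close>, the arrow
  \<open>a\<^sub>i\<^sub>j\<close> is the list \<open>[i, j]\<close>, and products are read from left to right.
\<close>

type_synonym path = "nat list"

definition quiver_paths :: "nat \<Rightarrow> path set"
  where "quiver_paths l =
    {p. p \<noteq> [] \<and> set p \<subseteq> {0..l} \<and> successively (\<lambda>i j. j = i + 1 \<or> i = j + 1) p}"

definition path_length :: "path \<Rightarrow> nat"
  where "path_length p = length p - 1"

definition path_comp :: "path \<Rightarrow> path \<Rightarrow> (path \<Rightarrow>\<^sub>0 'k::comm_ring_1)"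
  where "path_comp p q =
    (if last p = hd q then Poly_Mapping.single (p @ tl q) 1 else 0)"

definition path_algebra :: "nat \<Rightarrow> (path \<Rightarrow>\<^sub>0 'k::comm_ring_1) ring"
  where "path_algebra l =
    \<lparr>carrier = {x. Poly_Mapping.keys x \<subseteq> quiver_paths l},
     monoid.mult = bilin_extend path_comp,
     one = (\<Sum>i\<in>{0..l}. Poly_Mapping.single [i] 1),
     zero = 0,
     add = (+)\<rparr>"

definition zigzag_relations :: "nat \<Rightarrow> (path \<Rightarrow>\<^sub>0 'k::comm_ring_1) set"
  where "zigzag_relations l =
    {Poly_Mapping.single p 1 | p. p \<in> quiver_paths l \<and> path_length p \<ge> 3} \<union>
    {Poly_Mapping.single p 1 | p. p \<in> quiver_paths l \<and> path_length p = 2 \<and> hd p \<noteq> last p} \<union>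
    {Poly_Mapping.single p 1 - Poly_Mapping.single q 1 | p q.
        p \<in> quiver_paths l \<and> path_length p = 2 \<and> hd p = last p \<and>
        q \<in> quiver_paths l \<and> path_length q = 2 \<and> hd q = last q \<and> hd p = hd q} \<union>
    {Poly_Mapping.single [l, l - 1, l] 1}"

definition zigzag_ideal :: "nat \<Rightarrow> (path \<Rightarrow>\<^sub>0 'k::comm_ring_1) set"
  where "zigzag_ideal l = Idl\<^bsub>path_algebra l\<^esub> (zigzag_relations l)"

definition ext_zigzag :: "nat \<Rightarrow> (path \<Rightarrow>\<^sub>0 'k::comm_ring_1) set ring"
  where "ext_zigzag l = path_algebra l Quot zigzag_ideal l"

definition path_class :: "nat \<Rightarrow> path \<Rightarrow> (path \<Rightarrow>\<^sub>0 'k::comm_ring_1) set"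
  where "path_class l p = zigzag_ideal l +>\<^bsub>path_algebra l\<^esub> Poly_Mapping.single p 1"

text \<open>
  The distinguished basis is the set of classes of the paths in \<open>zigzag_basis l\<close>. The parity of
  a basis element is the parity of the length of its path.
\<close>

definition basis_z :: "nat \<Rightarrow> path set"
  where "basis_z l = {[j] | j. j \<le> l}"

definition basis_c :: "nat \<Rightarrow> path set"
  where "basis_c l = {[j, j + 1, j] | j. j < l}"

definition basis_1 :: "nat \<Rightarrow> path set"
  where "basis_1 l = {[j, j + 1] | j. j < l} \<union> {[j + 1, j] | j. j < l}"

definition zigzag_basis :: "nat \<Rightarrow> path set"
  where "zigzag_basis l = basis_z l \<union> basis_c l \<union> basis_1 l"

text \<open>
  An element of the quotient is a coset of the ideal; its coordinate vector with respect to the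
  distinguished basis is the unique representative supported on the basis paths.
\<close>

definition coords :: "nat \<Rightarrow> (path \<Rightarrow>\<^sub>0 'k::comm_ring_1) set \<Rightarrow> (path \<Rightarrow>\<^sub>0 'k)"
  where "coords l z = (THE x. x \<in> z \<and> Poly_Mapping.keys x \<subseteq> zigzag_basis l)"


section \<open>Matrices\<close>

text \<open>Matrices are indexed by \<open>{1..n}\<close> and are zero outside this range.\<close>

definition matrix_ring :: "('z, 'm) ring_scheme \<Rightarrow> nat \<Rightarrow> (nat \<Rightarrow> nat \<Rightarrow> 'z) ring"
  where "matrix_ring Z n =
    \<lparr>carrier = {A. \<forall>r s. A r s \<in> carrier Z \<and> (r \<notin> {1..n} \<or> s \<notin> {1..n} \<longrightarrow> A r s = \<zero>\<^bsub>Z\<^esub>)},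
     monoid.mult = (\<lambda>A B r s. \<Oplus>\<^bsub>Z\<^esub>t\<in>{1..n}. A r t \<otimes>\<^bsub>Z\<^esub> B t s),
     one = (\<lambda>r s. if r = s \<and> r \<in> {1..n} then \<one>\<^bsub>Z\<^esub> else \<zero>\<^bsub>Z\<^esub>),
     zero = (\<lambda>r s. \<zero>\<^bsub>Z\<^esub>),
     add = (\<lambda>A B r s. A r s \<oplus>\<^bsub>Z\<^esub> B r s)\<rparr>"

definition xi :: "('z, 'm) ring_scheme \<Rightarrow> 'z \<Rightarrow> nat \<Rightarrow> nat \<Rightarrow> (nat \<Rightarrow> nat \<Rightarrow> 'z)"
  where "xi Z a r s = (\<lambda>r' s'. if r' = r \<and> s' = s then a else \<zero>\<^bsub>Z\<^esub>)"

text \<open>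
  The letter \<open>(b, r, s)\<close> stands for the matrix \<open>\<xi>\<^sup>b\<^sub>r\<^sub>,\<^sub>s\<close>; these matrices are a basis
  of the matrix algebra over the extended zigzag algebra.
\<close>

type_synonym letter = "path \<times> nat \<times> nat"

definition letters :: "nat \<Rightarrow> nat \<Rightarrow> letter set"
  where "letters l n = zigzag_basis l \<times> {1..n} \<times> {1..n}"

definition odd_letter :: "letter \<Rightarrow> bool"
  where "odd_letter x \<longleftrightarrow> odd (path_length (fst x))"

definition letter_matrix :: "nat \<Rightarrow> letter \<Rightarrow> (nat \<Rightarrow> nat \<Rightarrow> (path \<Rightarrow>\<^sub>0 'k::comm_ring_1) set)"
  where "letter_matrix l x = (case x of (b, r, s) \<Rightarrow> xi (ext_zigzag l) (path_class l b) r s)"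

definition matrix_coords ::
    "nat \<Rightarrow> nat \<Rightarrow> (nat \<Rightarrow> nat \<Rightarrow> (path \<Rightarrow>\<^sub>0 'k::comm_ring_1) set) \<Rightarrow> (letter \<Rightarrow>\<^sub>0 'k)"
  where "matrix_coords l n A =
    (\<Sum>r\<in>{1..n}. \<Sum>s\<in>{1..n}. lin_extend (\<lambda>b. Poly_Mapping.single (b, r, s) 1) (coords l (A r s)))"


section \<open>Tensor powers and the generalized Schur algebra\<close>

text \<open>
  The \<open>d\<close>-th tensor power of the matrix algebra is the free module on the words of length \<open>d\<close>
  in the letters, a word standing for the tensor product of its letters.
\<close>

type_synonym tensor_word = "letter list"

definition words :: "nat \<Rightarrow> nat \<Rightarrow> nat \<Rightarrow> tensor_word set"
  where "words l n d = {w. length w = d \<and> set w \<subseteq> letters l n}"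

primrec pure_tensor :: "(letter \<Rightarrow>\<^sub>0 'k) list \<Rightarrow> (tensor_word \<Rightarrow>\<^sub>0 'k::comm_ring_1)" where
  "pure_tensor [] = Poly_Mapping.single [] 1"
| "pure_tensor (x # xs) =
    bilin_extend (\<lambda>a w. Poly_Mapping.single (a # w) 1) x (pure_tensor xs)"

definition tensor ::
    "nat \<Rightarrow> nat \<Rightarrow> (nat \<Rightarrow> nat \<Rightarrow> (path \<Rightarrow>\<^sub>0 'k::comm_ring_1) set) list \<Rightarrow> (tensor_word \<Rightarrow>\<^sub>0 'k)"
  where "tensor l n As = pure_tensor (map (matrix_coords l n) As)"

text \<open>
  Iterating the sign rule for two factors, the product of \<open>x\<^sub>1 \<otimes> \<dots> \<otimes> x\<^sub>d\<close> and
  \<open>y\<^sub>1 \<otimes> \<dots> \<otimes> y\<^sub>d\<close> carries one sign for each pair \<open>j < i\<close> with \<open>x\<^sub>i\<close> and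
  \<open>y\<^sub>j\<close> odd.
\<close>

definition word_mult :: "nat \<Rightarrow> nat \<Rightarrow> tensor_word \<Rightarrow> tensor_word \<Rightarrow> (tensor_word \<Rightarrow>\<^sub>0 'k::comm_ring_1)"
  where "word_mult l n v w =
    scale ((- 1) ^ card {(i, j). j < i \<and> i < length v \<and> odd_letter (v ! i) \<and> odd_letter (w ! j)})
      (tensor l n (map2 (\<lambda>x y. letter_matrix l x \<otimes>\<^bsub>matrix_ring (ext_zigzag l) n\<^esub> letter_matrix l y) v w))"

definition tensor_power :: "nat \<Rightarrow> nat \<Rightarrow> nat \<Rightarrow> (tensor_word \<Rightarrow>\<^sub>0 'k::comm_ring_1) ring"
  where "tensor_power l n d =
    \<lparr>carrier = {x. Poly_Mapping.keys x \<subseteq> words l n d},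
     monoid.mult = bilin_extend (word_mult l n),
     one = tensor l n (replicate d \<one>\<^bsub>matrix_ring (ext_zigzag l) n\<^esub>),
     zero = 0,
     add = (+)\<rparr>"

text \<open>
  Positions are numbered from \<open>0\<close>; \<open>permute_list \<sigma> w\<close> has the entry \<open>w ! \<sigma> k\<close> at
  position \<open>k\<close>.
\<close>

definition odd_inversions :: "(nat \<Rightarrow> nat) \<Rightarrow> tensor_word \<Rightarrow> nat"
  where "odd_inversions \<sigma> w =
    card {(i, j). i < j \<and> j < length w \<and> inv_into UNIV \<sigma> i > inv_into UNIV \<sigma> j \<and> odd_letter (w ! i) \<and> odd_letter (w ! j)}"

definition perm_act :: "(nat \<Rightarrow> nat) \<Rightarrow> (tensor_word \<Rightarrow>\<^sub>0 'k::comm_ring_1) \<Rightarrow> (tensor_word \<Rightarrow>\<^sub>0 'k)"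
  where "perm_act \<sigma> =
    lin_extend (\<lambda>w. Poly_Mapping.single (permute_list \<sigma> w) ((- 1) ^ odd_inversions \<sigma> w))"

definition schur_algebra :: "nat \<Rightarrow> nat \<Rightarrow> nat \<Rightarrow> (tensor_word \<Rightarrow>\<^sub>0 'k::comm_ring_1) ring"
  where "schur_algebra l n d =
    tensor_power l n d\<lparr>carrier :=
      {x \<in> carrier (tensor_power l n d). \<forall>\<sigma>. \<sigma> permutes {..<d} \<longrightarrow> perm_act \<sigma> x = x}\<rparr>"


section \<open>The subalgebra spanned by the elements eta\<close>

text \<open>
  A triple of words of length \<open>d\<close> is encoded as one word of triples.
\<close>

definition Tri :: "nat \<Rightarrow> nat \<Rightarrow> nat \<Rightarrow> tensor_word set"
  where "Tri l n d =
    {w \<in> words l n d. \<forall>i<d. \<forall>j<d. i \<noteq> j \<and> w ! i = w ! j \<longrightarrow> \<not> odd_letter (w ! i)}"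

definition word_stabilizer :: "tensor_word \<Rightarrow> (nat \<Rightarrow> nat) set"
  where "word_stabilizer w = {\<tau>. \<tau> permutes {..<length w} \<and> permute_list \<tau> w = w}"

text \<open>
  For the right action, \<open>\<tau>\<close> followed by \<open>\<sigma>\<close> is \<open>\<tau> \<circ> \<sigma>\<close>.
\<close>

definition stabilizer_cosets :: "tensor_word \<Rightarrow> (nat \<Rightarrow> nat) set set"
  where "stabilizer_cosets w =
    {(\<lambda>\<tau>. \<tau> \<circ> \<sigma>) ` word_stabilizer w | \<sigma>. \<sigma> permutes {..<length w}}"

definition xi_word :: "tensor_word \<Rightarrow> (tensor_word \<Rightarrow>\<^sub>0 'k::comm_ring_1)"
  where "xi_word w =
    (\<Sum>C\<in>stabilizer_cosets w. perm_act (SOME \<sigma>. \<sigma> \<in> C) (Poly_Mapping.single w 1))"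

definition eta_word :: "nat \<Rightarrow> nat \<Rightarrow> tensor_word \<Rightarrow> (tensor_word \<Rightarrow>\<^sub>0 'k::comm_ring_1)"
  where "eta_word l n w =
    scale (of_nat (\<Prod>x\<in>basis_c l \<times> {1..n} \<times> {1..n}. fact (count_list w x))) (xi_word w)"

definition T_algebra :: "nat \<Rightarrow> nat \<Rightarrow> nat \<Rightarrow> (tensor_word \<Rightarrow>\<^sub>0 'k::comm_ring_1) ring"
  where "T_algebra l n d =
    schur_algebra l n d\<lparr>carrier := module.span scale (eta_word l n ` Tri l n d)\<rparr>"


section \<open>The idempotents\<close>

definition zigzag_e :: "nat \<Rightarrow> (path \<Rightarrow>\<^sub>0 'k::comm_ring_1) set"
  where "zigzag_e l = (\<Oplus>\<^bsub>ext_zigzag l\<^esub>j\<in>{..<l}. path_class l [j])"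

definition matrix_E :: "nat \<Rightarrow> nat \<Rightarrow> (path \<Rightarrow>\<^sub>0 'k::comm_ring_1) set \<Rightarrow> (nat \<Rightarrow> nat \<Rightarrow> (path \<Rightarrow>\<^sub>0 'k) set)"
  where "matrix_E l n a =
    (\<Oplus>\<^bsub>matrix_ring (ext_zigzag l) n\<^esub>r\<in>{1..n}. xi (ext_zigzag l) a r r)"

definition xi_e :: "nat \<Rightarrow> nat \<Rightarrow> nat \<Rightarrow> (tensor_word \<Rightarrow>\<^sub>0 'k::comm_ring_1)"
  where "xi_e l n d = tensor l n (replicate d (matrix_E l n (zigzag_e l)))"

end

theory Submission
  imports Defs
begin

text \<open>
  Call the basis elements of \<open>M\<^sub>n(Z)\<close> letters; a letter leads from a source to a target, both of
  the form (vertex, index). In characteristic \<open>0\<close> the algebra \<open>T\<close> consists of the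
  (super)symmetric coefficient functions on words whose value at \<open>w\<close> is divisible by the product of
  the factorials of the multiplicities of the letters with entry \<open>c\<^sub>j\<close> in \<open>w\<close>.

  Let \<open>f = \<xi>\<^sup>e\<close>. For each list of sources choose a word \<open>w\<^sub>0\<close> that is the identity on the strands
  at the vertices \<open>0, \<dots>, l - 1\<close> and moves every strand at the vertex \<open>l\<close> to its own unoccupied
  place at the vertex \<open>l - 1\<close>, which is possible for \<open>d \<le> n\<close>. The elements \<open>\<xi>\<^bsub>w\<^sub>0\<^esub>\<close> generate
  \<open>T f\<close> as a right \<open>f T f\<close>-module, and all targets of \<open>w\<^sub>0\<close> that are not on identity strands are
  distinct, so that the coefficient of \<open>s \<xi>\<^bsub>w\<^sub>0\<^esub>\<close> at the word \<open>v w\<^sub>0\<close> is \<open>\<plusminus>s(v)\<close>. This gives injectivity, and it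
  dictates the preimage \<open>s\<close> of an endomorphism \<open>\<phi>\<close>. The function \<open>s\<close> so defined is symmetric because
  different choices of \<open>w\<^sub>0\<close> differ by right multiplication with elements of \<open>f T f\<close>, and
  \<open>s \<xi>\<^bsub>w\<^sub>0\<^esub> = \<phi>(\<xi>\<^bsub>w\<^sub>0\<^esub>)\<close> because every other coefficient of \<open>\<phi>(\<xi>\<^bsub>w\<^sub>0\<^esub>)\<close> is detected by an
  element of \<open>f T f\<close> that annihilates \<open>\<xi>\<^bsub>w\<^sub>0\<^esub>\<close>.

  The claim about \<open>Z\<close> is the case \<open>n = d = 1\<close>.
\<close>


section \<open>Free modules and bilinear extensions\<close>


text \<open>The vertex \<open>l\<close> is the whole difference between \<open>T\<close> and its
  corner. A basis path ending at \<open>l\<close> is the idempotent or the arrow from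
  \<open>l - 1\<close>, and neither is killed by the arrow from \<open>l\<close> to
  \<open>l - 1\<close>; so moving strands to \<open>l - 1\<close> loses no information. Conversely
  that arrow is the only basis path from \<open>l\<close> to a lower vertex, which is why moved
  strands suffice to generate. Repeated targets are harmless on identity strands, because an
  identity is determined by its target. Two arrows with different sources and a common target could
  be interchanged, and a repeated arrow, being odd, would give zero; this is why every moved strand
  needs its own place. The factorials intervene three times. \<open>T\<close> must be closed under
  products, which is an orbit count. The generators must lie in \<open>T\<close>, which holds
  because their words contain no letter with entry \<open>c\<close>. The preimage of an endomorphism
  must satisfy the divisibility; this works because letters with entry \<open>c\<close> end below
  \<open>l\<close>, meet only identity strands of a generator and so survive unchanged in the
  product.\<close>

abbreviation lookup where "lookup \<equiv> Poly_Mapping.lookup"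
abbreviation keys where "keys \<equiv> Poly_Mapping.keys"
abbreviation single where "single \<equiv> Poly_Mapping.single"

lemma lookup_scale [simp]: "lookup (scale c x) a = c * lookup x a"
  by (simp add: scale_def Poly_Mapping.map.rep_eq when_def)

lemma keys_scale: "keys (scale c x) \<subseteq> keys x"
  by (auto simp: in_keys_iff)

interpretation free_module: module "scale :: 'k::comm_ring_1 \<Rightarrow> ('a \<Rightarrow>\<^sub>0 'k) \<Rightarrow> ('a \<Rightarrow>\<^sub>0 'k)"
  by unfold_locales (auto intro!: poly_mapping_eqI simp: lookup_add algebra_simps)

lemma scale_single: "scale c (single a b) = single a (c * b)"
  by (auto intro!: poly_mapping_eqI simp: lookup_single when_def)

lemma lookup_lin_extend:
  "lookup (lin_extend g x) b = (\<Sum>a\<in>keys x. lookup x a * lookup (g a) b)"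
  by (simp add: lin_extend_def lookup_sum)

lemma lookup_lin_extend_superset:
  assumes "finite A" "keys x \<subseteq> A"
  shows "lookup (lin_extend g x) b = (\<Sum>a\<in>A. lookup x a * lookup (g a) b)"
  unfolding lookup_lin_extend using assms
  by (intro sum.mono_neutral_left) (auto simp: in_keys_iff)

lemma lin_extend_add: "lin_extend g (x + y) = lin_extend g x + lin_extend g y"
proof (rule poly_mapping_eqI)
  fix b
  let ?A = "keys x \<union> keys y"
  have "keys (x + y) \<subseteq> ?A" by (rule Poly_Mapping.keys_add)
  then show "lookup (lin_extend g (x + y)) b = lookup (lin_extend g x + lin_extend g y) b"
    by (simp add: lookup_lin_extend_superset[of ?A] lookup_add distrib_right sum.distrib)
qed

lemma lin_extend_scale: "lin_extend g (scale c x) = scale c (lin_extend g x)"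
proof (rule poly_mapping_eqI)
  fix b
  show "lookup (lin_extend g (scale c x)) b = lookup (scale c (lin_extend g x)) b"
    using keys_scale[of c x]
    by (simp add: lookup_lin_extend_superset[of "keys x"] sum_distrib_left mult.assoc)
qed

lemma lin_extend_zero [simp]: "lin_extend g 0 = 0"
  by (simp add: lin_extend_def)

lemma lin_extend_single [simp]: "lin_extend g (single a c) = scale c (g a)"
  by (auto simp: lin_extend_def free_module.scale_zero_left)

lemma lin_extend_sum: "lin_extend g (sum f A) = (\<Sum>a\<in>A. lin_extend g (f a))"
  by (induction A rule: infinite_finite_induct) (auto simp: lin_extend_add)

lemma lin_extend_uminus: "lin_extend g (- x) = - lin_extend g x"
  using lin_extend_add[of g x "- x"] by (simp add: eq_neg_iff_add_eq_0 add.commute)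

lemma lin_extend_diff: "lin_extend g (x - y) = lin_extend g x - lin_extend g y"
  using lin_extend_add[of g x "- y"] by (simp add: lin_extend_uminus)

lemma lin_extend_cong:
  "(\<And>a. a \<in> keys x \<Longrightarrow> g a = h a) \<Longrightarrow> lin_extend g x = lin_extend h x"
  by (simp add: lin_extend_def)

lemma lin_extend_id: "lin_extend (\<lambda>a. single a 1) x = x"
  by (rule poly_mapping_eqI)
    (auto simp: lookup_lin_extend lookup_single when_def if_distrib in_keys_iff cong: if_cong)

lemma lin_extend_id_on:
  "(\<And>a. a \<in> keys x \<Longrightarrow> g a = single a 1) \<Longrightarrow> lin_extend g x = x"
  using lin_extend_cong[of x g "\<lambda>a. single a 1"] by (simp add: lin_extend_id)

lemma lin_extend_lin_extend: "lin_extend g (lin_extend h x) = lin_extend (\<lambda>a. lin_extend g (h a)) x"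
  by (simp add: lin_extend_def[of h] lin_extend_def[of "\<lambda>a. lin_extend g (h a)"]
      lin_extend_sum lin_extend_scale)

lemma lin_extend_add_fun: "lin_extend (\<lambda>a. g a + h a) x = lin_extend g x + lin_extend h x"
  by (rule poly_mapping_eqI) (simp add: lookup_lin_extend lookup_add distrib_left sum.distrib)

lemma lin_extend_scale_fun: "lin_extend (\<lambda>a. scale c (g a)) x = scale c (lin_extend g x)"
  by (rule poly_mapping_eqI)
    (simp add: lookup_lin_extend sum_distrib_left mult.left_commute)

lemma lin_extend_zero_fun [simp]: "lin_extend (\<lambda>a. 0) x = 0"
  by (rule poly_mapping_eqI) (simp add: lookup_lin_extend)

lemma lin_extend_swap:
  "lin_extend (\<lambda>a. lin_extend (g a) y) x = lin_extend (\<lambda>b. lin_extend (\<lambda>a. g a b) x) y"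
  by (rule poly_mapping_eqI)
    (unfold lookup_lin_extend sum_distrib_left, subst sum.swap, simp add: mult.left_commute)

lemma keys_lin_extend: "keys (lin_extend g x) \<subseteq> (\<Union>a\<in>keys x. keys (g a))"
proof
  fix b assume "b \<in> keys (lin_extend g x)"
  then have "(\<Sum>a\<in>keys x. lookup x a * lookup (g a) b) \<noteq> 0"
    by (simp add: in_keys_iff lookup_lin_extend)
  then obtain a where "a \<in> keys x" "lookup x a * lookup (g a) b \<noteq> 0"
    by (meson sum.not_neutral_contains_not_neutral)
  then have "b \<in> keys (g a)" by (auto simp: in_keys_iff)
  with \<open>a \<in> keys x\<close> show "b \<in> (\<Union>a\<in>keys x. keys (g a))" by blast
qed

lemma bilin_extend_add_left:
  "bilin_extend g (x + y) z = bilin_extend g x z + bilin_extend g y z"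
  by (simp add: bilin_extend_def lin_extend_add)

lemma bilin_extend_add_right:
  "bilin_extend g x (y + z) = bilin_extend g x y + bilin_extend g x z"
  by (simp add: bilin_extend_def lin_extend_add lin_extend_add_fun)

lemma bilin_extend_scale_left: "bilin_extend g (scale c x) y = scale c (bilin_extend g x y)"
  by (simp add: bilin_extend_def lin_extend_scale)

lemma bilin_extend_scale_right: "bilin_extend g x (scale c y) = scale c (bilin_extend g x y)"
  by (simp add: bilin_extend_def lin_extend_scale lin_extend_scale_fun)

lemma bilin_extend_zero [simp]: "bilin_extend g 0 y = 0" "bilin_extend g x 0 = 0"
  by (simp_all add: bilin_extend_def)

lemma bilin_extend_single [simp]:
  "bilin_extend g (single a c) (single b e) = scale (c * e) (g a b)"
  by (simp add: bilin_extend_def)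

lemma lookup_bilin_extend:
  "lookup (bilin_extend g x y) c =
    (\<Sum>a\<in>keys x. \<Sum>b\<in>keys y. lookup x a * lookup y b * lookup (g a b) c)"
  by (simp add: bilin_extend_def lookup_lin_extend sum_distrib_left mult.assoc)

lemma keys_bilin_extend:
  "keys (bilin_extend g x y) \<subseteq> (\<Union>a\<in>keys x. \<Union>b\<in>keys y. keys (g a b))"
  unfolding bilin_extend_def
  by (rule order_trans[OF keys_lin_extend]) (intro UN_mono keys_lin_extend order_refl)

lemma bilin_extend_cong:
  "(\<And>a b. a \<in> keys x \<Longrightarrow> b \<in> keys y \<Longrightarrow> g a b = h a b) \<Longrightarrow> bilin_extend g x y = bilin_extend h x y"
  unfolding bilin_extend_def by (intro lin_extend_cong) auto

lemma lin_extend_bilin_extend: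
  "lin_extend h (bilin_extend g x y) = bilin_extend (\<lambda>a b. lin_extend h (g a b)) x y"
  by (simp add: bilin_extend_def lin_extend_lin_extend)

lemma bilin_extend_lin_extend_left:
  "bilin_extend g (lin_extend h x) y = bilin_extend (\<lambda>a b. lin_extend (\<lambda>c. g c b) (h a)) x y"
  unfolding bilin_extend_def lin_extend_lin_extend
  by (intro lin_extend_cong) (rule lin_extend_swap)

lemma bilin_extend_lin_extend_right:
  "bilin_extend g x (lin_extend h y) = bilin_extend (\<lambda>a b. lin_extend (g a) (h b)) x y"
  by (simp add: bilin_extend_def lin_extend_lin_extend)

lemma bilin_extend_assoc:
  assumes "\<And>a b c. a \<in> keys x \<Longrightarrow> b \<in> keys y \<Longrightarrow> c \<in> keys z \<Longrightarrow>
    lin_extend (\<lambda>t. g t c) (g a b) = lin_extend (g a) (g b c)"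
  shows "bilin_extend g (bilin_extend g x y) z = bilin_extend g x (bilin_extend g y z)"
proof -
  have "bilin_extend g (bilin_extend g x y) z
      = lin_extend (\<lambda>a. lin_extend (\<lambda>b. lin_extend (\<lambda>c. lin_extend (\<lambda>t. g t c) (g a b)) z) y) x"
    unfolding bilin_extend_def lin_extend_lin_extend
    by (intro lin_extend_cong, subst lin_extend_swap) (rule refl)
  also have "\<dots> = lin_extend (\<lambda>a. lin_extend (\<lambda>b. lin_extend (\<lambda>c. lin_extend (g a) (g b c)) z) y) x"
    using assms by (intro lin_extend_cong) auto
  also have "\<dots> = bilin_extend g x (bilin_extend g y z)"
    by (simp add: bilin_extend_def lin_extend_lin_extend)
  finally show ?thesis .
qed


section \<open>The extended zigzag algebra as a free module\<close>


text \<open>A product of two basis paths, letters or words is, up to sign, a basis element or zero.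
  Encoding it as an option, with \<open>None\<close> for zero, separates the combinatorial product
  from the coefficients, so that cancellation can be stated for it.\<close>

definition opt_single :: "'k \<Rightarrow> 'a option \<Rightarrow> ('a \<Rightarrow>\<^sub>0 'k::comm_ring_1)"
  where "opt_single c p = (case p of None \<Rightarrow> 0 | Some a \<Rightarrow> single a c)"

lemma opt_single_simps [simp]: "opt_single c None = 0" "opt_single c (Some a) = single a c"
  by (simp_all add: opt_single_def)

text \<open>The representative of a quiver path modulo the zigzag relations; \<open>None\<close>
  means that the path becomes zero. Lists count vertices, so \<open>length p \<le> 2\<close> is a
  path with at most one arrow and \<open>length p = 3\<close> a path with two. The condition
  \<open>hd p < l\<close> excludes the cycle at \<open>l\<close>.\<close>

definition nf :: "nat \<Rightarrow> path \<Rightarrow> path option"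
  where "nf l p =
    (if length p \<le> 2 then Some p
     else if length p = 3 \<and> hd p = last p \<and> hd p < l then Some [hd p, hd p + 1, hd p]
     else None)"

definition bmul :: "nat \<Rightarrow> path \<Rightarrow> path \<Rightarrow> path option"
  where "bmul l p q = (if last p = hd q then nf l (p @ tl q) else None)"

definition proj :: "nat \<Rightarrow> (path \<Rightarrow>\<^sub>0 'k::comm_ring_1) \<Rightarrow> (path \<Rightarrow>\<^sub>0 'k)"
  where "proj l = lin_extend (\<lambda>p. opt_single 1 (nf l p))"

lemma length_le_2_cases:
  assumes "p \<noteq> []" "length p \<le> 2"
  obtains i where "p = [i]" | i j where "p = [i, j]"
  using assms by (cases p; cases "tl p") (auto simp: le_Suc_eq)

lemma length_3_cases:
  assumes "length p = 3"
  obtains i j k where "p = [i, j, k]"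
  using assms by (auto simp: numeral_3_eq_3 length_Suc_conv)

lemma nf_SomeD:
  assumes "nf l p = Some q" "p \<noteq> []"
  shows "q \<noteq> []" "hd q = hd p" "last q = last p" "length q = length p"
  using assms by (auto simp: nf_def split: if_splits)

text \<open>A path with at least two arrows becomes zero as soon as an arrow is appended, whether or
  not it was normalised before; a shorter path is its own normal form. For trivial \<open>q\<close>
  the claim is the idempotence of \<open>nf\<close>.\<close>

lemma bind_nf_left:
  assumes "p \<noteq> []" "q \<noteq> []" "last p = hd q"
  shows "Option.bind (nf l p) (\<lambda>p'. nf l (p' @ tl q)) = nf l (p @ tl q)"
proof (cases "length p \<le> 2")
  case True
  then show ?thesis by (simp add: nf_def)
next
  case False
  show ?thesis
  proof (cases "tl q = []")
    case True
    then show ?thesis by (auto simp: nf_def)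
  next
    case ne: False
    then have "length (tl q) \<ge> 1" by (cases "tl q") auto
    with False show ?thesis by (auto simp: nf_def)
  qed
qed

lemma bind_nf_right:
  assumes "p \<noteq> []" "q \<noteq> []" "last p = hd q"
  shows "Option.bind (nf l q) (\<lambda>q'. nf l (p @ tl q')) = nf l (p @ tl q)"
proof (cases "length q \<le> 2")
  case True
  then show ?thesis by (simp add: nf_def)
next
  case False
  show ?thesis
  proof (cases "length p = 1")
    case True
    then obtain a where p: "p = [a]" by (auto simp: length_Suc_conv)
    with assms have "p @ tl q = q" by (cases q) auto
    moreover have "p @ [Suc (hd q), hd q] = [hd q, Suc (hd q), hd q]" using p assms by simp
    ultimately show ?thesis by (auto simp: nf_def)
  next
    case ne: False
    with assms have "length p \<ge> 2" by (cases p) (auto simp: Suc_le_eq)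
    with False show ?thesis by (auto simp: nf_def)
  qed
qed

text \<open>Both bracketings are the normal form of the concatenation of all three paths. If
  endpoints do not match, both sides are \<open>None\<close>, because \<open>nf\<close> keeps
  endpoints.\<close>

lemma bmul_assoc:
  assumes "p \<noteq> []" "q \<noteq> []" "r \<noteq> []"
  shows "Option.bind (bmul l p q) (\<lambda>t. bmul l t r) = Option.bind (bmul l q r) (bmul l p)"
proof (cases "last p = hd q \<and> last q = hd r")
  case True
  then have 1: "last (p @ tl q) = hd r" using assms by (cases q) (auto simp: last_append)
  have 2: "hd (q @ tl r) = hd q" using assms by simp
  have "Option.bind (bmul l p q) (\<lambda>t. bmul l t r)
      = Option.bind (nf l (p @ tl q)) (\<lambda>t. nf l (t @ tl r))"
    using True 1 assms by (auto simp: bmul_def dest!: nf_SomeD(3) intro!: Option.bind_cong)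
  also have "\<dots> = nf l ((p @ tl q) @ tl r)"
    using 1 assms by (intro bind_nf_left) auto
  also have "(p @ tl q) @ tl r = p @ tl (q @ tl r)" using assms by simp
  also have "nf l \<dots> = Option.bind (nf l (q @ tl r)) (\<lambda>t. nf l (p @ tl t))"
    using True 2 assms by (intro bind_nf_right[symmetric]) auto
  also have "\<dots> = Option.bind (bmul l q r) (bmul l p)"
    using True 2 assms by (auto simp: bmul_def dest!: nf_SomeD(2) intro!: Option.bind_cong)
  finally show ?thesis .
next
  case False
  have "Option.bind (bmul l p q) (\<lambda>t. bmul l t r) = None"
  proof (cases "bmul l p q")
    case (Some t)
    then have "last p = hd q" "nf l (p @ tl q) = Some t" by (auto simp: bmul_def split: if_splits)
    moreover have "last (p @ tl q) = last q"
      using \<open>last p = hd q\<close> assms by (cases q) (auto simp: last_append)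
    ultimately show ?thesis using False assms nf_SomeD(3)[of l "p @ tl q" t] Some
      by (auto simp: bmul_def)
  qed simp
  moreover have "Option.bind (bmul l q r) (bmul l p) = None"
  proof (cases "bmul l q r")
    case (Some t)
    then have "last q = hd r" "nf l (q @ tl r) = Some t" by (auto simp: bmul_def split: if_splits)
    then show ?thesis using False assms nf_SomeD(2)[of l "q @ tl r" t] Some
      by (auto simp: bmul_def)
  qed simp
  ultimately show ?thesis by simp
qed

lemma quiver_paths_append:
  assumes "p \<in> quiver_paths l" "q \<in> quiver_paths l" "last p = hd q"
  shows "p @ tl q \<in> quiver_paths l"
proof (cases q)
  case (Cons a q')
  with assms show ?thesis
    by (cases q') (auto simp: quiver_paths_def successively_append_iff)
qed (use assms in \<open>auto simp: quiver_paths_def\<close>)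

lemma zigzag_basis_iff: "b \<in> zigzag_basis l \<longleftrightarrow> b \<in> quiver_paths l \<and> nf l b = Some b"
proof
  assume "b \<in> zigzag_basis l"
  then show "b \<in> quiver_paths l \<and> nf l b = Some b"
    by (auto simp: zigzag_basis_def basis_z_def basis_c_def basis_1_def quiver_paths_def nf_def)
next
  assume b: "b \<in> quiver_paths l \<and> nf l b = Some b"
  then have ne: "b \<noteq> []" by (simp add: quiver_paths_def)
  show "b \<in> zigzag_basis l"
  proof (cases "length b \<le> 2")
    case True
    then consider i where "b = [i]" | i j where "b = [i, j]"
      using ne length_le_2_cases by blast
    then show ?thesis
      by cases (use b in \<open>auto simp: zigzag_basis_def basis_z_def basis_1_def quiver_paths_def\<close>)
  next
    case False
    then have "b = [hd b, hd b + 1, hd b]" "hd b < l"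
      using b by (auto simp: nf_def split: if_splits)
    then have "b \<in> basis_c l" unfolding basis_c_def by blast
    then show ?thesis by (simp add: zigzag_basis_def)
  qed
qed

lemma nf_in_basis:
  assumes "nf l p = Some q" "p \<in> quiver_paths l"
  shows "q \<in> zigzag_basis l"
proof (cases "length p \<le> 2")
  case True
  then show ?thesis using assms by (auto simp: nf_def zigzag_basis_iff)
next
  case False
  then show ?thesis
    using assms by (auto simp: nf_def zigzag_basis_def basis_c_def split: if_splits)
qed

lemma finite_zigzag_basis [simp]: "finite (zigzag_basis l)"
proof -
  have "basis_z l = (\<lambda>j. [j]) ` {..l}" "basis_c l = (\<lambda>j. [j, j + 1, j]) ` {..<l}"
    "basis_1 l = (\<lambda>j. [j, j + 1]) ` {..<l} \<union> (\<lambda>j. [j + 1, j]) ` {..<l}"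
    by (auto simp: basis_z_def basis_c_def basis_1_def)
  then show ?thesis by (simp add: zigzag_basis_def)
qed


section \<open>The path algebra and the zigzag ideal\<close>

lemma path_algebra_simps [simp]:
  "carrier (path_algebra l) = {x. keys x \<subseteq> quiver_paths l}"
  "x \<otimes>\<^bsub>path_algebra l\<^esub> y = bilin_extend path_comp x y"
  "\<one>\<^bsub>path_algebra l\<^esub> = (\<Sum>i\<in>{0..l}. single [i] 1)"
  "\<zero>\<^bsub>path_algebra l\<^esub> = 0"
  "x \<oplus>\<^bsub>path_algebra l\<^esub> y = x + y"
  by (simp_all add: path_algebra_def)

lemma path_comp_assoc:
  assumes "p \<noteq> []" "q \<noteq> []" "r \<noteq> []"
  shows "lin_extend (\<lambda>t. path_comp t r) (path_comp p q) = lin_extend (path_comp p) (path_comp q r)"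
proof -
  have "last p = hd q \<Longrightarrow> last (p @ tl q) = last q"
    using assms by (cases q) (auto simp: last_append)
  then show ?thesis using assms by (auto simp: path_comp_def)
qed

lemma path_algebra_one_mult:
  assumes "keys x \<subseteq> quiver_paths l"
  shows "bilin_extend path_comp (\<Sum>i\<in>{0..l}. single [i] 1) x = x"
    "bilin_extend path_comp x (\<Sum>i\<in>{0..l}. single [i] 1) = x"
proof -
  have *: "(\<Sum>i\<in>{0..l}. path_comp [i] p) = single p (1::'a)"
      "(\<Sum>i\<in>{0..l}. path_comp p [i]) = single p (1::'a)" if "p \<in> keys x" for p
  proof -
    from that assms have p: "p \<noteq> []" "hd p \<in> {0..l}" "last p \<in> {0..l}"
      by (auto simp: quiver_paths_def subset_iff)
    have "(\<Sum>i\<in>{0..l}. path_comp [i] p) = (\<Sum>i\<in>{0..l}. if i = hd p then single p (1::'a) else 0)"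
      using p by (intro sum.cong) (auto simp: path_comp_def)
    then show "(\<Sum>i\<in>{0..l}. path_comp [i] p) = single p (1::'a)" using p by simp
    have "(\<Sum>i\<in>{0..l}. path_comp p [i]) = (\<Sum>i\<in>{0..l}. if i = last p then single p (1::'a) else 0)"
      using p by (intro sum.cong) (auto simp: path_comp_def)
    then show "(\<Sum>i\<in>{0..l}. path_comp p [i]) = single p (1::'a)" using p by simp
  qed
  show "bilin_extend path_comp (\<Sum>i\<in>{0..l}. single [i] 1) x = x"
    unfolding bilin_extend_def
    by (subst lin_extend_swap, rule lin_extend_id_on) (simp add: lin_extend_sum *)
  show "bilin_extend path_comp x (\<Sum>i\<in>{0..l}. single [i] 1) = x"
    unfolding bilin_extend_def
    by (rule lin_extend_id_on) (simp add: lin_extend_sum *)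
qed

lemma path_algebra_mult_closed:
  assumes "keys x \<subseteq> quiver_paths l" "keys y \<subseteq> quiver_paths l"
  shows "keys (bilin_extend path_comp x y) \<subseteq> quiver_paths l"
proof -
  have "keys (path_comp p q :: _ \<Rightarrow>\<^sub>0 'a) \<subseteq> quiver_paths l" if "p \<in> keys x" "q \<in> keys y" for p q
    using that assms quiver_paths_append[of p l q] by (auto simp: path_comp_def)
  then show ?thesis using keys_bilin_extend[of path_comp x y] by blast
qed

lemma path_algebra_ring: "ring (path_algebra l :: (path \<Rightarrow>\<^sub>0 'k::comm_ring_1) ring)"
proof (rule ringI)
  show "abelian_group (path_algebra l :: (path \<Rightarrow>\<^sub>0 'k) ring)"
  proof (rule abelian_groupI)
    fix x :: "path \<Rightarrow>\<^sub>0 'k"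
    assume x: "x \<in> carrier (path_algebra l)"
    then show "\<exists>y\<in>carrier (path_algebra l). y \<oplus>\<^bsub>path_algebra l\<^esub> x = \<zero>\<^bsub>path_algebra l\<^esub>"
      by (intro bexI[of _ "- x"]) (auto simp: in_keys_iff)
  next
    fix x y :: "path \<Rightarrow>\<^sub>0 'k"
    assume "x \<in> carrier (path_algebra l)" "y \<in> carrier (path_algebra l)"
    then show "x \<oplus>\<^bsub>path_algebra l\<^esub> y \<in> carrier (path_algebra l)"
      using Poly_Mapping.keys_add[of x y] by auto
  qed (simp_all add: ac_simps)
  show "Group.monoid (path_algebra l :: (path \<Rightarrow>\<^sub>0 'k) ring)"
  proof (rule Group.monoidI, simp_all add: path_algebra_one_mult path_algebra_mult_closed)
    show "keys (\<Sum>i = 0..l. single [i] (1::'k)) \<subseteq> quiver_paths l"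
      using keys_sum[of "\<lambda>i. single [i] (1::'k)" "{0..l}"]
      by (auto simp: quiver_paths_def split: if_splits)
    show "bilin_extend path_comp (bilin_extend path_comp x y) z =
        bilin_extend path_comp x (bilin_extend path_comp y z)"
      if "keys x \<subseteq> quiver_paths l" "keys y \<subseteq> quiver_paths l" "keys z \<subseteq> quiver_paths l"
      for x y z :: "path \<Rightarrow>\<^sub>0 'k"
      using that by (intro bilin_extend_assoc path_comp_assoc) (auto simp: quiver_paths_def)
  qed
qed (simp_all add: bilin_extend_add_left bilin_extend_add_right)

lemma proj_path_comp:
  "proj l (path_comp p q) = opt_single 1 (bmul l p q)"
  by (simp add: proj_def path_comp_def bmul_def)

lemma keys_uminus': "keys (- x) = keys (x :: 'a \<Rightarrow>\<^sub>0 'k::comm_ring_1)"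
  by (auto simp: in_keys_iff)

text \<open>The two identities show that a factor killed by \<open>proj\<close> makes the product be
  killed too, so the kernel of \<open>proj\<close> is a two-sided ideal. They come from
  \<open>bind_nf_right\<close> and \<open>bind_nf_left\<close>.\<close>

lemma proj_mult:
  assumes "keys x \<subseteq> quiver_paths l" "keys y \<subseteq> quiver_paths l"
  shows "proj l (bilin_extend path_comp x y)
      = bilin_extend (\<lambda>p q. opt_single 1 (bmul l p q)) x (proj l y)" (is "?P = ?R")
    and "proj l (bilin_extend path_comp x y)
      = bilin_extend (\<lambda>p q. opt_single 1 (bmul l p q)) (proj l x) y" (is "?P = ?L")
proof -
  have P: "?P = bilin_extend (\<lambda>p q. opt_single 1 (bmul l p q)) x y"
    by (simp add: proj_def lin_extend_bilin_extend proj_path_comp[unfolded proj_def])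
  have R: "lin_extend (\<lambda>q. opt_single 1 (bmul l p q)) (opt_single 1 (nf l q))
      = (opt_single 1 (bmul l p q) :: path \<Rightarrow>\<^sub>0 'a)" if "p \<noteq> []" "q \<noteq> []" for p q
    using bind_nf_right[of p q l] that nf_SomeD(2)[of l q]
    by (cases "nf l q") (auto simp: bmul_def)
  have L: "lin_extend (\<lambda>p. opt_single 1 (bmul l p q)) (opt_single 1 (nf l p))
      = (opt_single 1 (bmul l p q) :: path \<Rightarrow>\<^sub>0 'a)" if "p \<noteq> []" "q \<noteq> []" for p q
    using bind_nf_left[of p q l] that nf_SomeD(3)[of l p]
    by (cases "nf l p") (auto simp: bmul_def)
  have ne: "p \<noteq> []" if "p \<in> keys x \<or> p \<in> keys y" for p
    using that assms by (auto simp: quiver_paths_def)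
  show "?P = ?R"
    unfolding P unfolding proj_def bilin_extend_lin_extend_right
    by (rule bilin_extend_cong) (simp add: R ne)
  show "?P = ?L"
    unfolding P unfolding proj_def bilin_extend_lin_extend_left
    by (rule bilin_extend_cong) (simp add: L ne)
qed

lemma proj_linear:
  "proj l (x + y) = proj l x + proj l y" "proj l (x - y) = proj l x - proj l y"
  "proj l (- x) = - proj l x" "proj l 0 = 0" "proj l (single p c) = scale c (opt_single 1 (nf l p))"
  by (simp_all add: proj_def lin_extend_add lin_extend_diff lin_extend_uminus)

lemma keys_proj:
  assumes "keys x \<subseteq> quiver_paths l"
  shows "keys (proj l x) \<subseteq> zigzag_basis l"
proof -
  have "keys (opt_single 1 (nf l p) :: path \<Rightarrow>\<^sub>0 'a) \<subseteq> zigzag_basis l" if "p \<in> keys x" for p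
    using that assms nf_in_basis[of l p] by (cases "nf l p") auto
  then show ?thesis unfolding proj_def using keys_lin_extend[of _ x] by fast
qed

lemma proj_id:
  assumes "keys x \<subseteq> zigzag_basis l"
  shows "proj l x = x"
  unfolding proj_def using assms by (intro lin_extend_id_on) (auto simp: zigzag_basis_iff)

lemma zigzag_relations_closed:
  assumes "l \<ge> 1"
  shows "zigzag_relations l \<subseteq> carrier (path_algebra l :: (path \<Rightarrow>\<^sub>0 'k::comm_ring_1) ring)"
proof -
  have "[l, l - 1, l] \<in> quiver_paths l" using assms by (auto simp: quiver_paths_def)
  then show ?thesis
    using keys_diff by (fastforce simp: zigzag_relations_def split: if_splits)
qed

lemma zigzag_ideal_ideal:
  assumes "l \<ge> 1"
  shows "ideal (zigzag_ideal l) (path_algebra l)"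
  unfolding zigzag_ideal_def
  using assms by (intro ring.genideal_ideal path_algebra_ring zigzag_relations_closed)

text \<open>The elements killed by \<open>proj\<close> form an ideal \<open>?K\<close> containing
  the relations, hence the ideal they generate. This is the independence half of the basis theorem
  for the zigzag algebra; \<open>diff_proj_in_ideal\<close> is the spanning half.\<close>

lemma proj_zigzag_ideal:
  assumes l1: "l \<ge> 1" and "x \<in> zigzag_ideal l"
  shows "proj l x = 0"
proof -
  let ?K = "{x. keys x \<subseteq> quiver_paths l \<and> proj l x = (0::path \<Rightarrow>\<^sub>0 'a)}"
  interpret ring "path_algebra l :: (path \<Rightarrow>\<^sub>0 'a) ring" by (rule path_algebra_ring)
  have "ideal ?K (path_algebra l)"
  proof (rule idealI)
    show "ring (path_algebra l :: (path \<Rightarrow>\<^sub>0 'a) ring)" by (rule path_algebra_ring)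
    show "subgroup ?K (add_monoid (path_algebra l))"
    proof (rule add.subgroupI)
      fix a assume a: "a \<in> ?K"
      have "\<ominus>\<^bsub>path_algebra l\<^esub> a = - a"
        using a by (intro minus_equality) (auto simp: in_keys_iff)
      then show "\<ominus>\<^bsub>path_algebra l\<^esub> a \<in> ?K"
        using a by (auto simp: proj_linear in_keys_iff)
    next
      fix a b assume "a \<in> ?K" "b \<in> ?K"
      then show "a \<oplus>\<^bsub>path_algebra l\<^esub> b \<in> ?K"
        using Poly_Mapping.keys_add[of a b] by (auto simp: proj_linear)
    next
      have "0 \<in> ?K" by (simp add: proj_linear)
      then show "?K \<noteq> {}" by blast
    qed auto
    fix a x :: "path \<Rightarrow>\<^sub>0 'a"
    assume "a \<in> ?K" "x \<in> carrier (path_algebra l)"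
    then show "x \<otimes>\<^bsub>path_algebra l\<^esub> a \<in> ?K" "a \<otimes>\<^bsub>path_algebra l\<^esub> x \<in> ?K"
      by (simp_all add: path_algebra_mult_closed proj_mult(1)[of x l a] proj_mult(2)[of a l x])
  qed
  moreover have "zigzag_relations l \<subseteq> ?K"
  proof
    fix x assume x: "x \<in> (zigzag_relations l :: (path \<Rightarrow>\<^sub>0 'a) set)"
    \<comment> \<open>The four families of relations have three shapes: a path without normal form,
      a difference of two paths with the same normal form, and the cycle at
      \<open>l\<close>.\<close>
    then consider (p) p where "x = single p 1" "p \<in> quiver_paths l" "nf l p = None"
      | (pq) p q where "x = single p 1 - single q 1" "p \<in> quiver_paths l" "q \<in> quiver_paths l"
          "nf l p = nf l q"
      | (l) "x = single [l, l - 1, l] 1"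
      unfolding zigzag_relations_def
    proof (elim UnE)
      assume "x \<in> {single p 1 - single q 1 | p q.
        p \<in> quiver_paths l \<and> path_length p = 2 \<and> hd p = last p \<and>
        q \<in> quiver_paths l \<and> path_length q = 2 \<and> hd q = last q \<and> hd p = hd q}"
      then obtain p q where "x = single p 1 - single q 1" "p \<in> quiver_paths l" "q \<in> quiver_paths l"
        "length p = 3" "hd p = last p" "length q = 3" "hd q = last q" "hd p = hd q"
        by (auto simp: path_length_def)
      then show thesis by (intro that(2)[of p q]) (simp_all add: nf_def)
    next
      assume "x \<in> {single p 1 | p. p \<in> quiver_paths l \<and> path_length p \<ge> 3}"
      then obtain p where "x = single p 1" "p \<in> quiver_paths l" "length p \<ge> 4"
        by (auto simp: path_length_def)
      then show thesis by (intro that(1)[of p]) (simp_all add: nf_def)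
    next
      assume "x \<in> {single p 1 | p. p \<in> quiver_paths l \<and> path_length p = 2 \<and> hd p \<noteq> last p}"
      then obtain p where "x = single p 1" "p \<in> quiver_paths l" "length p = 3" "hd p \<noteq> last p"
        by (auto simp: path_length_def)
      then show thesis by (intro that(1)[of p]) (simp_all add: nf_def)
    next
      assume "x \<in> {single [l, l - 1, l] 1}"
      then show thesis by (intro that(3)) simp
    qed
    then show "x \<in> ?K"
    proof cases
      case p
      then show ?thesis by (simp add: proj_linear)
    next
      case pq
      then show ?thesis using keys_diff[of "single p (1::'a)" "single q 1"]
        by (auto simp: proj_linear)
    next
      case l
      then show ?thesis using zigzag_relations_closed[OF l1] x
        by (auto simp: proj_linear nf_def)
    qed
  qed
  ultimately have "zigzag_ideal l \<subseteq> ?K"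
    unfolding zigzag_ideal_def by (rule genideal_minimal)
  then show ?thesis using assms by blast
qed

text \<open>By linearity a single path suffices, and for a path the difference is zero or is
  literally one of the relations.\<close>

lemma diff_proj_in_ideal:
  fixes x :: "path \<Rightarrow>\<^sub>0 'k::comm_ring_1"
  assumes l1: "l \<ge> 1" and x: "keys x \<subseteq> quiver_paths l"
  shows "x - proj l x \<in> zigzag_ideal l"
proof -
  let ?I = "zigzag_ideal l :: (path \<Rightarrow>\<^sub>0 'k) set"
  interpret ideal ?I "path_algebra l" by (rule zigzag_ideal_ideal[OF l1])
  have zero: "0 \<in> ?I" using additive_subgroup.zero_closed[OF is_additive_subgroup] by simp
  have add: "a + b \<in> ?I" if "a \<in> ?I" "b \<in> ?I" for a b
    using additive_subgroup.a_closed[OF is_additive_subgroup that] by simp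
  have rel: "a \<in> ?I" if "a \<in> zigzag_relations l" for a
    using that genideal_self[OF zigzag_relations_closed[OF l1]] by (auto simp: zigzag_ideal_def)
  \<comment> \<open>An ideal in the ring-theoretic sense is closed under scalars because the
    multiple of \<open>a\<close> by \<open>c\<close> is the product of \<open>scale c ?one\<close>
    with \<open>a\<close>.\<close>
  have sc: "scale c a \<in> ?I" if a: "a \<in> ?I" for a c
  proof -
    let ?one = "\<one>\<^bsub>path_algebra l\<^esub> :: path \<Rightarrow>\<^sub>0 'k"
    have ak: "keys a \<subseteq> quiver_paths l" using a a_subset by auto
    have "keys (scale c ?one) \<subseteq> quiver_paths l"
      using keys_scale[of c ?one] one_closed by auto
    then have "bilin_extend path_comp (scale c ?one) a \<in> ?I"
      using I_l_closed[OF a, of "scale c ?one"] by simp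
    then show ?thesis
      using path_algebra_one_mult(1)[OF ak] by (simp add: bilin_extend_scale_left)
  qed
  have base: "single p 1 - proj l (single p 1) \<in> ?I" if p: "p \<in> quiver_paths l" for p
  proof (cases "length p \<le> 2")
    case True
    then show ?thesis by (simp add: proj_linear nf_def zero)
  next
    case gt: False
    show ?thesis
    proof (cases "length p = 3")
      case False
      with gt p have "single p (1::'k) \<in> zigzag_relations l"
        unfolding zigzag_relations_def path_length_def by (intro UnI1) force
      with gt False show ?thesis
        by (auto simp: proj_linear nf_def intro!: rel)
    next
      case True
      then obtain i j k where pijk: "p = [i, j, k]" by (rule length_3_cases)
      show ?thesis
      proof (cases "i = k")
        case False
        with p pijk have "single p (1::'k) \<in> zigzag_relations l"
          unfolding zigzag_relations_def path_length_def by - (rule UnI1, rule UnI1, rule UnI2, force)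
        with pijk False show ?thesis
          by (auto simp: proj_linear nf_def intro!: rel)
      next
        case ik: True
        show ?thesis
        proof (cases "i < l")
          case True
          then have "[i, i + 1, i] \<in> quiver_paths l" by (auto simp: quiver_paths_def)
          then have "single p (1::'k) - single [i, i + 1, i] 1 \<in> zigzag_relations l"
            using p pijk ik unfolding zigzag_relations_def path_length_def by fastforce
          then show ?thesis
            using pijk ik True by (auto simp: proj_linear nf_def intro!: rel)
        next
          case False
          then have "p = [l, l - 1, l]" using p pijk ik by (auto simp: quiver_paths_def)
          then show ?thesis
            by (auto simp: proj_linear nf_def zigzag_relations_def intro!: rel)
        qed
      qed
    qed
  qed
  have "x - proj l x = lin_extend (\<lambda>p. single p 1 - proj l (single p 1)) x"
    using lin_extend_add_fun[of "\<lambda>p. single p 1 - proj l (single p 1)" "\<lambda>p. proj l (single p 1)" x]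
    unfolding diff_eq_eq by (simp add: lin_extend_id proj_linear) (simp add: proj_def)
  also have "\<dots> \<in> ?I"
  proof -
    have "(\<Sum>a\<in>A. scale (lookup x a) (single a 1 - proj l (single a 1))) \<in> ?I"
      if "finite A" "A \<subseteq> keys x" for A
      using that
    proof induction
      case (insert a A)
      then show ?case using x by (auto intro!: add sc base)
    qed (simp add: zero)
    then show ?thesis unfolding lin_extend_def by simp
  qed
  finally show ?thesis .
qed

text \<open>The element \<open>proj l x\<close> lies in the coset by
  \<open>diff_proj_in_ideal\<close>. Any other candidate has the same projection, since
  \<open>proj\<close> kills the ideal, and an element supported on the basis is its own projection.
  So the \<open>THE\<close> in \<open>coords\<close> is meaningful.\<close>

lemma zigzag_coset:
  assumes l1: "l \<ge> 1" and x: "keys x \<subseteq> quiver_paths l"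
  shows "coords l (zigzag_ideal l +>\<^bsub>path_algebra l\<^esub> x) = proj l x"
proof -
  interpret ideal "zigzag_ideal l :: (path \<Rightarrow>\<^sub>0 'a) set" "path_algebra l"
    by (rule zigzag_ideal_ideal[OF l1])
  have coset: "zigzag_ideal l +>\<^bsub>path_algebra l\<^esub> x = {i + x | i. i \<in> zigzag_ideal l}"
    by (auto simp: a_r_coset_def')
  have "x - proj l x \<in> zigzag_ideal l" by (rule diff_proj_in_ideal[OF l1 x])
  then have "\<ominus>\<^bsub>path_algebra l\<^esub> (x - proj l x) \<in> zigzag_ideal l"
    by (rule additive_subgroup.a_inv_closed[OF is_additive_subgroup])
  moreover have "\<ominus>\<^bsub>path_algebra l\<^esub> (x - proj l x) = - (x - proj l x)"
  proof (rule minus_equality)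
    have *: "x - proj l x \<in> carrier (path_algebra l)"
      using \<open>x - proj l x \<in> zigzag_ideal l\<close> a_subset by blast
    then show "x - proj l x \<in> carrier (path_algebra l)" .
    from * show "- (x - proj l x) \<in> carrier (path_algebra l)"
      by (simp only: path_algebra_simps mem_Collect_eq keys_uminus')
  qed simp
  ultimately have i: "proj l x - x \<in> zigzag_ideal l" by simp
  show ?thesis
    unfolding coords_def coset
  proof (rule the_equality)
    show "proj l x \<in> {i + x |i. i \<in> zigzag_ideal l} \<and> keys (proj l x) \<subseteq> zigzag_basis l"
      using i keys_proj[OF x] by (force intro: exI[of _ "proj l x - x"])
  next
    fix y assume "y \<in> {i + x |i. i \<in> zigzag_ideal l} \<and> keys y \<subseteq> zigzag_basis l"
    then obtain i where "i \<in> zigzag_ideal l" "y = i + x" "keys y \<subseteq> zigzag_basis l" by auto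
    then have "proj l y = proj l i + proj l x" by (simp add: proj_linear)
    then show "y = proj l x"
      using proj_id[of y l] \<open>keys y \<subseteq> _\<close> proj_zigzag_ideal[OF l1 \<open>i \<in> _\<close>] by simp
  qed
qed

section \<open>The quotient ring in coordinates\<close>

lemma zigzag_basis_subset: "zigzag_basis l \<subseteq> quiver_paths l"
  by (auto simp: zigzag_basis_iff)

lemma ext_zigzag_ring: "l \<ge> 1 \<Longrightarrow> ring (ext_zigzag l)"
  unfolding ext_zigzag_def by (intro ideal.quotient_is_ring zigzag_ideal_ideal)

definition cls :: "nat \<Rightarrow> (path \<Rightarrow>\<^sub>0 'k::comm_ring_1) \<Rightarrow> (path \<Rightarrow>\<^sub>0 'k) set"
  where "cls l x = zigzag_ideal l +>\<^bsub>path_algebra l\<^esub> x"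

lemma path_class_eq: "path_class l p = cls l (single p 1)"
  by (simp add: path_class_def cls_def)

lemma cls_eq_proj:
  assumes l1: "l \<ge> 1" and x: "keys x \<subseteq> quiver_paths l"
  shows "cls l x = cls l (proj l x)"
proof -
  interpret ideal "zigzag_ideal l :: (path \<Rightarrow>\<^sub>0 'a) set" "path_algebra l"
    by (rule zigzag_ideal_ideal[OF l1])
  have p: "keys (proj l x) \<subseteq> quiver_paths l" using keys_proj[OF x] zigzag_basis_subset by blast
  have "x = (x - proj l x) \<oplus>\<^bsub>path_algebra l\<^esub> proj l x" by simp
  then have "x \<in> zigzag_ideal l +>\<^bsub>path_algebra l\<^esub> proj l x"
    using diff_proj_in_ideal[OF l1 x] unfolding a_r_coset_def' by blast
  then have "zigzag_ideal l +>\<^bsub>path_algebra l\<^esub> x = zigzag_ideal l +>\<^bsub>path_algebra l\<^esub> proj l x"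
    using p a_subgroup by (intro a_repr_independence[symmetric]) (simp_all only: path_algebra_simps mem_Collect_eq)
  then show ?thesis unfolding cls_def .
qed

lemma ext_zigzag_carrier:
  assumes l1: "l \<ge> 1"
  shows "carrier (ext_zigzag l) = cls l ` {x. keys x \<subseteq> zigzag_basis l}"
proof -
  have "carrier (ext_zigzag l) = cls l ` {x. keys x \<subseteq> quiver_paths l}"
    by (auto simp: ext_zigzag_def FactRing_def A_RCOSETS_def' cls_def)
  also have "\<dots> = cls l ` {x. keys x \<subseteq> zigzag_basis l}"
  proof (intro equalityI subsetI)
    fix z assume "z \<in> cls l ` {x. keys x \<subseteq> quiver_paths l}"
    then obtain x where "z = cls l x" "keys x \<subseteq> quiver_paths l" by auto
    then show "z \<in> cls l ` {x. keys x \<subseteq> zigzag_basis l}"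
      using cls_eq_proj[OF l1, of x] keys_proj[of x l] by auto
  qed (use zigzag_basis_subset[of l] in auto)
  finally show ?thesis .
qed

lemma coords_cls:
  "l \<ge> 1 \<Longrightarrow> keys x \<subseteq> zigzag_basis l \<Longrightarrow> coords l (cls l x) = x"
  using zigzag_basis_subset[of l] by (auto simp: cls_def zigzag_coset proj_id)

lemma ext_zigzag_ops:
  assumes l1: "l \<ge> 1" and x: "keys x \<subseteq> quiver_paths l" and y: "keys y \<subseteq> quiver_paths l"
  shows "cls l x \<oplus>\<^bsub>ext_zigzag l\<^esub> cls l y = cls l (x + y)"
    and "cls l x \<otimes>\<^bsub>ext_zigzag l\<^esub> cls l y = cls l (bilin_extend path_comp x y)"
proof -
  interpret ideal "zigzag_ideal l :: (path \<Rightarrow>\<^sub>0 'a) set" "path_algebra l"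
    by (rule zigzag_ideal_ideal[OF l1])
  show "cls l x \<oplus>\<^bsub>ext_zigzag l\<^esub> cls l y = cls l (x + y)"
    using a_rcos_sum[of x y] x y by (simp add: ext_zigzag_def FactRing_def cls_def)
  show "cls l x \<otimes>\<^bsub>ext_zigzag l\<^esub> cls l y = cls l (bilin_extend path_comp x y)"
    using rcoset_mult_add[of x y] x y by (simp add: ext_zigzag_def FactRing_def cls_def)
qed

lemma ext_zigzag_zero: "l \<ge> 1 \<Longrightarrow> \<zero>\<^bsub>ext_zigzag l\<^esub> = cls l 0"
proof -
  assume l1: "l \<ge> 1"
  interpret ideal "zigzag_ideal l :: (path \<Rightarrow>\<^sub>0 'a) set" "path_algebra l"
    by (rule zigzag_ideal_ideal[OF l1])
  show ?thesis
    by (auto simp: ext_zigzag_def FactRing_def cls_def a_r_coset_def')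
qed

lemma ext_zigzag_one: "\<one>\<^bsub>ext_zigzag l\<^esub> = cls l (\<Sum>i\<in>{0..l}. single [i] 1)"
  by (simp add: ext_zigzag_def FactRing_def cls_def)


section \<open>Letters and words\<close>


definition src :: "letter \<Rightarrow> nat \<times> nat"
  where "src x = (hd (fst x), fst (snd x))"

definition tgt :: "letter \<Rightarrow> nat \<times> nat"
  where "tgt x = (last (fst x), snd (snd x))"

definition lmul :: "nat \<Rightarrow> letter \<Rightarrow> letter \<Rightarrow> letter option"
  where "lmul l x y =
    (if snd (snd x) = fst (snd y)
     then map_option (\<lambda>b. (b, fst (snd x), snd (snd y))) (bmul l (fst x) (fst y)) else None)"

text \<open>The product of two words without its sign, which is \<open>eps\<close> below; again
  \<open>None\<close> stands for zero.\<close>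

fun wmul :: "nat \<Rightarrow> tensor_word \<Rightarrow> tensor_word \<Rightarrow> tensor_word option" where
  "wmul l [] [] = Some []"
| "wmul l (x # u) (y # v) =
    Option.bind (lmul l x y) (\<lambda>z. map_option ((#) z) (wmul l u v))"
| "wmul l _ _ = None"

lemma letters_ne: "x \<in> letters l n \<Longrightarrow> fst x \<noteq> []"
  by (auto simp: letters_def zigzag_basis_iff quiver_paths_def)

lemma lmul_SomeD:
  assumes "lmul l x y = Some z" "fst x \<noteq> []" "fst y \<noteq> []"
  shows "tgt x = src y" "src z = src x" "tgt z = tgt y"
    "length (fst z) + 1 = length (fst x) + length (fst y)"
proof -
  obtain b where b: "nf l (fst x @ tl (fst y)) = Some b" "z = (b, fst (snd x), snd (snd y))"
    and eq: "last (fst x) = hd (fst y)" "snd (snd x) = fst (snd y)"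
    using assms(1) by (auto simp: lmul_def bmul_def split: if_splits)
  note D = nf_SomeD[OF b(1)]
  have "last (fst x @ tl (fst y)) = last (fst y)"
    using eq assms by (cases "fst y") (auto simp: last_append)
  moreover have "length (fst x @ tl (fst y)) + 1 = length (fst x) + length (fst y)"
    using assms by (cases "fst y") auto
  ultimately show "tgt x = src y" "src z = src x" "tgt z = tgt y"
    "length (fst z) + 1 = length (fst x) + length (fst y)"
    using D b eq assms by (auto simp: src_def tgt_def)
qed

lemma lmul_closed:
  assumes "lmul l x y = Some z" "x \<in> letters l n" "y \<in> letters l n"
  shows "z \<in> letters l n"
proof -
  obtain b where b: "nf l (fst x @ tl (fst y)) = Some b" "z = (b, fst (snd x), snd (snd y))"
    and eq: "last (fst x) = hd (fst y)"
    using assms(1) by (auto simp: lmul_def bmul_def split: if_splits)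
  have "fst x \<in> quiver_paths l" "fst y \<in> quiver_paths l"
    using assms(2,3) by (auto simp: letters_def zigzag_basis_iff)
  then have "b \<in> zigzag_basis l" using b(1) eq nf_in_basis quiver_paths_append by blast
  then show ?thesis using b(2) assms(2,3) by (auto simp: letters_def)
qed

lemma lmul_None: "tgt x \<noteq> src y \<Longrightarrow> lmul l x y = None"
  by (auto simp: lmul_def bmul_def src_def tgt_def)

text \<open>The number of arrows is additive under a nonzero product. In terms of vertices this is
  the shift by one in \<open>lmul_SomeD\<close>.\<close>

lemma lmul_odd:
  assumes "lmul l x y = Some z" "fst x \<noteq> []" "fst y \<noteq> []"
  shows "odd_letter z \<longleftrightarrow> odd_letter x \<noteq> odd_letter y"
proof -
  have *: "odd_letter t \<longleftrightarrow> even (length (fst t))" if "length (fst t) \<ge> 1" for t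
    using that by (cases "fst t") (simp_all add: odd_letter_def path_length_def)
  have "length (fst x) \<ge> 1" "length (fst y) \<ge> 1"
    using assms by (simp_all add: Suc_le_eq)
  moreover from this have "length (fst z) \<ge> 1" "length (fst z) + 1 = length (fst x) + length (fst y)"
    using lmul_SomeD(4)[OF assms] by linarith+
  ultimately show ?thesis unfolding *[of x, OF \<open>length (fst x) \<ge> 1\<close>]
      *[of y, OF \<open>length (fst y) \<ge> 1\<close>] *[of z, OF \<open>length (fst z) \<ge> 1\<close>]
    by (metis even_Suc even_add Suc_eq_plus1)
qed

text \<open>The length is a grading, and it separates the two letters a loop can have.\<close>

lemma letter_unique:
  assumes "x \<in> letters l n" "y \<in> letters l n" "src x = src y" "tgt x = tgt y"
    "length (fst x) = length (fst y)"
  shows "x = y"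
proof -
  have "fst x = fst y"
    using assms by (auto simp: letters_def zigzag_basis_def basis_z_def basis_c_def basis_1_def
        src_def tgt_def)
  with assms show ?thesis by (auto simp: src_def tgt_def prod_eq_iff)
qed

text \<open>Source, target and length of the unknown factor are determined by the known letters, and
  these three data determine a letter.\<close>

lemma lmul_right_cancel:
  assumes "lmul l x y = Some z" "lmul l x' y = Some z" "x \<in> letters l n" "x' \<in> letters l n"
    "y \<in> letters l n"
  shows "x = x'"
proof (rule letter_unique[OF assms(3,4)])
  note ne = letters_ne[OF assms(3)] letters_ne[OF assms(4)] letters_ne[OF assms(5)]
  note D = lmul_SomeD[OF assms(1) ne(1,3)] lmul_SomeD[OF assms(2) ne(2,3)]
  show "src x = src x'" "tgt x = tgt x'" "length (fst x) = length (fst x')" using D by auto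
qed

lemma lmul_left_cancel:
  assumes "lmul l y x = Some z" "lmul l y x' = Some z" "x \<in> letters l n" "x' \<in> letters l n"
    "y \<in> letters l n"
  shows "x = x'"
proof (rule letter_unique[OF assms(3,4)])
  note ne = letters_ne[OF assms(3)] letters_ne[OF assms(4)] letters_ne[OF assms(5)]
  note D = lmul_SomeD[OF assms(1) ne(3,1)] lmul_SomeD[OF assms(2) ne(3,2)]
  show "src x = src x'" "tgt x = tgt x'" "length (fst x) = length (fst x')" using D by auto
qed

lemma lmul_assoc:
  assumes "fst x \<noteq> []" "fst y \<noteq> []" "fst z \<noteq> []"
  shows "Option.bind (lmul l x y) (\<lambda>t. lmul l t z) = Option.bind (lmul l y z) (lmul l x)"
  using bmul_assoc[OF assms, of l]
  by (cases "bmul l (fst x) (fst y)"; cases "bmul l (fst y) (fst z)") (auto simp: lmul_def)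

definition idl :: "nat \<times> nat \<Rightarrow> letter"
  where "idl p = ([fst p], snd p, snd p)"

lemma idl_simps [simp]: "src (idl p) = p" "tgt (idl p) = p" "\<not> odd_letter (idl p)"
  "fst (idl p) = [fst p]"
  by (simp_all add: idl_def src_def tgt_def odd_letter_def path_length_def)

lemma nf_letter: "x \<in> letters l n \<Longrightarrow> nf l (fst x) = Some (fst x)"
  by (auto simp: letters_def zigzag_basis_iff)

lemma lmul_idl_left: "x \<in> letters l n \<Longrightarrow> src x = p \<Longrightarrow> lmul l (idl p) x = Some x"
  using nf_letter[of x l n] letters_ne[of x l n]
  by (cases "fst x") (auto simp: lmul_def bmul_def idl_def src_def prod_eq_iff)

lemma lmul_idl_right: "x \<in> letters l n \<Longrightarrow> tgt x = p \<Longrightarrow> lmul l x (idl p) = Some x"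
  using nf_letter[of x l n]
  by (auto simp: lmul_def bmul_def idl_def tgt_def prod_eq_iff)

lemma idl_in_letters: "idl p \<in> letters l n \<longleftrightarrow> fst p \<le> l \<and> snd p \<in> {1..n}"
  by (auto simp: idl_def letters_def zigzag_basis_def basis_z_def basis_c_def basis_1_def)

lemma src_letter: "x \<in> letters l n \<Longrightarrow> fst (src x) \<le> l \<and> snd (src x) \<in> {1..n}"
  by (auto simp: src_def letters_def zigzag_basis_def basis_z_def basis_c_def basis_1_def)

lemma tgt_letter: "x \<in> letters l n \<Longrightarrow> fst (tgt x) \<le> l \<and> snd (tgt x) \<in> {1..n}"
  by (auto simp: tgt_def letters_def zigzag_basis_def basis_z_def basis_c_def basis_1_def)

lemma finite_letters [simp]: "finite (letters l n)"
  by (simp add: letters_def)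

lemma finite_words [simp]: "finite (words l n d)"
  using finite_lists_length_eq[of "letters l n" d] by (simp add: words_def conj_commute)

lemma words_nth: "w \<in> words l n d \<Longrightarrow> i < d \<Longrightarrow> w ! i \<in> letters l n"
  by (auto simp: words_def)

lemma words_length: "w \<in> words l n d \<Longrightarrow> length w = d"
  by (auto simp: words_def)

lemma wordsI: "length w = d \<Longrightarrow> (\<And>i. i < d \<Longrightarrow> w ! i \<in> letters l n) \<Longrightarrow> w \<in> words l n d"
  by (simp add: words_def) (metis in_set_conv_nth subsetI)

lemma word_eqI:
  "v \<in> words l n d \<Longrightarrow> w \<in> words l n d \<Longrightarrow> (\<And>i. i < d \<Longrightarrow> v ! i = w ! i) \<Longrightarrow> v = w"
  by (auto simp: words_def intro: nth_equalityI)

lemma wmul_iff: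
  "wmul l u v = Some w \<longleftrightarrow> length u = length w \<and> length v = length w \<and>
    (\<forall>i<length w. lmul l (u ! i) (v ! i) = Some (w ! i))"
proof (induction l u v arbitrary: w rule: wmul.induct)
  case (2 l x u y v)
  show ?case
  proof (cases w)
    case (Cons z w')
    then show ?thesis using 2[of _ w']
      by (cases "lmul l x y") (auto simp: less_Suc_eq_0_disj)
  qed (auto split: bind_splits)
qed auto

lemma wmul_SomeD:
  assumes "wmul l u v = Some w" "u \<in> words l n d" "v \<in> words l n d"
  shows "w \<in> words l n d" "map src w = map src u" "map tgt w = map tgt v" "map tgt u = map src v"
proof -
  have *: "length u = length w" "length v = length w"
    "\<And>i. i < length w \<Longrightarrow> lmul l (u ! i) (v ! i) = Some (w ! i)"
    using assms(1) by (auto simp: wmul_iff)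
  have d: "length w = d" using * assms words_length by metis
  have L: "u ! i \<in> letters l n" "v ! i \<in> letters l n" if "i < d" for i
    using that assms words_nth by blast+
  have D: "tgt (u ! i) = src (v ! i)" "src (w ! i) = src (u ! i)" "tgt (w ! i) = tgt (v ! i)"
    if "i < d" for i
    using lmul_SomeD[OF *(3)[of i] letters_ne letters_ne] L[OF that] that d by blast+
  show "w \<in> words l n d"
    using * d L lmul_closed by (intro wordsI) blast+
  show "map src w = map src u" "map tgt w = map tgt v" "map tgt u = map src v"
    using * d D by (auto intro!: nth_equalityI)
qed

lemma wmul_right_cancel:
  assumes "wmul l u v = Some w" "wmul l u' v = Some w" "u \<in> words l n d" "u' \<in> words l n d"
    "v \<in> words l n d"
  shows "u = u'"
proof (rule word_eqI[OF assms(3,4)])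
  fix i assume i: "i < d"
  have "length w = d" using assms by (auto simp: wmul_iff words_length)
  then have "lmul l (u ! i) (v ! i) = Some (w ! i)" "lmul l (u' ! i) (v ! i) = Some (w ! i)"
    using assms(1,2) i by (auto simp: wmul_iff)
  then show "u ! i = u' ! i"
    using lmul_right_cancel words_nth[OF assms(3) i] words_nth[OF assms(4) i] words_nth[OF assms(5) i]
    by blast
qed

lemma wmul_left_cancel:
  assumes "wmul l v u = Some w" "wmul l v u' = Some w" "u \<in> words l n d" "u' \<in> words l n d"
    "v \<in> words l n d"
  shows "u = u'"
proof (rule word_eqI[OF assms(3,4)])
  fix i assume i: "i < d"
  have "length w = d" using assms by (auto simp: wmul_iff words_length)
  then have "lmul l (v ! i) (u ! i) = Some (w ! i)" "lmul l (v ! i) (u' ! i) = Some (w ! i)"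
    using assms(1,2) i by (auto simp: wmul_iff)
  then show "u ! i = u' ! i"
    using lmul_left_cancel words_nth[OF assms(3) i] words_nth[OF assms(4) i] words_nth[OF assms(5) i]
    by blast
qed

lemma wmul_assoc:
  assumes "u \<in> words l n d" "v \<in> words l n d" "w \<in> words l n d"
  shows "Option.bind (wmul l u v) (\<lambda>t. wmul l t w) = Option.bind (wmul l v w) (wmul l u)"
proof -
  have ne: "\<forall>x\<in>set u \<union> set v \<union> set w. fst x \<noteq> []" "length u = length v" "length v = length w"
    using assms letters_ne[of _ l n] by (auto simp: words_def)
  from ne(2,3,1) show ?thesis
  proof (induction u v w rule: list_induct3)
    case (Cons x u y v z w)
    then have 1: "Option.bind (lmul l x y) (\<lambda>t. lmul l t z) = Option.bind (lmul l y z) (lmul l x)"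
      by (intro lmul_assoc) auto
    from Cons have 2: "Option.bind (wmul l u v) (\<lambda>t. wmul l t w) = Option.bind (wmul l v w) (wmul l u)"
      by auto
    show ?case using 1 2
      by (cases "lmul l x y"; cases "lmul l y z"; cases "wmul l u v"; cases "wmul l v w")
        (auto split: option.splits bind_splits)
  qed simp
qed

section \<open>Coordinates of tensors: products of words, the unit and the idempotent\<close>

lemma lookup_pure_tensor:
  "lookup (pure_tensor xs) w =
    (if length w = length xs then \<Prod>i<length xs. lookup (xs ! i) (w ! i) else 0)"
proof (induction xs arbitrary: w)
  case Nil
  then show ?case by (auto simp: lookup_single when_def)
next
  case (Cons x xs)
  show ?case
  proof (cases w)
    case Nil
    then show ?thesis by (simp add: lookup_bilin_extend lookup_single when_def)
  next
    case (Cons a w')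
    have "lookup (pure_tensor (x # xs)) w =
        (\<Sum>b\<in>keys x. \<Sum>v\<in>keys (pure_tensor xs). if b = a then
          if v = w' then lookup x a * lookup (pure_tensor xs) w' else 0 else 0)"
      unfolding pure_tensor.simps lookup_bilin_extend
      by (intro sum.cong refl) (auto simp: Cons lookup_single when_def)
    also have "\<dots> = (\<Sum>b\<in>keys x. if b = a then lookup x a * lookup (pure_tensor xs) w' else 0)"
      by (intro sum.cong refl) (auto simp: in_keys_iff)
    also have "\<dots> = lookup x a * lookup (pure_tensor xs) w'"
      by (auto simp: in_keys_iff)
    finally show ?thesis
      by (simp add: Cons Cons.IH lessThan_Suc_eq_insert_0 prod.reindex lessThan_Suc_atMost prod.lessThan_Suc_shift del: prod.lessThan_Suc)
  qed
qed

lemma pure_tensor_opt_single: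
  assumes "length u = length v"
  shows "pure_tensor (map2 (\<lambda>x y. opt_single 1 (lmul l x y)) u v) = opt_single 1 (wmul l u v)"
  using assms
proof (induction u v rule: list_induct2)
  case (Cons x u y v)
  then show ?case by (cases "lmul l x y"; cases "wmul l u v") auto
qed simp


definition eps :: "tensor_word \<Rightarrow> tensor_word \<Rightarrow> 'k::comm_ring_1"
  where "eps v w = (- 1) ^ card {(i, j). j < i \<and> i < length v \<and> odd_letter (v ! i) \<and> odd_letter (w ! j)}"

context
  fixes l n :: nat
  assumes l1: "l \<ge> 1"
begin

interpretation Z: ring "ext_zigzag l :: (path \<Rightarrow>\<^sub>0 'k::comm_ring_1) set ring"
  by (rule ext_zigzag_ring[OF l1])

lemma path_class_closed:
  "b \<in> quiver_paths l \<Longrightarrow> path_class l b \<in> carrier (ext_zigzag l :: (path \<Rightarrow>\<^sub>0 'k::comm_ring_1) set ring)"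
  using cls_eq_proj[OF l1, of "single b (1::'k)"] keys_proj[of "single b (1::'k)" l]
  by (auto simp: path_class_eq ext_zigzag_carrier[OF l1])

lemma coords_zero: "coords l \<zero>\<^bsub>ext_zigzag l\<^esub> = (0 :: path \<Rightarrow>\<^sub>0 'k::comm_ring_1)"
  by (simp add: ext_zigzag_zero[OF l1] coords_cls[OF l1])

lemma coords_cls_proj: "keys x \<subseteq> quiver_paths l \<Longrightarrow> coords l (cls l x) = proj l x"
  by (simp add: cls_def zigzag_coset[OF l1])

lemma coords_path_class_mult:
  assumes "b \<in> quiver_paths l" "b' \<in> quiver_paths l"
  shows "coords l (path_class l b \<otimes>\<^bsub>ext_zigzag l\<^esub> path_class l b')
    = (opt_single 1 (bmul l b b') :: path \<Rightarrow>\<^sub>0 'k::comm_ring_1)"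
  using assms path_algebra_mult_closed[of "single b (1::'k)" l "single b' 1"]
  by (simp add: path_class_eq ext_zigzag_ops[OF l1] coords_cls_proj proj_path_comp)

lemma xi_mult:
  assumes "a \<in> carrier (ext_zigzag l)" "b \<in> carrier (ext_zigzag l)" "s \<in> {1..n}"
  shows "xi (ext_zigzag l) a r s \<otimes>\<^bsub>matrix_ring (ext_zigzag l) n\<^esub> xi (ext_zigzag l) b r' s'
    = (if s = r' then xi (ext_zigzag l) (a \<otimes>\<^bsub>ext_zigzag l\<^esub> b :: (path \<Rightarrow>\<^sub>0 'k::comm_ring_1) set) r s'
       else (\<lambda>_ _. \<zero>\<^bsub>ext_zigzag l\<^esub>))"
proof (intro ext)
  fix i j
  let ?Z = "ext_zigzag l :: (path \<Rightarrow>\<^sub>0 'k) set ring"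
  let ?c = "if i = r \<and> s = r' \<and> j = s' then a \<otimes>\<^bsub>?Z\<^esub> b else \<zero>\<^bsub>?Z\<^esub>"
  have "(\<Oplus>\<^bsub>?Z\<^esub>t\<in>{1..n}. xi ?Z a r s i t \<otimes>\<^bsub>?Z\<^esub> xi ?Z b r' s' t j)
      = (\<Oplus>\<^bsub>?Z\<^esub>t\<in>{1..n}. if s = t then ?c else \<zero>\<^bsub>?Z\<^esub>)"
    using assms by (intro Z.finsum_cong') (auto simp: xi_def)
  also have "\<dots> = ?c"
    using assms Z.finsum_singleton[of s "{1..n}" "\<lambda>_. ?c"] by simp
  finally show "(xi ?Z a r s \<otimes>\<^bsub>matrix_ring ?Z n\<^esub> xi ?Z b r' s') i j =
      (if s = r' then xi ?Z (a \<otimes>\<^bsub>?Z\<^esub> b) r s' else (\<lambda>_ _. \<zero>\<^bsub>?Z\<^esub>)) i j"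
    by (auto simp: matrix_ring_def xi_def)
qed

lemma lookup_matrix_coords:
  assumes "\<And>r s. r \<in> {1..n} \<Longrightarrow> s \<in> {1..n} \<Longrightarrow> x r s = coords l (A r s)"
  shows "lookup (matrix_coords l n A) (b, r, s) =
    (if r \<in> {1..n} \<and> s \<in> {1..n} then lookup (x r s :: path \<Rightarrow>\<^sub>0 'k::comm_ring_1) b else 0)"
proof -
  have *: "lookup (lin_extend (\<lambda>b. single (b, r', s') 1) y) (b, r, s)
      = (if r' = r then if s' = s then lookup y b else 0 else 0)"
    for r' s' and y :: "path \<Rightarrow>\<^sub>0 'k"
    by (auto simp: lookup_lin_extend lookup_single when_def in_keys_iff if_distrib cong: if_cong)
  have "lookup (matrix_coords l n A) (b, r, s) =
      (\<Sum>r'\<in>{1..n}. \<Sum>s'\<in>{1..n}. if r' = r then if s' = s then lookup (coords l (A r s)) b else 0 else 0)"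
    unfolding matrix_coords_def lookup_sum * by (intro sum.cong refl) auto
  also have "\<dots> = (\<Sum>r'\<in>{1..n}. if r' = r then (if s \<in> {1..n} then lookup (coords l (A r s)) b else 0) else 0)"
    by (intro sum.cong refl) auto
  also have "\<dots> = (if r \<in> {1..n} \<and> s \<in> {1..n} then lookup (coords l (A r s)) b else 0)"
    by simp
  finally show ?thesis using assms by simp
qed

lemma matrix_coords_letter_mult:
  assumes "x \<in> letters l n" "y \<in> letters l n"
  shows "matrix_coords l n (letter_matrix l x \<otimes>\<^bsub>matrix_ring (ext_zigzag l) n\<^esub> letter_matrix l y)
    = (opt_single 1 (lmul l x y) :: letter \<Rightarrow>\<^sub>0 'k::comm_ring_1)"
proof (rule poly_mapping_eqI)
  fix z :: letter
  obtain b r s b' r' s' where [simp]: "x = (b, r, s)" "y = (b', r', s')" by (metis prod_cases3)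
  obtain c i j where [simp]: "z = (c, i, j)" by (metis prod_cases3)
  have b: "b \<in> quiver_paths l" "b' \<in> quiver_paths l" and i: "r \<in> {1..n}" "s \<in> {1..n}" "s' \<in> {1..n}"
    using assms zigzag_basis_subset by (auto simp: letters_def)
  let ?A = "letter_matrix l x \<otimes>\<^bsub>matrix_ring (ext_zigzag l) n\<^esub> letter_matrix l y
    :: nat \<Rightarrow> nat \<Rightarrow> (path \<Rightarrow>\<^sub>0 'k) set"
  have A: "?A = (if s = r' then xi (ext_zigzag l) (path_class l b \<otimes>\<^bsub>ext_zigzag l\<^esub> path_class l b') r s'
      else (\<lambda>_ _. \<zero>\<^bsub>ext_zigzag l\<^esub>))"
    unfolding letter_matrix_def using b i by (simp add: xi_mult path_class_closed)
  have "coords l (?A i j) = (if s = r' \<and> i = r \<and> j = s' then opt_single 1 (bmul l b b') else 0)"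
    for i j
    unfolding A using b by (simp add: xi_def coords_path_class_mult coords_zero)
  then show "lookup (matrix_coords l n ?A) z = lookup (opt_single 1 (lmul l x y)) z"
    using i by (cases "bmul l b b'")
      (auto simp: lookup_matrix_coords[OF refl] lmul_def lookup_single when_def)
qed

text \<open>This replaces matrices over a quotient ring by combinatorics: from here on the
  multiplication is \<open>wmul\<close> together with the sign \<open>eps\<close>.\<close>

lemma word_mult_eq:
  assumes "u \<in> words l n d" "v \<in> words l n d"
  shows "word_mult l n u v = (opt_single (eps u v) (wmul l u v) :: _ \<Rightarrow>\<^sub>0 'k::comm_ring_1)"
proof -
  have "map (matrix_coords l n) (map2 (\<lambda>x y. letter_matrix l x \<otimes>\<^bsub>matrix_ring (ext_zigzag l) n\<^esub> letter_matrix l y) u v)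
      = (map2 (\<lambda>x y. opt_single 1 (lmul l x y)) u v :: (_ \<Rightarrow>\<^sub>0 'k) list)"
    using words_length[OF assms(1)] words_length[OF assms(2)] words_nth[OF assms(1)] words_nth[OF assms(2)]
    by (intro nth_equalityI) (simp_all add: matrix_coords_letter_mult)
  then have "word_mult l n u v = scale (eps u v) (opt_single 1 (wmul l u v) :: _ \<Rightarrow>\<^sub>0 'k)"
    using assms unfolding word_mult_def tensor_def eps_def
    by (simp only: pure_tensor_opt_single words_length)
  then show ?thesis by (cases "wmul l u v") (simp_all add: scale_single)
qed

text \<open>One computation serves the unit, with \<open>I = {0..l}\<close>, and the idempotent
  \<open>xi_e\<close>, with \<open>I = {..<l}\<close>: each is a tensor power of a diagonal matrix
  whose entry is a sum of vertex idempotents.\<close>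

lemma lookup_tensor_diagonal:
  fixes z :: "(path \<Rightarrow>\<^sub>0 'k::comm_ring_1) set"
  assumes z: "coords l z = (\<Sum>i\<in>I. single [i] 1)" and I: "finite I"
  shows "lookup (tensor l n (replicate d (\<lambda>r s. if r = s \<and> r \<in> {1..n} then z else \<zero>\<^bsub>ext_zigzag l\<^esub>))) w
    = (if length w = d \<and> (\<forall>i<d. \<exists>p. w ! i = idl p \<and> fst p \<in> I \<and> snd p \<in> {1..n}) then 1 else 0)"
proof -
  let ?A = "\<lambda>r s. if r = s \<and> r \<in> {1..n} then z else \<zero>\<^bsub>ext_zigzag l\<^esub>"
  have 1: "lookup (coords l z) b = (if \<exists>i\<in>I. b = [i] then 1 else 0)" for b
  proof -
    have "lookup (coords l z) b = (\<Sum>i\<in>I. if b = [i] then 1 else 0)"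
      unfolding z lookup_sum by (intro sum.cong) (auto simp: lookup_single when_def)
    also have "\<dots> = (if \<exists>i\<in>I. b = [i] then 1 else 0)"
    proof (cases "\<exists>i\<in>I. b = [i]")
      case True
      then obtain j where "j \<in> I" "b = [j]" by blast
      then show ?thesis using I by simp
    qed (auto intro!: sum.neutral)
    finally show ?thesis .
  qed
  have "lookup (matrix_coords l n ?A) x
      = (if \<exists>p. x = idl p \<and> fst p \<in> I \<and> snd p \<in> {1..n} then 1 else 0)" for x
  proof -
    obtain b r s where "x = (b, r, s)" by (metis prod_cases3)
    then show ?thesis
      using lookup_matrix_coords[of "\<lambda>r s. if r = s then coords l z else 0" ?A b r s]
      by (auto simp: coords_zero 1 idl_def)
  qed
  then have "lookup (tensor l n (replicate d ?A)) w = (if length w = d then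
      \<Prod>i<d. if \<exists>p. w ! i = idl p \<and> fst p \<in> I \<and> snd p \<in> {1..n} then 1 else 0 else 0)"
    by (auto simp: tensor_def lookup_pure_tensor intro!: prod.cong)
  also have "\<dots> = (if length w = d \<and> (\<forall>i<d. \<exists>p. w ! i = idl p \<and> fst p \<in> I \<and> snd p \<in> {1..n}) then 1 else 0)"
  proof (cases "\<forall>i<d. \<exists>p. w ! i = idl p \<and> fst p \<in> I \<and> snd p \<in> {1..n}")
    case True
    then show ?thesis by (auto intro!: prod.neutral)
  next
    case False
    then show ?thesis by (auto intro!: prod_zero)
  qed
  finally show ?thesis .
qed

lemma matrix_E_eq:
  assumes "z \<in> carrier (ext_zigzag l)"
  shows "matrix_E l n z = (\<lambda>r s. if r = s \<and> r \<in> {1..n} then z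
    else (\<zero>\<^bsub>ext_zigzag l\<^esub> :: (path \<Rightarrow>\<^sub>0 'k::comm_ring_1) set))"
proof -
  let ?Z = "ext_zigzag l :: (path \<Rightarrow>\<^sub>0 'k) set ring"
  let ?M = "matrix_ring ?Z n"
  interpret M: abelian_monoid ?M
    by (rule abelian_monoidI) (auto simp: matrix_ring_def Z.a_assoc intro!: ext Z.a_comm)
  have "(\<Oplus>\<^bsub>?M\<^esub>r\<in>A. xi ?Z z r r) = (\<lambda>r s. if r = s \<and> r \<in> A then z else \<zero>\<^bsub>?Z\<^esub>)"
    if "finite A" "A \<subseteq> {1..n}" for A
    using that
  proof (induction A rule: finite_induct)
    case (insert a A)
    have "xi ?Z z r r \<in> carrier ?M" if "r \<in> {1..n}" for r
      using assms that by (auto simp: xi_def matrix_ring_def)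
    then have "(\<Oplus>\<^bsub>?M\<^esub>r\<in>insert a A. xi ?Z z r r) = xi ?Z z a a \<oplus>\<^bsub>?M\<^esub> (\<Oplus>\<^bsub>?M\<^esub>r\<in>A. xi ?Z z r r)"
      using insert by (intro M.finsum_insert) auto
    also have "\<dots> = (\<lambda>r s. if r = s \<and> r \<in> insert a A then z else \<zero>\<^bsub>?Z\<^esub>)"
      using insert assms by (auto simp: matrix_ring_def xi_def fun_eq_iff)
    finally show ?case .
  next
    case empty
    show ?case unfolding M.finsum_empty by (simp add: matrix_ring_def)
  qed
  then show ?thesis by (simp add: matrix_E_def)
qed

lemma zigzag_e_eq:
  "zigzag_e l = cls l (\<Sum>i\<in>{..<l}. single [i] (1::'k::comm_ring_1))"
proof -
  let ?Z = "ext_zigzag l :: (path \<Rightarrow>\<^sub>0 'k) set ring"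
  have *: "keys (\<Sum>i\<in>A. single [i] (1::'k)) \<subseteq> quiver_paths l" if "A \<subseteq> {..<l}" for A
    using that keys_sum[of "\<lambda>i. single [i] (1::'k)" A] by (fastforce simp: quiver_paths_def split: if_splits)
  have "(\<Oplus>\<^bsub>?Z\<^esub>j\<in>A. path_class l [j]) = cls l (\<Sum>i\<in>A. single [i] 1)" if "finite A" "A \<subseteq> {..<l}" for A
    using that
  proof (induction A rule: finite_induct)
    case empty
    then show ?case by (simp add: ext_zigzag_zero[OF l1])
  next
    case (insert a A)
    have q: "[j] \<in> quiver_paths l" if "j < l" for j using that by (auto simp: quiver_paths_def)
    have "(\<Oplus>\<^bsub>?Z\<^esub>j\<in>insert a A. path_class l [j]) = path_class l [a] \<oplus>\<^bsub>?Z\<^esub> (\<Oplus>\<^bsub>?Z\<^esub>j\<in>A. path_class l [j])"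
      using insert q by (intro Z.finsum_insert) (auto intro!: path_class_closed)
    then show ?case using insert q[of a] *[of A]
      by (simp add: path_class_eq ext_zigzag_ops[OF l1])
  qed
  then show ?thesis by (simp add: zigzag_e_def)
qed

lemma lookup_tensor_one:
  "lookup (tensor l n (replicate d \<one>\<^bsub>matrix_ring (ext_zigzag l) n\<^esub>)) w =
    (if length w = d \<and> (\<forall>i<d. \<exists>p. w ! i = idl p \<and> fst p \<le> l \<and> snd p \<in> {1..n}) then 1 else (0::'k::comm_ring_1))"
proof -
  have "keys (\<Sum>i\<in>{0..l}. single [i] (1::'k)) \<subseteq> zigzag_basis l"
    using keys_sum[of "\<lambda>i. single [i] (1::'k)" "{0..l}"]
    by (fastforce simp: zigzag_basis_def basis_z_def split: if_splits)
  then have "coords l \<one>\<^bsub>ext_zigzag l\<^esub> = (\<Sum>i\<in>{0..l}. single [i] (1::'k))"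
    by (simp add: ext_zigzag_one coords_cls[OF l1])
  from lookup_tensor_diagonal[OF this, of d w] show ?thesis
    by (simp add: matrix_ring_def)
qed

lemma lookup_xi_e:
  "lookup (xi_e l n d) w =
    (if length w = d \<and> (\<forall>i<d. \<exists>p. w ! i = idl p \<and> fst p < l \<and> snd p \<in> {1..n}) then 1 else (0::'k::comm_ring_1))"
proof -
  have k: "keys (\<Sum>i\<in>{..<l}. single [i] (1::'k)) \<subseteq> zigzag_basis l"
    using keys_sum[of "\<lambda>i. single [i] (1::'k)" "{..<l}"]
    by (fastforce simp: zigzag_basis_def basis_z_def split: if_splits)
  then have c: "coords l (zigzag_e l) = (\<Sum>i\<in>{..<l}. single [i] (1::'k))"
    by (simp add: zigzag_e_eq coords_cls[OF l1])
  moreover have "(zigzag_e l :: (path \<Rightarrow>\<^sub>0 'k) set) \<in> carrier (ext_zigzag l)"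
    using k by (auto simp: zigzag_e_eq ext_zigzag_carrier[OF l1])
  ultimately show ?thesis using lookup_tensor_diagonal[OF c, of d w]
    by (simp add: xi_e_def matrix_E_eq)
qed

end


section \<open>Signs and symmetric tensors\<close>


abbreviation pinv :: "('a \<Rightarrow> 'b) \<Rightarrow> 'b \<Rightarrow> 'a" where "pinv \<equiv> inv_into UNIV"

lemma neg_one_power_card:
  "finite F \<Longrightarrow> (- 1) ^ card {x \<in> F. P x} = (\<Prod>x\<in>F. if P x then - 1 else (1::'k::comm_ring_1))"
  by (simp add: prod.If_cases Int_def)

definition psign :: "(nat \<Rightarrow> nat) \<Rightarrow> tensor_word \<Rightarrow> 'k::comm_ring_1"
  where "psign \<sigma> w = (- 1) ^ odd_inversions \<sigma> w"

text \<open>With a sign written as a product over all pairs of positions, identities between signs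
  can be checked pair by pair, and permuting positions is a reindexing.\<close>

lemma eps_prod:
  assumes "length u = d"
  shows "eps u v = (\<Prod>(i, j)\<in>{..<d} \<times> {..<d}.
    if j < i \<and> odd_letter (u ! i) \<and> odd_letter (v ! j) then - 1 else (1::'k::comm_ring_1))"
proof -
  have "{(i, j). j < i \<and> i < length u \<and> odd_letter (u ! i) \<and> odd_letter (v ! j)}
      = {x \<in> {..<d} \<times> {..<d}. snd x < fst x \<and> odd_letter (u ! fst x) \<and> odd_letter (v ! snd x)}"
    using assms by auto
  then show ?thesis unfolding eps_def
    by (simp add: neg_one_power_card case_prod_unfold)
qed

lemma psign_prod:
  assumes "length w = d"
  shows "psign \<sigma> w = (\<Prod>(i, j)\<in>{..<d} \<times> {..<d}.
    if i < j \<and> pinv \<sigma> j < pinv \<sigma> i \<and> odd_letter (w ! i) \<and> odd_letter (w ! j)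
    then - 1 else (1::'k::comm_ring_1))"
proof -
  have "{(i, j). i < j \<and> j < length w \<and> pinv \<sigma> i > pinv \<sigma> j \<and> odd_letter (w ! i) \<and> odd_letter (w ! j)}
      = {x \<in> {..<d} \<times> {..<d}. fst x < snd x \<and> pinv \<sigma> (snd x) < pinv \<sigma> (fst x) \<and>
          odd_letter (w ! fst x) \<and> odd_letter (w ! snd x)}"
    using assms by auto
  then show ?thesis unfolding psign_def odd_inversions_def
    by (simp add: neg_one_power_card case_prod_unfold)
qed

lemma eps_square [simp]: "eps u v * eps u v = (1::'k::comm_ring_1)"
  by (simp add: eps_def flip: power_add mult_2)

lemma psign_square [simp]: "psign \<sigma> w * psign \<sigma> w = (1::'k::comm_ring_1)"
  by (simp add: psign_def flip: power_add mult_2)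

lemma eps_cong:
  assumes "length u = length u'" "\<And>i. i < length u \<Longrightarrow> odd_letter (u ! i) = odd_letter (u' ! i)"
    "\<And>i. i < length u \<Longrightarrow> odd_letter (v ! i) = odd_letter (v' ! i)"
  shows "eps u v = (eps u' v' :: 'k::comm_ring_1)"
proof -
  have "{(i, j). j < i \<and> i < length u \<and> odd_letter (u ! i) \<and> odd_letter (v ! j)} =
      {(i, j). j < i \<and> i < length u' \<and> odd_letter (u' ! i) \<and> odd_letter (v' ! j)}"
    using assms by auto
  then show ?thesis by (simp add: eps_def)
qed

lemma eps_even_right:
  "(\<And>i. i < length u \<Longrightarrow> \<not> odd_letter (v ! i)) \<Longrightarrow> eps u v = 1"
  by (simp add: eps_prod[OF refl]) (auto intro!: prod.neutral)

lemma eps_even_left: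
  "(\<And>i. i < length u \<Longrightarrow> \<not> odd_letter (u ! i)) \<Longrightarrow> eps u v = 1"
  by (simp add: eps_prod[OF refl]) (auto intro!: prod.neutral)

text \<open>Parities add under products, so for each pair \<open>j < i\<close> both sides count,
  modulo two, the odd pairs formed from \<open>u ! i\<close> and \<open>v ! j\<close>, from
  \<open>u ! i\<close> and \<open>w ! j\<close>, and from \<open>v ! i\<close> and
  \<open>w ! j\<close>. This is the sign part of associativity.\<close>

lemma eps_cocycle:
  assumes "length u = d" "length v = d" "length w = d" "length t = d" "length t' = d"
    and "\<And>i. i < d \<Longrightarrow> odd_letter (t ! i) = (odd_letter (u ! i) \<noteq> odd_letter (v ! i))"
    and "\<And>i. i < d \<Longrightarrow> odd_letter (t' ! i) = (odd_letter (v ! i) \<noteq> odd_letter (w ! i))"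
  shows "eps u v * eps t w = (eps v w * eps u t' :: 'k::comm_ring_1)"
  using assms by (simp add: eps_prod[of _ d] flip: prod.distrib) (auto intro!: prod.cong)

lemma bij_betw_map_prod_permutes:
  "\<sigma> permutes A \<Longrightarrow> bij_betw (map_prod \<sigma> \<sigma>) (A \<times> A) (A \<times> A)"
  by (intro bij_betw_map_prod) (auto simp: permutes_imp_bij)

lemma prod_permute_pairs:
  assumes "\<sigma> permutes A"
  shows "(\<Prod>(i, j)\<in>A \<times> A. f i j) = (\<Prod>(i, j)\<in>A \<times> A. f (pinv \<sigma> i) (pinv \<sigma> j))"
  using prod.reindex_bij_betw[OF bij_betw_map_prod_permutes[OF assms],
      of "\<lambda>(i, j). f (pinv \<sigma> i) (pinv \<sigma> j)"] permutes_inverses(2)[OF assms]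
  by (simp add: case_prod_unfold)

lemma prod_swap_pairs:
  "(\<Prod>(i, j)\<in>A \<times> A. f i j) = (\<Prod>(i, j)\<in>A \<times> A. f j i)"
proof -
  have "bij_betw prod.swap (A \<times> A) (A \<times> A)"
    by (rule bij_betwI[of _ _ _ prod.swap]) auto
  from prod.reindex_bij_betw[OF this, of "\<lambda>(i, j). f i j"] show ?thesis
    by (simp add: case_prod_unfold)
qed

text \<open>Only pairs inverted by \<sigma> matter. \<open>X\<close> and \<open>Y\<close> collect
  those with one odd letter in \<open>u\<close> and one in \<open>v\<close>. The permuted
  \<open>eps\<close> gains the factor \<open>X * Y\<close>, and so does the sign of the product
  word, whose parities are the sums of those of \<open>u\<close> and \<open>v\<close>. The lemma
  makes the signed action compatible with multiplication.\<close>

lemma eps_permute: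
  assumes \<sigma>: "\<sigma> permutes {..<d}"
    and len: "length u = d" "length v = d" "length w = d"
    and odd: "\<And>i. i < d \<Longrightarrow> odd_letter (w ! i) = (odd_letter (u ! i) \<noteq> odd_letter (v ! i))"
  shows "psign \<sigma> u * psign \<sigma> v * eps (permute_list \<sigma> u) (permute_list \<sigma> v)
    = (eps u v * psign \<sigma> w :: 'k::comm_ring_1)"
proof -
  let ?D = "{..<d} \<times> {..<d}"
  let ?\<tau> = "pinv \<sigma>"
  define X :: 'k where "X = (\<Prod>(i, j)\<in>?D. if i < j \<and> ?\<tau> j < ?\<tau> i \<and> odd_letter (u ! i) \<and> odd_letter (v ! j) then - 1 else 1)"
  define Y :: 'k where "Y = (\<Prod>(i, j)\<in>?D. if i < j \<and> ?\<tau> j < ?\<tau> i \<and> odd_letter (v ! i) \<and> odd_letter (u ! j) then - 1 else 1)"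
  have Y: "Y = (\<Prod>(i, j)\<in>?D. if j < i \<and> ?\<tau> i < ?\<tau> j \<and> odd_letter (u ! i) \<and> odd_letter (v ! j) then - 1 else 1)"
    unfolding Y_def by (subst prod_swap_pairs) (auto intro!: prod.cong)
  have "eps (permute_list \<sigma> u) (permute_list \<sigma> v) = (\<Prod>(i, j)\<in>?D.
      if j < i \<and> odd_letter (u ! \<sigma> i) \<and> odd_letter (v ! \<sigma> j) then - 1 else (1::'k))"
    using \<sigma> len by (auto simp: eps_prod[of _ d] permute_list_nth intro!: prod.cong)
  also have "\<dots> = (\<Prod>(i, j)\<in>?D.
      if ?\<tau> j < ?\<tau> i \<and> odd_letter (u ! i) \<and> odd_letter (v ! j) then - 1 else (1::'k))"
    using permutes_inverses(1)[OF \<sigma>] by (subst prod_permute_pairs[OF \<sigma>]) simp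
  also have "\<dots> = X * Y * eps u v"
  proof -
    have "?\<tau> i \<noteq> ?\<tau> j" if "i \<noteq> j" for i j
      using that permutes_inverses(1)[OF \<sigma>] by metis
    then show ?thesis
      unfolding X_def Y eps_prod[OF len(1)] prod.distrib[symmetric]
      by (intro prod.cong refl) (auto simp: not_less_iff_gr_or_eq)
  qed
  finally have 1: "eps (permute_list \<sigma> u) (permute_list \<sigma> v) = X * Y * eps u v" .
  have 2: "psign \<sigma> w = psign \<sigma> u * psign \<sigma> v * (X * Y)"
    unfolding X_def Y_def psign_prod[OF len(1)] psign_prod[OF len(2)] psign_prod[OF len(3)]
      prod.distrib[symmetric]
    using odd by (intro prod.cong refl) auto
  show ?thesis unfolding 1 2 by (simp add: mult_ac)
qed

lemma prod_pairs_ordered: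
  fixes f :: "nat \<Rightarrow> nat \<Rightarrow> 'k::comm_ring_1"
  assumes "\<And>i. f i i = 1"
  shows "(\<Prod>(i, j)\<in>A \<times> A. f i j) = (\<Prod>(i, j)\<in>A \<times> A. if i < j then f i j * f j i else 1)"
proof -
  have "(\<Prod>(i, j)\<in>A \<times> A. if i < j then f i j * f j i else 1)
      = (\<Prod>(i, j)\<in>A \<times> A. if i < j then f i j else 1) * (\<Prod>(i, j)\<in>A \<times> A. if i < j then f j i else 1)"
    unfolding prod.distrib[symmetric] by (intro prod.cong) auto
  also have "(\<Prod>(i, j)\<in>A \<times> A. if i < j then f j i else 1) = (\<Prod>(i, j)\<in>A \<times> A. if j < i then f i j else 1)"
    by (subst prod_swap_pairs) simp
  also have "(\<Prod>(i, j)\<in>A \<times> A. if i < j then f i j else 1) * \<dots> = (\<Prod>(i, j)\<in>A \<times> A. f i j)"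
    unfolding prod.distrib[symmetric]
    using assms by (intro prod.cong) (auto simp: not_less_iff_gr_or_eq)
  finally show ?thesis ..
qed

text \<open>A pair \<open>i < j\<close> is inverted by the composite exactly when one of the two
  permutations inverts it and the other does not. The sign of \<rho> refers to positions already
  moved by \<sigma>, hence the permuted word.\<close>

lemma psign_compose:
  assumes \<sigma>: "\<sigma> permutes {..<d}" and \<rho>: "\<rho> permutes {..<d}" and len: "length w = d"
  shows "psign (\<sigma> \<circ> \<rho>) w = psign \<sigma> w * (psign \<rho> (permute_list \<sigma> w) :: 'k::comm_ring_1)"
proof -
  let ?D = "{..<d} \<times> {..<d}"
  let ?o = "\<lambda>i. odd_letter (w ! i)"
  have "psign \<rho> (permute_list \<sigma> w) = (\<Prod>(i, j)\<in>?D.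
      if i < j \<and> pinv \<rho> j < pinv \<rho> i \<and> ?o (\<sigma> i) \<and> ?o (\<sigma> j) then - 1 else (1::'k))"
    using \<sigma> len by (auto simp: psign_prod[of _ d] permute_list_nth intro!: prod.cong)
  also have "\<dots> = (\<Prod>(i, j)\<in>?D. if pinv \<sigma> i < pinv \<sigma> j \<and> pinv \<rho> (pinv \<sigma> j) < pinv \<rho> (pinv \<sigma> i) \<and>
      ?o i \<and> ?o j then - 1 else 1)"
    using permutes_inverses(1)[OF \<sigma>] by (subst prod_permute_pairs[OF \<sigma>]) simp
  \<comment> \<open>After reindexing, the pairs are ordered by their images under
    \<open>pinv \<sigma>\<close>; folding the product onto \<open>i < j\<close> makes it comparable
    with the other two signs.\<close>
  also have "\<dots> = (\<Prod>(i, j)\<in>?D. if i < j then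
      (if pinv \<sigma> i < pinv \<sigma> j \<and> pinv \<rho> (pinv \<sigma> j) < pinv \<rho> (pinv \<sigma> i) \<and> ?o i \<and> ?o j then - 1 else 1) *
      (if pinv \<sigma> j < pinv \<sigma> i \<and> pinv \<rho> (pinv \<sigma> i) < pinv \<rho> (pinv \<sigma> j) \<and> ?o j \<and> ?o i then - 1 else 1)
      else 1)"
    by (rule prod_pairs_ordered) simp
  finally have 1: "psign \<rho> (permute_list \<sigma> w) = \<dots>" .
  have inv: "pinv (\<sigma> \<circ> \<rho>) = pinv \<rho> \<circ> pinv \<sigma>"
    using permutes_bij[OF \<sigma>] permutes_bij[OF \<rho>] by (rule o_inv_distrib)
  have \<sigma>': "pinv \<sigma> i \<noteq> pinv \<sigma> j" and \<rho>': "pinv \<rho> i \<noteq> pinv \<rho> j" if "i \<noteq> j" for i j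
    using that permutes_inverses(1)[OF \<sigma>] permutes_inverses(1)[OF \<rho>] by metis+
  have *: "pinv \<rho> (pinv \<sigma> i) < pinv \<rho> (pinv \<sigma> j) \<longleftrightarrow> \<not> pinv \<rho> (pinv \<sigma> j) < pinv \<rho> (pinv \<sigma> i)"
    "pinv \<sigma> i < pinv \<sigma> j \<longleftrightarrow> \<not> pinv \<sigma> j < pinv \<sigma> i" if "i < j" for i j
    using \<sigma>'[of i j] \<rho>'[of "pinv \<sigma> i" "pinv \<sigma> j"] that by auto
  show ?thesis
    unfolding 1 psign_prod[OF len] prod.distrib[symmetric] inv o_apply
    using * by (intro prod.cong refl) auto
qed


lemma permute_list_words: "w \<in> words l n d \<Longrightarrow> \<sigma> permutes {..<d} \<Longrightarrow> permute_list \<sigma> w \<in> words l n d"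
  by (auto simp: words_def)

lemma permute_list_inv:
  assumes "\<sigma> permutes {..<length w}"
  shows "permute_list (pinv \<sigma>) (permute_list \<sigma> w) = w" "permute_list \<sigma> (permute_list (pinv \<sigma>) w) = w"
  using permute_list_compose[OF permutes_inv[OF assms], of \<sigma>] permute_list_compose[OF assms, of "pinv \<sigma>"]
    permutes_inv_o[OF assms] by simp_all

lemma wmul_permute:
  assumes \<sigma>: "\<sigma> permutes {..<d}" and w: "wmul l u v = Some w" and len: "length u = d"
  shows "wmul l (permute_list \<sigma> u) (permute_list \<sigma> v) = Some (permute_list \<sigma> w)"
proof -
  have *: "length u = length w" "length v = length w" "d = length w"
    "\<And>i. i < length w \<Longrightarrow> lmul l (u ! i) (v ! i) = Some (w ! i)"
    using w len by (auto simp: wmul_iff)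
  have "\<sigma> i < length w" if "i < length w" for i
    using permutes_in_image[OF \<sigma>, of i] that *(3) by auto
  then show ?thesis using * \<sigma> by (auto simp: wmul_iff permute_list_nth)
qed

lemma wmul_odd:
  assumes "wmul l u v = Some w" "u \<in> words l n d" "v \<in> words l n d" "i < d"
  shows "odd_letter (w ! i) = (odd_letter (u ! i) \<noteq> odd_letter (v ! i))"
proof (rule lmul_odd)
  show "lmul l (u ! i) (v ! i) = Some (w ! i)"
    using assms words_length[OF assms(2)] by (auto simp: wmul_iff)
  show "fst (u ! i) \<noteq> []" "fst (v ! i) \<noteq> []"
    using letters_ne words_nth[OF assms(2,4)] words_nth[OF assms(3,4)] by blast+
qed

lemma mset_eq_permute:
  assumes "mset v = mset w"
  obtains \<sigma> where "\<sigma> permutes {..<length w}" "v = permute_list \<sigma> w"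
  using mset_eq_permutation[OF assms] by metis


section \<open>Symmetrised words and the span of the elements eta\<close>

definition cfact :: "nat \<Rightarrow> nat \<Rightarrow> tensor_word \<Rightarrow> nat"
  where "cfact l n w = (\<Prod>x\<in>basis_c l \<times> {1..n} \<times> {1..n}. fact (count_list w x))"

text \<open>Invariance under the signed action, read off on coefficients:
  \<open>perm_act \<sigma>\<close> carries the word \<open>w\<close> to
  \<open>psign \<sigma> w\<close> times the permuted word.\<close>

definition supersym :: "nat \<Rightarrow> nat \<Rightarrow> nat \<Rightarrow> (tensor_word \<Rightarrow>\<^sub>0 'k::comm_ring_1) set"
  where "supersym l n d = {x. keys x \<subseteq> words l n d \<and>
    (\<forall>\<sigma> w. \<sigma> permutes {..<d} \<longrightarrow> w \<in> words l n d \<longrightarrow>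
      lookup x (permute_list \<sigma> w) = psign \<sigma> w * lookup x w)}"

definition Tset :: "nat \<Rightarrow> nat \<Rightarrow> nat \<Rightarrow> (tensor_word \<Rightarrow>\<^sub>0 'k::comm_ring_1) set"
  where "Tset l n d = {x \<in> supersym l n d. \<forall>w \<in> words l n d. of_nat (cfact l n w) dvd lookup x w}"

lemma supersymD:
  "x \<in> supersym l n d \<Longrightarrow> keys x \<subseteq> words l n d"
  "x \<in> supersym l n d \<Longrightarrow> \<sigma> permutes {..<d} \<Longrightarrow> w \<in> words l n d \<Longrightarrow>
    lookup x (permute_list \<sigma> w) = psign \<sigma> w * lookup x w"
  by (auto simp: supersym_def)

lemma lookup_notin_words: "keys x \<subseteq> words l n d \<Longrightarrow> w \<notin> words l n d \<Longrightarrow> lookup x w = 0"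
  by (auto simp: in_keys_iff)

lemma supersym_add: "x \<in> supersym l n d \<Longrightarrow> y \<in> supersym l n d \<Longrightarrow> x + y \<in> supersym l n d"
  using Poly_Mapping.keys_add[of x y] by (auto simp: supersym_def lookup_add distrib_left)

lemma supersym_scale: "x \<in> supersym l n d \<Longrightarrow> scale c x \<in> supersym l n d"
  using keys_scale[of c x] by (auto simp: supersym_def mult_ac)

lemma supersym_zero: "0 \<in> supersym l n d"
  by (auto simp: supersym_def)

lemma Tset_add: "x \<in> Tset l n d \<Longrightarrow> y \<in> Tset l n d \<Longrightarrow> x + y \<in> Tset l n d"
  by (auto simp: Tset_def supersym_add lookup_add)

lemma Tset_scale: "x \<in> Tset l n d \<Longrightarrow> scale c x \<in> Tset l n d"
  by (auto simp: Tset_def supersym_scale)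

lemma Tset_zero: "0 \<in> Tset l n d"
  by (auto simp: Tset_def supersym_zero)

lemma Tset_uminus: "x \<in> Tset l n d \<Longrightarrow> - x \<in> Tset l n d"
  using Tset_scale[of x l n d "- 1"] by simp

lemma Tri_words: "w \<in> Tri l n d \<Longrightarrow> w \<in> words l n d"
  by (simp add: Tri_def)

lemma Tri_length: "w \<in> Tri l n d \<Longrightarrow> length w = d"
  by (rule words_length[OF Tri_words])

lemma Tri_permute:
  assumes "w \<in> Tri l n d" "\<sigma> permutes {..<d}"
  shows "permute_list \<sigma> w \<in> Tri l n d"
proof -
  have len: "length w = d" using assms(1) by (rule Tri_length)
  have 1: "\<sigma> i < d" if "i < d" for i using permutes_in_image[OF assms(2), of i] that by auto
  have 2: "\<sigma> i \<noteq> \<sigma> j" if "i \<noteq> j" for i j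
    using that permutes_inj[OF assms(2)] by (auto dest: injD)
  have 3: "\<not> odd_letter (w ! i)" if "i < d" "j < d" "i \<noteq> j" "w ! i = w ! j" for i j
    using assms(1) that unfolding Tri_def by blast
  have 4: "permute_list \<sigma> w ! i = w ! \<sigma> i" if "i < d" for i
    using that assms(2) len by (simp add: permute_list_nth)
  show ?thesis
    unfolding Tri_def using permute_list_words[OF Tri_words[OF assms(1)] assms(2)]
  proof (intro CollectI conjI allI impI)
    fix i j assume "i < d" "j < d" "i \<noteq> j \<and> permute_list \<sigma> w ! i = permute_list \<sigma> w ! j"
    then show "\<not> odd_letter (permute_list \<sigma> w ! i)"
      using 3[of "\<sigma> i" "\<sigma> j"] 1 2 by (simp add: 4)
  qed
qed

text \<open>An odd letter occurs only once in a word of \<open>Tri\<close>, so a stabilising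
  permutation fixes its position and creates no odd inversion.\<close>

lemma psign_stabilizer:
  assumes w: "w \<in> Tri l n d" and \<tau>: "\<tau> permutes {..<d}" and st: "permute_list \<tau> w = w"
  shows "psign \<tau> w = (1::'k::comm_ring_1)"
proof -
  have len: "length w = d" using w by (rule Tri_length)
  have "pinv \<tau> i = i" if i: "i < d" "odd_letter (w ! i)" for i
  proof -
    have j: "pinv \<tau> i < d" using permutes_in_image[OF permutes_inv[OF \<tau>], of i] i by auto
    have "w ! pinv \<tau> i = permute_list \<tau> w ! pinv \<tau> i" using st by simp
    also have "\<dots> = w ! i"
      using \<tau> len j permutes_inverses(1)[OF \<tau>] by (simp add: permute_list_nth)
    finally show ?thesis using w i j by (auto simp: Tri_def)
  qed
  then show ?thesis by (auto simp: psign_prod[OF len] intro!: prod.neutral)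
qed

text \<open>The two permutations differ by an element of the stabiliser, which has sign one.\<close>

lemma psign_well_defined:
  assumes w: "w \<in> Tri l n d" and \<sigma>: "\<sigma> permutes {..<d}" and \<rho>: "\<rho> permutes {..<d}"
    and eq: "permute_list \<sigma> w = permute_list \<rho> w"
  shows "psign \<sigma> w = (psign \<rho> w :: 'k::comm_ring_1)"
proof -
  have len: "length w = d" using w by (rule Tri_length)
  let ?\<tau> = "\<sigma> \<circ> pinv \<rho>"
  have \<tau>: "?\<tau> permutes {..<d}" using \<sigma> \<rho> by (intro permutes_compose permutes_inv)
  have "permute_list ?\<tau> w = permute_list (pinv \<rho>) (permute_list \<rho> w)"
    using permute_list_compose[of "pinv \<rho>" w \<sigma>] permutes_inv[OF \<rho>] len eq by simp
  also have "\<dots> = w" using permute_list_inv(1)[of \<rho> w] \<rho> len by simp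
  finally have st: "permute_list ?\<tau> w = w" .
  have "?\<tau> \<circ> \<rho> = \<sigma>" using permutes_inv_o(2)[OF \<rho>] by (simp add: comp_assoc)
  then have "psign \<sigma> w = psign ?\<tau> w * (psign \<rho> (permute_list ?\<tau> w) :: 'k)"
    using psign_compose[OF \<tau> \<rho> len] by metis
  then show ?thesis using psign_stabilizer[OF w \<tau> st, where 'k = 'k] st by simp
qed

text \<open>Cosets of the stabiliser correspond to the distinct rearrangements of \<open>w\<close>,
  so exactly one summand of \<open>xi_word\<close> hits a given rearrangement. Its sign does not
  depend on the representative picked by \<open>SOME\<close>, by
  \<open>psign_well_defined\<close>.\<close>

lemma lookup_xi_word:
  assumes w: "w \<in> Tri l n d"
  shows "\<sigma> permutes {..<d} \<Longrightarrow> lookup (xi_word w) (permute_list \<sigma> w) = (psign \<sigma> w :: 'k::comm_ring_1)"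
    and "mset v \<noteq> mset w \<Longrightarrow> lookup (xi_word w) v = (0 :: 'k)"
proof -
  have len: "length w = d" using w by (rule Tri_length)
  let ?St = "word_stabilizer w"
  let ?c = "\<lambda>\<sigma>. (\<lambda>\<tau>. \<tau> \<circ> \<sigma>) ` ?St"
  have cosets: "stabilizer_cosets w = ?c ` {\<sigma>. \<sigma> permutes {..<d}}"
    by (auto simp: stabilizer_cosets_def len)
  then have fin: "finite (stabilizer_cosets w)" by (simp add: finite_permutations)
  have mem: "\<rho> permutes {..<d} \<and> permute_list \<rho> w = permute_list \<sigma> w"
    if "\<rho> \<in> ?c \<sigma>" "\<sigma> permutes {..<d}" for \<rho> \<sigma>
  proof -
    from that(1) obtain \<tau> where "\<rho> = \<tau> \<circ> \<sigma>" "\<tau> \<in> ?St" by (rule imageE)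
    then have "\<tau> permutes {..<d}" "permute_list \<tau> w = w" "\<rho> = \<tau> \<circ> \<sigma>"
      by (simp_all add: word_stabilizer_def len)
    then show ?thesis using that permute_list_compose[of \<sigma> w \<tau>] len
      by (auto intro: permutes_compose)
  qed
  have self: "\<sigma> \<in> ?c \<sigma>" for \<sigma>
    by (rule image_eqI[of _ _ id]) (auto simp: word_stabilizer_def permutes_id)
  have eq: "?c \<sigma> = ?c \<rho>"
    if "permute_list \<sigma> w = permute_list \<rho> w" "\<sigma> permutes {..<d}" "\<rho> permutes {..<d}" for \<sigma> \<rho>
  proof -
    have "?c \<sigma> \<subseteq> ?c \<rho>" if eq: "permute_list \<sigma> w = permute_list \<rho> w"
      and \<sigma>: "\<sigma> permutes {..<d}" and \<rho>: "\<rho> permutes {..<d}" for \<sigma> \<rho>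
    proof
      fix \<pi> assume "\<pi> \<in> ?c \<sigma>"
      from mem[OF this \<sigma>] have \<pi>: "\<pi> permutes {..<d}" "permute_list \<pi> w = permute_list \<rho> w"
        using eq by auto
      have "permute_list (\<pi> \<circ> pinv \<rho>) w = w"
        using permute_list_compose[of "pinv \<rho>" w \<pi>] permutes_inv[OF \<rho>] len \<pi>
          permute_list_inv(1)[of \<rho> w] \<rho> by simp
      then have "\<pi> \<circ> pinv \<rho> \<in> ?St"
        using \<pi> \<rho> len by (auto simp: word_stabilizer_def intro!: permutes_compose permutes_inv)
      moreover have "\<pi> = \<pi> \<circ> pinv \<rho> \<circ> \<rho>" using permutes_inv_o(2)[OF \<rho>] by (simp add: comp_assoc)
      ultimately show "\<pi> \<in> ?c \<rho>" by blast
    qed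
    with that show ?thesis by (metis subset_antisym)
  qed
  let ?r = "\<lambda>C. SOME \<sigma>. \<sigma> \<in> C"
  have rep: "?r C permutes {..<d} \<and> ?c (?r C) = C" if C: "C \<in> stabilizer_cosets w" for C
  proof -
    obtain \<sigma> where \<sigma>: "\<sigma> permutes {..<d}" "C = ?c \<sigma>" using C cosets by auto
    then have "?r C \<in> ?c \<sigma>" using self[of \<sigma>] by (metis someI)
    from mem[OF this \<sigma>(1)] eq[of "?r C" \<sigma>] \<sigma> show ?thesis by auto
  qed
  have xi: "xi_word w = (\<Sum>C\<in>stabilizer_cosets w. single (permute_list (?r C) w) (psign (?r C) w :: 'k))"
    by (simp add: xi_word_def perm_act_def psign_def)
  {
    assume "mset v \<noteq> mset w"
    then have "permute_list (?r C) w \<noteq> v" if "C \<in> stabilizer_cosets w" for C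
      using rep[OF that] len mset_permute_list[of "?r C" w] by auto
    then show "lookup (xi_word w) v = (0 :: 'k)"
      by (simp add: xi lookup_sum lookup_single_not_eq)
  }
  {
    assume \<sigma>: "\<sigma> permutes {..<d}"
    have "lookup (xi_word w) (permute_list \<sigma> w)
        = (\<Sum>C\<in>stabilizer_cosets w. if C = ?c \<sigma> then psign \<sigma> w else (0::'k))"
      unfolding xi lookup_sum
    proof (intro sum.cong refl)
      fix C assume C: "C \<in> stabilizer_cosets w"
      note r = rep[OF C]
      show "lookup (single (permute_list (?r C) w) (psign (?r C) w)) (permute_list \<sigma> w)
          = (if C = ?c \<sigma> then psign \<sigma> w else (0::'k))"
      proof (cases "C = ?c \<sigma>")
        case True
        then have "?r C \<in> ?c \<sigma>" using self[of \<sigma>] by (metis someI)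
        from mem[OF this \<sigma>] psign_well_defined[OF w _ \<sigma>, of "?r C"] True show ?thesis
          by (simp add: lookup_single)
      next
        case False
        then have "permute_list (?r C) w \<noteq> permute_list \<sigma> w" using r eq[of "?r C" \<sigma>] \<sigma> by auto
        with False show ?thesis by (simp add: lookup_single_not_eq)
      qed
    qed
    also have "\<dots> = psign \<sigma> w" using fin cosets \<sigma> by simp
    finally show "lookup (xi_word w) (permute_list \<sigma> w) = (psign \<sigma> w :: 'k)" .
  }
qed

lemma psign_id: "length w = d \<Longrightarrow> psign id w = (1::'k::comm_ring_1)"
  by (auto simp: psign_prod inv_id intro!: prod.neutral)

lemma lookup_xi_word_self: "w \<in> Tri l n d \<Longrightarrow> lookup (xi_word w) w = (1::'k::comm_ring_1)"
  using lookup_xi_word(1)[of w l n d id, where 'k = 'k] psign_id[of w d, where 'k = 'k]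
  by (simp add: permutes_id Tri_length)

lemma xi_word_supersym:
  assumes w: "w \<in> Tri l n d"
  shows "(xi_word w :: _ \<Rightarrow>\<^sub>0 'k::comm_ring_1) \<in> supersym l n d"
  unfolding supersym_def
proof (intro CollectI conjI subsetI allI impI)
  have len: "length w = d" using w by (rule Tri_length)
  fix v assume "v \<in> keys (xi_word w :: _ \<Rightarrow>\<^sub>0 'k)"
  then have "mset v = mset w" using lookup_xi_word(2)[OF w, of v, where 'k = 'k]
    by (auto simp: in_keys_iff)
  then show "v \<in> words l n d"
    using w len by (auto simp: Tri_def words_def dest: mset_eq_setD mset_eq_length)
next
  have len: "length w = d" using w by (rule Tri_length)
  fix \<sigma> v assume \<sigma>: "\<sigma> permutes {..<d}" and v: "v \<in> words l n d"
  have lv: "length v = d" using v by (simp add: words_length)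
  show "lookup (xi_word w) (permute_list \<sigma> v) = psign \<sigma> v * (lookup (xi_word w) v :: 'k)"
  proof (cases "mset v = mset w")
    case True
    then obtain \<rho> where \<rho>: "\<rho> permutes {..<d}" "v = permute_list \<rho> w"
      using mset_eq_permute len by metis
    have "permute_list \<sigma> v = permute_list (\<rho> \<circ> \<sigma>) w"
      using \<rho> \<sigma> len by (simp add: permute_list_compose)
    then show ?thesis
      using lookup_xi_word(1)[OF w permutes_compose[OF \<sigma> \<rho>(1)], where 'k = 'k]
        lookup_xi_word(1)[OF w \<rho>(1), where 'k = 'k]
        psign_compose[OF \<rho>(1) \<sigma> len, where 'k = 'k] \<rho>(2)
      by (simp add: mult.commute)
  next
    case False
    then have "mset (permute_list \<sigma> v) \<noteq> mset w" using \<sigma> lv by simp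
    then show ?thesis using False by (simp add: lookup_xi_word(2)[OF w])
  qed
qed

lemma supersym_single_orbit:
  fixes x :: "_ \<Rightarrow>\<^sub>0 'k::comm_ring_1"
  assumes x: "x \<in> supersym l n d" and w: "w \<in> Tri l n d"
    and supp: "\<And>v. lookup x v \<noteq> 0 \<Longrightarrow> mset v = mset w"
  shows "x = scale (lookup x w) (xi_word w)"
proof (rule poly_mapping_eqI)
  fix v
  show "lookup x v = lookup (scale (lookup x w) (xi_word w)) v"
  proof (cases "mset v = mset w")
    case True
    then obtain \<sigma> where \<sigma>: "\<sigma> permutes {..<length w}" "v = permute_list \<sigma> w"
      by (rule mset_eq_permute)
    then show ?thesis
      using supersymD(2)[OF x _ Tri_words[OF w], of \<sigma>] lookup_xi_word(1)[OF w, of \<sigma>, where 'k = 'k]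
        Tri_length[OF w]
      by (simp add: mult.commute)
  next
    case False
    then show ?thesis using supp[of v] lookup_xi_word(2)[OF w False, where 'k = 'k] by auto
  qed
qed

text \<open>Interchanging two equal odd letters fixes the word and reverses the sign. The
  coefficient is then its own negative and vanishes in a domain of characteristic zero.\<close>

lemma supersym_Tri:
  fixes x :: "_ \<Rightarrow>\<^sub>0 'k::{idom, ring_char_0}"
  assumes x: "x \<in> supersym l n d" and w: "lookup x w \<noteq> 0"
  shows "w \<in> Tri l n d"
proof (rule ccontr)
  have W: "w \<in> words l n d" using supersymD(1)[OF x] w by (auto simp: in_keys_iff)
  assume "w \<notin> Tri l n d"
  then obtain i' j' where "i' < d" "j' < d" "i' \<noteq> j'" "w ! i' = w ! j'" "odd_letter (w ! i')"
    using W by (auto simp: Tri_def)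
  then obtain i j where ij: "i < d" "j < d" "i < j" "w ! i = w ! j" "odd_letter (w ! i)"
    by (cases i' j' rule: linorder_cases) (auto intro: that)
  have len: "length w = d" using W by (rule words_length)
  let ?\<sigma> = "Transposition.transpose i j"
  have \<sigma>: "?\<sigma> permutes {..<d}" using ij by (auto intro: permutes_swap_id)
  have st: "permute_list ?\<sigma> w = w"
    using ij len \<sigma> by (intro nth_equalityI) (auto simp: permute_list_nth transpose_def)
  have inv: "pinv ?\<sigma> = ?\<sigma>" by (rule inv_transpose_eq)
  let ?o = "\<lambda>k. odd_letter (w ! k)"
  let ?g = "\<lambda>p. case p of (a, b) \<Rightarrow> if a < b \<and> ?\<sigma> b < ?\<sigma> a \<and> ?o a \<and> ?o b then - 1 else (1::'k)"
  \<comment> \<open>The odd inversions of the transposition are the pair \<open>(i, j)\<close> and,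
    for every odd position \<open>k\<close> strictly between, both \<open>(i, k)\<close> and
    \<open>(k, j)\<close>; so their number is odd.\<close>
  define M where "M = {k \<in> {i<..<j}. ?o k}"
  have "psign ?\<sigma> w = (\<Prod>p\<in>{..<d} \<times> {..<d}. ?g p)"
    by (simp add: psign_prod[OF len] inv)
  also have "\<dots> = (\<Prod>p\<in>insert (i, j) (Pair i ` M \<union> (\<lambda>k. (k, j)) ` M). - 1)"
  proof (rule prod.mono_neutral_cong_right)
    show "insert (i, j) (Pair i ` M \<union> (\<lambda>k. (k, j)) ` M) \<subseteq> {..<d} \<times> {..<d}"
      using ij by (auto simp: M_def)
    show "\<forall>p\<in>{..<d} \<times> {..<d} - insert (i, j) (Pair i ` M \<union> (\<lambda>k. (k, j)) ` M). ?g p = 1"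
      using ij by (auto simp: M_def transpose_def split: if_splits)
    show "?g p = - 1" if "p \<in> insert (i, j) (Pair i ` M \<union> (\<lambda>k. (k, j)) ` M)" for p
      using that ij by (auto simp: M_def transpose_def)
  qed simp
  also have "\<dots> = (- 1) ^ card (insert (i, j) (Pair i ` M \<union> (\<lambda>k. (k, j)) ` M))" by simp
  also have "card (insert (i, j) (Pair i ` M \<union> (\<lambda>k. (k, j)) ` M)) = Suc (card M + card M)"
  proof -
    have "finite M" by (simp add: M_def)
    moreover have "Pair i ` M \<inter> (\<lambda>k. (k, j)) ` M = {}" by (auto simp: M_def)
    moreover have "(i, j) \<notin> Pair i ` M \<union> (\<lambda>k. (k, j)) ` M" by (auto simp: M_def)
    ultimately show ?thesis
      by (simp add: card_Un_disjoint card_image inj_on_def)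
  qed
  finally have "psign ?\<sigma> w = (- 1 :: 'k)" by (simp flip: mult_2)
  then have "lookup x w = - lookup x w" using supersymD(2)[OF x \<sigma> W] st by simp
  then have "2 * lookup x w = 0" by (metis add.right_inverse mult_2)
  then show False using w by simp
qed

lemma cfact_mset: "mset v = mset w \<Longrightarrow> cfact l n v = cfact l n w"
  by (simp add: cfact_def flip: count_mset)

lemma eta_word_eq: "eta_word l n w = scale (of_nat (cfact l n w)) (xi_word w)"
  by (simp add: eta_word_def cfact_def)

lemma eta_word_Tset:
  assumes w: "w \<in> Tri l n d"
  shows "(eta_word l n w :: _ \<Rightarrow>\<^sub>0 'k::comm_ring_1) \<in> Tset l n d"
  unfolding Tset_def
proof (intro CollectI conjI ballI)
  show "(eta_word l n w :: _ \<Rightarrow>\<^sub>0 'k) \<in> supersym l n d"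
    unfolding eta_word_eq by (intro supersym_scale xi_word_supersym w)
  fix v
  show "of_nat (cfact l n v) dvd lookup (eta_word l n w :: _ \<Rightarrow>\<^sub>0 'k) v"
    using cfact_mset[of v w l n] lookup_xi_word(2)[OF w, of v, where 'k = 'k]
    by (cases "mset v = mset w") (simp_all add: eta_word_eq)
qed

text \<open>Orbits are split off one at a time: divisibility supplies the coefficient
  \<open>c\<close>, and the subtraction clears the orbit of \<open>w\<close> without enlarging the
  support. \<open>Q\<close> transports a condition on the support, later that all targets avoid the
  vertex \<open>l\<close>.\<close>

lemma Tset_induct [consumes 1, case_names support zero add]:
  fixes x :: "_ \<Rightarrow>\<^sub>0 'k::{idom, ring_char_0}"
  assumes x: "x \<in> Tset l n d" and Q: "\<And>w. lookup x w \<noteq> 0 \<Longrightarrow> Q w"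
    and zero: "P 0"
    and add: "\<And>c w y. w \<in> Tri l n d \<Longrightarrow> Q w \<Longrightarrow> P y \<Longrightarrow> P (scale c (eta_word l n w) + y)"
  shows "P x"
  using x Q
proof (induction "card (keys x)" arbitrary: x rule: less_induct)
  case less
  show ?case
  proof (cases "x = 0")
    case False
    then obtain w where w0: "lookup x w \<noteq> 0" by (metis lookup_zero poly_mapping_eqI)
    have sx: "x \<in> supersym l n d" using less by (simp add: Tset_def)
    have w: "w \<in> Tri l n d" using supersym_Tri[OF sx w0] .
    obtain c where c: "lookup x w = of_nat (cfact l n w) * c"
      using less(2) Tri_words[OF w] unfolding Tset_def by blast
    define y where "y = x - scale c (eta_word l n w)"
    have yT: "y \<in> Tset l n d"
      unfolding y_def diff_conv_add_uminus
      using less(2) w by (intro Tset_add Tset_uminus Tset_scale eta_word_Tset)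
    have "lookup y v = 0" if v: "lookup x v = 0" for v
    proof (cases "mset v = mset w")
      case True
      then obtain \<sigma> where \<sigma>: "\<sigma> permutes {..<length v}" "w = permute_list \<sigma> v"
        by (metis mset_eq_permute)
      have vW: "v \<in> words l n d" using True Tri_words[OF w]
        by (auto simp: words_def dest: mset_eq_setD mset_eq_length)
      then have "lookup x w = psign \<sigma> v * lookup x v"
        using supersymD(2)[OF sx _ vW, of \<sigma>] \<sigma> by (simp add: words_length)
      then show ?thesis using v w0 by simp
    next
      case False
      then show ?thesis using v lookup_xi_word(2)[OF w False, where 'k = 'k]
        by (simp add: y_def lookup_minus eta_word_eq)
    qed
    then have sub: "keys y \<subseteq> keys x" by (auto simp: in_keys_iff)
    moreover have "lookup y w = 0"
      using c lookup_xi_word_self[OF w, where 'k = 'k] by (simp add: y_def lookup_minus eta_word_eq)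
    ultimately have "keys y \<subset> keys x" using w0 by (auto simp: in_keys_iff)
    then have "card (keys y) < card (keys x)" by (intro psubset_card_mono) auto
    moreover have "Q v" if "lookup y v \<noteq> 0" for v
      using that less(3)[of v] \<open>keys y \<subseteq> keys x\<close> by (auto simp: in_keys_iff)
    ultimately have "P y" using less(1) yT by blast
    from add[OF w less(3)[OF w0] this, of c] show ?thesis by (simp add: y_def)
  qed (use zero in simp)
qed

lemma span_eta:
  "module.span scale (eta_word l n ` Tri l n d) = (Tset l n d :: (_ \<Rightarrow>\<^sub>0 'k::{idom, ring_char_0}) set)"
proof
  show "module.span scale (eta_word l n ` Tri l n d) \<subseteq> (Tset l n d :: (_ \<Rightarrow>\<^sub>0 'k) set)"
    by (rule free_module.span_minimal)
      (auto simp: eta_word_Tset free_module.subspace_def Tset_add Tset_scale Tset_zero)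
  show "(Tset l n d :: (_ \<Rightarrow>\<^sub>0 'k) set) \<subseteq> module.span scale (eta_word l n ` Tri l n d)"
  proof
    fix x :: "_ \<Rightarrow>\<^sub>0 'k" assume "x \<in> Tset l n d"
    then show "x \<in> module.span scale (eta_word l n ` Tri l n d)"
    proof (induction x rule: Tset_induct[where Q = "\<lambda>_. True"])
      case (add c w y)
      have "scale c (eta_word l n w :: _ \<Rightarrow>\<^sub>0 'k) \<in> module.span scale (eta_word l n ` Tri l n d)"
        using add(1) by (intro free_module.span_scale free_module.span_base imageI)
      then show ?case using add(3) by (rule free_module.span_add)
    qed (auto simp: free_module.span_zero)
  qed
qed


section \<open>The algebra T\<close>


abbreviation tmul :: "nat \<Rightarrow> nat \<Rightarrow> (tensor_word \<Rightarrow>\<^sub>0 'k::comm_ring_1) \<Rightarrow> (tensor_word \<Rightarrow>\<^sub>0 'k) \<Rightarrow> (tensor_word \<Rightarrow>\<^sub>0 'k)"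
  where "tmul l n \<equiv> bilin_extend (word_mult l n)"

definition factorizations :: "nat \<Rightarrow> nat \<Rightarrow> nat \<Rightarrow> tensor_word \<Rightarrow> (tensor_word \<times> tensor_word) set"
  where "factorizations l n d w = {(u, v). u \<in> words l n d \<and> v \<in> words l n d \<and> wmul l u v = Some w}"

lemma finite_factorizations [simp]: "finite (factorizations l n d w)"
  by (rule finite_subset[of _ "words l n d \<times> words l n d"]) (auto simp: factorizations_def)

lemma lookup_tmul:
  fixes x y :: "tensor_word \<Rightarrow>\<^sub>0 'k::comm_ring_1"
  assumes l1: "l \<ge> 1" and x: "keys x \<subseteq> words l n d" and y: "keys y \<subseteq> words l n d"
  shows "lookup (tmul l n x y) w =
    (\<Sum>(u, v)\<in>factorizations l n d w. eps u v * lookup x u * lookup y v)"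
proof -
  have "lookup (tmul l n x y) w
      = (\<Sum>p\<in>keys x \<times> keys y. lookup x (fst p) * lookup y (snd p) * lookup (word_mult l n (fst p) (snd p)) w)"
    by (simp add: lookup_bilin_extend sum.cartesian_product case_prod_unfold)
  also have "\<dots> = (\<Sum>p\<in>words l n d \<times> words l n d.
      lookup x (fst p) * lookup y (snd p) * lookup (word_mult l n (fst p) (snd p)) w)"
    using x y by (intro sum.mono_neutral_left) (auto simp: in_keys_iff)
  also have "\<dots> = (\<Sum>p\<in>factorizations l n d w. eps (fst p) (snd p) * lookup x (fst p) * lookup y (snd p))"
  proof (rule sum.mono_neutral_cong_right)
    show "\<forall>p\<in>words l n d \<times> words l n d - factorizations l n d w.
        lookup x (fst p) * lookup y (snd p) * lookup (word_mult l n (fst p) (snd p)) w = 0"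
    proof
      fix p assume "p \<in> words l n d \<times> words l n d - factorizations l n d w"
      then show "lookup x (fst p) * lookup y (snd p) * lookup (word_mult l n (fst p) (snd p)) w = 0"
        by (cases "wmul l (fst p) (snd p)")
          (auto simp: word_mult_eq[OF l1] factorizations_def lookup_single when_def split: if_splits)
    qed
  qed (auto simp: factorizations_def word_mult_eq[OF l1] mult_ac)
  finally show ?thesis by (simp add: case_prod_unfold)
qed

lemma keys_tmul:
  fixes x y :: "tensor_word \<Rightarrow>\<^sub>0 'k::comm_ring_1"
  assumes "l \<ge> 1" "keys x \<subseteq> words l n d" "keys y \<subseteq> words l n d"
  shows "keys (tmul l n x y) \<subseteq> words l n d"
proof
  fix w assume "w \<in> keys (tmul l n x y)"
  then have "factorizations l n d w \<noteq> {}" by (auto simp: in_keys_iff lookup_tmul[OF assms])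
  then show "w \<in> words l n d" using wmul_SomeD(1) by (fastforce simp: factorizations_def)
qed

lemma factorizations_permute:
  assumes "(u, v) \<in> factorizations l n d w" "\<sigma> permutes {..<d}"
  shows "(permute_list \<sigma> u, permute_list \<sigma> v) \<in> factorizations l n d (permute_list \<sigma> w)"
  using assms wmul_permute[of \<sigma> d l u v w] words_length[of u l n d]
  by (auto simp: factorizations_def permute_list_words)

lemma tmul_term_permute:
  assumes x: "x \<in> supersym l n d" and y: "y \<in> supersym l n d"
    and uv: "(u, v) \<in> factorizations l n d w" and \<sigma>: "\<sigma> permutes {..<d}"
  shows "eps (permute_list \<sigma> u) (permute_list \<sigma> v) * lookup x (permute_list \<sigma> u) * lookup y (permute_list \<sigma> v)
    = psign \<sigma> w * (eps u v * lookup x u * lookup y v :: 'k::comm_ring_1)"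
proof -
  have W: "u \<in> words l n d" "v \<in> words l n d" "wmul l u v = Some w"
    using uv by (auto simp: factorizations_def)
  note len = words_length[OF W(1)] words_length[OF W(2)] words_length[OF wmul_SomeD(1)[OF W(3,1,2)]]
  have 1: "psign \<sigma> u * psign \<sigma> v * eps (permute_list \<sigma> u) (permute_list \<sigma> v) = (eps u v * psign \<sigma> w :: 'k)"
    using wmul_odd[OF W(3,1,2)] by (intro eps_permute[OF \<sigma> len])
  have "eps (permute_list \<sigma> u) (permute_list \<sigma> v) * lookup x (permute_list \<sigma> u) * lookup y (permute_list \<sigma> v)
      = (psign \<sigma> u * psign \<sigma> v * eps (permute_list \<sigma> u) (permute_list \<sigma> v)) * (lookup x u * lookup y v)"
    unfolding supersymD(2)[OF x \<sigma> W(1)] supersymD(2)[OF y \<sigma> W(2)] by (simp only: mult_ac)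
  then show ?thesis unfolding 1 by (simp only: mult_ac)
qed

text \<open>Permuting both factors is a bijection from the factorizations of \<open>w\<close> to
  those of the permuted word, and \<open>tmul_term_permute\<close> shows that all summands change by
  the same sign.\<close>

lemma supersym_tmul:
  fixes x y :: "tensor_word \<Rightarrow>\<^sub>0 'k::comm_ring_1"
  assumes l1: "l \<ge> 1" and x: "x \<in> supersym l n d" and y: "y \<in> supersym l n d"
  shows "tmul l n x y \<in> supersym l n d"
  unfolding supersym_def
proof (intro CollectI conjI allI impI)
  note L = lookup_tmul[OF l1 supersymD(1)[OF x] supersymD(1)[OF y]]
  show "keys (tmul l n x y) \<subseteq> words l n d"
    by (rule keys_tmul[OF l1 supersymD(1)[OF x] supersymD(1)[OF y]])
  fix \<sigma> w assume \<sigma>: "\<sigma> permutes {..<d}" and w: "w \<in> words l n d"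
  note \<sigma>' = permutes_inv[OF \<sigma>]
  have len: "length w = d" using w by (rule words_length)
  let ?p = "\<lambda>\<tau> (u, v). (permute_list \<tau> u, permute_list \<tau> v)"
  have "lookup (tmul l n x y) (permute_list \<sigma> w)
      = (\<Sum>(u, v)\<in>factorizations l n d w. psign \<sigma> w * (eps u v * lookup x u * lookup y v))"
    unfolding L
  proof (rule sum.reindex_bij_witness[of _ "?p \<sigma>" "?p (pinv \<sigma>)"])
    fix p assume "p \<in> factorizations l n d (permute_list \<sigma> w)"
    then obtain u v where p: "p = (u, v)" "(u, v) \<in> factorizations l n d (permute_list \<sigma> w)" by (cases p) auto
    then have lp: "length u = d" "length v = d" by (auto simp: factorizations_def words_length)
    then show 1: "?p \<sigma> (?p (pinv \<sigma>) p) = p" using p \<sigma> by (simp add: permute_list_inv)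
    show 2: "?p (pinv \<sigma>) p \<in> factorizations l n d w"
      using factorizations_permute[OF p(2) \<sigma>'] p(1) \<sigma> len by (simp add: permute_list_inv)
    show "(case ?p (pinv \<sigma>) p of (u, v) \<Rightarrow> psign \<sigma> w * (eps u v * lookup x u * lookup y v))
        = (case p of (u, v) \<Rightarrow> eps u v * lookup x u * lookup y v)"
      using tmul_term_permute[OF x y _ \<sigma>, of "permute_list (pinv \<sigma>) u" "permute_list (pinv \<sigma>) v" w] 2 p(1) lp \<sigma>
      by (simp add: permute_list_inv)
  next
    fix p assume "p \<in> factorizations l n d w"
    then obtain u v where p: "p = (u, v)" "(u, v) \<in> factorizations l n d w" by (cases p) auto
    then have lp: "length u = d" "length v = d" by (auto simp: factorizations_def words_length)
    then show "?p (pinv \<sigma>) (?p \<sigma> p) = p" using p \<sigma> by (simp add: permute_list_inv)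
    show "?p \<sigma> p \<in> factorizations l n d (permute_list \<sigma> w)"
      using factorizations_permute[OF p(2) \<sigma>] p(1) by simp
  qed
  also have "\<dots> = psign \<sigma> w * lookup (tmul l n x y) w"
    unfolding L sum_distrib_left by (simp add: case_prod_unfold)
  finally show "lookup (tmul l n x y) (permute_list \<sigma> w) = psign \<sigma> w * lookup (tmul l n x y) w" .
qed


section \<open>Counting permutations and divisibility of orbit sums\<close>

lemma card_color_preserving:
  fixes f :: "'a \<Rightarrow> 'b"
  assumes S: "finite S" and A: "finite A" "f ` S \<subseteq> A"
  shows "card {\<sigma>. \<sigma> permutes S \<and> (\<forall>i\<in>S. f (\<sigma> i) = f i)} = (\<Prod>a\<in>A. fact (card {i \<in> S. f i = a}))"
proof -
  let ?S = "\<lambda>a. {i \<in> S. f i = a}"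
  let ?G = "{\<sigma>. \<sigma> permutes S \<and> (\<forall>i\<in>S. f (\<sigma> i) = f i)}"
  let ?P = "Pi\<^sub>E A (\<lambda>a. {\<pi>. \<pi> permutes ?S a})"
  \<comment> \<open>A colour-preserving permutation is the same as a family of permutations of the
    colour classes: \<open>?to\<close> restricts to the classes and \<open>?from\<close>
    glues.\<close>
  let ?to = "\<lambda>\<sigma>. \<lambda>a\<in>A. \<lambda>i. if i \<in> ?S a then \<sigma> i else i"
  let ?from = "\<lambda>g i. if i \<in> S then g (f i) i else i"
  have "bij_betw ?to ?G ?P"
  proof (rule bij_betw_byWitness[where f' = ?from])
    show "\<forall>\<sigma>\<in>?G. ?from (?to \<sigma>) = \<sigma>"
    proof
      fix \<sigma> assume "\<sigma> \<in> ?G"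
      then show "?from (?to \<sigma>) = \<sigma>"
        using A by (auto simp: fun_eq_iff permutes_def)
    qed
    show "\<forall>g\<in>?P. ?to (?from g) = g"
    proof
      fix g assume g: "g \<in> ?P"
      show "?to (?from g) = g"
      proof (rule extensionalityI[of _ A])
        fix a assume "a \<in> A"
        then have "g a permutes ?S a" using g by auto
        then show "?to (?from g) a = g a"
          using \<open>a \<in> A\<close> by (auto simp: fun_eq_iff permutes_def)
      qed (use g in \<open>auto simp: PiE_iff\<close>)
    qed
    show "?to ` ?G \<subseteq> ?P"
    proof (clarsimp simp: PiE_iff)
      fix \<sigma> a assume \<sigma>: "\<sigma> permutes S" "\<forall>i\<in>S. f (\<sigma> i) = f i"
      have "\<sigma> ` ?S a = ?S a"
      proof (intro equalityI subsetI)
        fix j assume j: "j \<in> ?S a"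
        then have "pinv \<sigma> j \<in> S" using permutes_in_image[OF permutes_inv[OF \<sigma>(1)]] by auto
        moreover have "\<sigma> (pinv \<sigma> j) = j" by (rule permutes_inverses(1)[OF \<sigma>(1)])
        ultimately have "pinv \<sigma> j \<in> ?S a" using \<sigma>(2) j by force
        then show "j \<in> \<sigma> ` ?S a" using \<open>\<sigma> (pinv \<sigma> j) = j\<close> by force
      qed (use \<sigma> permutes_in_image[OF \<sigma>(1)] in auto)
      then have "bij_betw \<sigma> (?S a) (?S a)"
        using permutes_inj[OF \<sigma>(1)] by (auto simp: bij_betw_def intro: inj_on_subset)
      then have "bij_betw (\<lambda>i. if i \<in> ?S a then \<sigma> i else i) (?S a) (?S a)"
        by (subst bij_betw_cong[of _ _ \<sigma>]) auto
      then show "(\<lambda>i. if i \<in> S \<and> f i = a then \<sigma> i else i) permutes ?S a"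
        by (intro bij_imp_permutes) auto
    qed
    show "?from ` ?P \<subseteq> ?G"
    proof (rule image_subsetI)
      fix g assume g: "g \<in> ?P"
      have p: "g (f i) permutes ?S (f i)" if "i \<in> S" for i
        using g that A by auto
      have h: "g (f i) i \<in> S \<and> f (g (f i) i) = f i" if "i \<in> S" for i
        using permutes_in_image[OF p[OF that], of i] that by auto
      have "inj_on (?from g) S"
      proof (rule inj_onI)
        fix i j assume ij: "i \<in> S" "j \<in> S" "?from g i = ?from g j"
        then have eq: "g (f i) i = g (f j) j" by simp
        then have "f i = f j" using h ij by metis
        with eq show "i = j" using permutes_inj[OF p[OF ij(1)]] by (auto dest: injD)
      qed
      moreover from this have "?from g ` S = S" using h S by (intro endo_inj_surj) auto
      ultimately have "?from g permutes S"
        by (intro bij_imp_permutes) (auto simp: bij_betw_def)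
      then show "?from g \<in> ?G" using h by auto
    qed
  qed
  then have "card ?G = card ?P" by (rule bij_betw_same_card)
  also have "\<dots> = (\<Prod>a\<in>A. fact (card (?S a)))"
    using S A by (simp add: card_PiE card_permutations)
  finally show ?thesis .
qed

text \<open>\<open>F\<close> is constant on an orbit, whose size is the index of a stabiliser. The
  order of the stabiliser divides the value, so the orbit sum is divisible by index times order,
  which is the order of \<open>G\<close>. The induction removes one orbit at a time. The reversed
  composition is that of a right action, as for \<open>permute_list\<close>.\<close>

lemma orbit_sum_dvd:
  fixes F :: "'x \<Rightarrow> 'k::comm_ring_1" and act :: "('a \<Rightarrow> 'a) \<Rightarrow> 'x \<Rightarrow> 'x"
  assumes G: "finite G" "id \<in> G" "\<And>g h. g \<in> G \<Longrightarrow> h \<in> G \<Longrightarrow> g \<circ> h \<in> G"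
      "\<And>g. g \<in> G \<Longrightarrow> bij g" "\<And>g. g \<in> G \<Longrightarrow> pinv g \<in> G"
    and X: "finite X" "\<And>g x. g \<in> G \<Longrightarrow> x \<in> X \<Longrightarrow> act g x \<in> X"
      "\<And>x. x \<in> X \<Longrightarrow> act id x = x"
      "\<And>g h x. g \<in> G \<Longrightarrow> h \<in> G \<Longrightarrow> x \<in> X \<Longrightarrow> act (g \<circ> h) x = act h (act g x)"
    and inv: "\<And>g x. g \<in> G \<Longrightarrow> x \<in> X \<Longrightarrow> F (act g x) = F x"
    and dvd: "\<And>x. x \<in> X \<Longrightarrow> of_nat (card {g \<in> G. act g x = x}) dvd F x"
  shows "of_nat (card G) dvd (\<Sum>x\<in>X. F x)"
  using X inv dvd
proof (induction "card X" arbitrary: X rule: less_induct)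
  case less
  show ?case
  proof (cases "X = {}")
    case False
    then obtain x where x: "x \<in> X" by auto
    let ?O = "(\<lambda>g. act g x) ` G"
    let ?St = "{g \<in> G. act g x = x}"
    have OX: "?O \<subseteq> X" using less.prems(2) x by auto
    \<comment> \<open>The elements carrying \<open>x\<close> to \<open>y\<close> form a coset of the
      stabiliser of \<open>x\<close>.\<close>
    have fib: "card {g \<in> G. act g x = y} = card ?St" if "y \<in> ?O" for y
    proof -
      from that obtain h where h: "y = act h x" "h \<in> G" by (rule imageE)
      have h': "h \<circ> pinv h = id" "pinv h \<circ> h = id"
        using G(4)[OF h(2)] by (auto simp: fun_eq_iff bij_is_inj bij_is_surj surj_f_inv_f)
      have "{g \<in> G. act g x = y} = (\<lambda>k. k \<circ> h) ` ?St"
      proof (intro equalityI subsetI)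
        fix g assume g: "g \<in> {g \<in> G. act g x = y}"
        then have gG: "g \<in> G" by simp
        have "act (g \<circ> pinv h) x = act (pinv h) (act g x)"
          using less.prems(4) gG G(5)[OF h(2)] x by simp
        also have "\<dots> = act (h \<circ> pinv h) x"
          using less.prems(4) h G(5)[OF h(2)] x g by simp
        also have "\<dots> = x" using h' less.prems(3) x by simp
        finally have "g \<circ> pinv h \<in> ?St" using G(3)[OF gG G(5)[OF h(2)]] by simp
        moreover have "g = g \<circ> pinv h \<circ> h" using h' by (simp add: comp_assoc)
        ultimately show "g \<in> (\<lambda>k. k \<circ> h) ` ?St" by blast
      next
        fix g assume "g \<in> (\<lambda>k. k \<circ> h) ` ?St"
        then show "g \<in> {g \<in> G. act g x = y}"
          using less.prems(4) h x G(3) by auto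
      qed
      moreover have "inj_on (\<lambda>k. k \<circ> h) ?St"
      proof (rule inj_onI)
        fix k k' assume "k \<circ> h = k' \<circ> h"
        then have "k \<circ> h \<circ> pinv h = k' \<circ> h \<circ> pinv h" by simp
        then show "k = k'" using h' by (simp add: comp_assoc)
      qed
      ultimately show ?thesis by (simp add: card_image)
    qed
    have "card G = card (\<Union>y\<in>?O. {g \<in> G. act g x = y})" by (rule arg_cong[of _ _ card]) auto
    also have "\<dots> = (\<Sum>y\<in>?O. card {g \<in> G. act g x = y})"
      using G(1) by (intro card_UN_disjoint) auto
    also have "\<dots> = card ?O * card ?St" using fib by simp
    finally have card: "card G = card ?O * card ?St" .
    have "(\<Sum>y\<in>?O. F y) = (\<Sum>y\<in>?O. F x)"
      using less.prems(5) x by (intro sum.cong) auto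
    then have "(\<Sum>y\<in>?O. F y) = of_nat (card ?O) * F x" by simp
    then have d1: "of_nat (card G) dvd (\<Sum>y\<in>?O. F y)"
      unfolding card of_nat_mult using less.prems(6)[OF x] by (simp add: mult_dvd_mono)
    have "x \<in> ?O" using G(2) less.prems(3)[OF x] by (metis image_eqI)
    then have lt: "card (X - ?O) < card X"
      using less.prems(1) x by (intro psubset_card_mono) auto
    have closed: "act g y \<in> X - ?O" if g: "g \<in> G" and y: "y \<in> X - ?O" for g y
    proof -
      have "act g y \<notin> ?O"
      proof
        assume "act g y \<in> ?O"
        then obtain h where h: "h \<in> G" "act g y = act h x" by auto
        have "y = act (g \<circ> pinv g) y"
          using less.prems(3)[of y] y surj_f_inv_f[OF bij_is_surj[OF G(4)[OF g]]]
          by (simp add: comp_def id_def)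
        also have "\<dots> = act (h \<circ> pinv g) x"
          using less.prems(4) g y h x G(5)[OF g] by simp
        finally show False using y G(3)[OF h(1) G(5)[OF g]] by blast
      qed
      then show ?thesis using less.prems(2) g y by auto
    qed
    have "of_nat (card G) dvd (\<Sum>y\<in>X - ?O. F y)"
      using less.prems closed by (intro less.hyps[OF lt]) auto
    moreover have "(\<Sum>y\<in>X. F y) = (\<Sum>y\<in>X - ?O. F y) + (\<Sum>y\<in>?O. F y)"
      using less.prems(1) OX by (rule sum.subset_diff[rotated])
    ultimately show ?thesis using d1 by simp
  qed simp
qed

lemma fact_eq_1: "k \<le> 1 \<Longrightarrow> fact k = (1::nat)"
  by (cases k) auto

text \<open>The label \<open>Inr i\<close> is private to the position \<open>i\<close> and freezes
  it, so only positions satisfying \<open>Q\<close> can be exchanged. Each frozen label contributes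
  the factorial of a number at most one.\<close>

lemma card_partial_color_preserving:
  fixes d :: nat and h :: "nat \<Rightarrow> 'b"
  assumes P: "finite P" "\<And>i. i < d \<Longrightarrow> Q i \<Longrightarrow> h i \<in> P"
  shows "card {\<sigma>. \<sigma> permutes {..<d} \<and> (\<forall>i\<in>{..<d}.
      (if Q (\<sigma> i) then Inl (h (\<sigma> i)) else Inr (\<sigma> i)) = (if Q i then Inl (h i) else Inr i))}
    = (\<Prod>a\<in>P. fact (card {i. i < d \<and> Q i \<and> h i = a}))"
proof -
  let ?lab = "\<lambda>i. if Q i then Inl (h i) else Inr i"
  let ?N = "\<lambda>a. card {i \<in> {..<d}. ?lab i = a}"
  have "card {\<sigma>. \<sigma> permutes {..<d} \<and> (\<forall>i\<in>{..<d}. ?lab (\<sigma> i) = ?lab i)}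
      = (\<Prod>a\<in>Inl ` P \<union> Inr ` {..<d}. fact (?N a))"
    using P by (intro card_color_preserving) auto
  also have "\<dots> = (\<Prod>a\<in>Inl ` P. fact (?N a)) * (\<Prod>a\<in>Inr ` {..<d}. fact (?N a))"
    using P by (intro prod.union_disjoint) auto
  also have "(\<Prod>a\<in>Inr ` {..<d}. fact (?N a)) = (1::nat)"
  proof (rule prod.neutral, rule ballI)
    fix a :: "'b + nat" assume "a \<in> Inr ` {..<d}"
    then obtain j where "a = Inr j" by auto
    then have "?N a \<le> card {j}" by (intro card_mono) (auto split: if_splits)
    then show "fact (?N a) = (1::nat)" by (intro fact_eq_1) simp
  qed
  also have "(\<Prod>a\<in>Inl ` P. fact (?N a)) = (\<Prod>a\<in>P. fact (?N (Inl a)) :: nat)"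
    by (simp add: prod.reindex)
  also have "\<dots> = (\<Prod>a\<in>P. fact (card {i. i < d \<and> Q i \<and> h i = a}))"
    by (intro prod.cong refl arg_cong[of _ _ fact] arg_cong[of _ _ card]) (auto split: if_splits)
  finally show ?thesis by simp
qed

text \<open>The quotient is a multinomial coefficient.\<close>

lemma prod_fact_dvd_fact_sum:
  "finite A \<Longrightarrow> (\<Prod>a\<in>A. fact (f a)) dvd (fact (\<Sum>a\<in>A. f a) :: nat)"
proof (induction A rule: finite_induct)
  case (insert a A)
  then have "fact (f a) * (\<Prod>a\<in>A. fact (f a)) dvd (fact (f a) * fact (\<Sum>a\<in>A. f a) :: nat)"
    by (intro mult_dvd_mono) auto
  also have "\<dots> dvd fact (f a + (\<Sum>a\<in>A. f a))" by (rule fact_fact_dvd_fact)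
  finally show ?case using insert by simp
qed simp

lemma count_list_card: "count_list w x = card {i. i < length w \<and> w ! i = x}"
  by (simp add: count_list_eq_length_filter length_filter_conv_card) (metis (full_types))

definition c_letters :: "nat \<Rightarrow> nat \<Rightarrow> letter set"
  where "c_letters l n = basis_c l \<times> {1..n} \<times> {1..n}"

lemma cfact_eq: "cfact l n w = (\<Prod>x\<in>c_letters l n. fact (count_list w x))"
  by (simp add: cfact_def c_letters_def)

lemma c_letters_iff: "x \<in> c_letters l n \<longleftrightarrow> x \<in> letters l n \<and> length (fst x) = 3"
  by (auto simp: c_letters_def letters_def zigzag_basis_def basis_z_def basis_c_def basis_1_def)

lemma letters_length: "x \<in> letters l n \<Longrightarrow> length (fst x) \<in> {1, 2, 3}"
  by (auto simp: letters_def zigzag_basis_def basis_z_def basis_c_def basis_1_def)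

lemma finite_c_letters [simp]: "finite (c_letters l n)"
  by (rule finite_subset[OF _ finite_letters[of l n]]) (auto simp: c_letters_iff)

lemma prod_Times: "(\<Prod>p\<in>A \<times> B. f p) = (\<Prod>a\<in>A. \<Prod>b\<in>B. f (a, b))"
  by (simp add: prod.cartesian_product)

text \<open>Counted in vertices, the two factors have total length four. Neither has three vertices,
  so both have two and are arrows.\<close>

lemma odd_factor_of_c_letter:
  assumes "lmul l x y = Some z" "x \<in> letters l n" "y \<in> letters l n" "z \<in> c_letters l n"
    "x \<notin> c_letters l n" "y \<notin> c_letters l n"
  shows "odd_letter x"
proof -
  have "length (fst z) + 1 = length (fst x) + length (fst y)"
    by (rule lmul_SomeD(4)[OF assms(1) letters_ne[OF assms(2)] letters_ne[OF assms(3)]])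
  then have "length (fst x) = 2"
    using letters_length[OF assms(2)] letters_length[OF assms(3)] assms by (auto simp: c_letters_iff)
  then show ?thesis by (simp add: odd_letter_def path_length_def)
qed


text \<open>
  The permutations that only move equal letters \<open>c\<close> of \<open>w\<close> form a group of order \<open>cfact l n w\<close>
  that acts on the factorizations of \<open>w\<close> and preserves the summands of the product. The order of
  the stabilizer of \<open>(u, v)\<close> divides \<open>cfact l n u * cfact l n v\<close>: a letter \<open>c\<close> factors as
  \<open>c e\<close>, as \<open>e c\<close>, or into two odd letters, and odd letters do not repeat.
\<close>

lemma cfact_tmul:
  fixes x y :: "tensor_word \<Rightarrow>\<^sub>0 'k::{idom, ring_char_0}"
  assumes l1: "l \<ge> 1" and x: "x \<in> Tset l n d" and y: "y \<in> Tset l n d" and w: "w \<in> words l n d"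
  shows "of_nat (cfact l n w) dvd lookup (tmul l n x y) w"
proof -
  note sx = x[unfolded Tset_def, THEN CollectD, THEN conjunct1]
  note sy = y[unfolded Tset_def, THEN CollectD, THEN conjunct1]
  let ?C = "c_letters l n" and ?L = "letters l n"
  define lab :: "nat \<Rightarrow> letter + nat" where "lab = (\<lambda>i. if w ! i \<in> ?C then Inl (w ! i) else Inr i)"
  let ?G = "{\<sigma>. \<sigma> permutes {..<d} \<and> (\<forall>i\<in>{..<d}. lab (\<sigma> i) = lab i)}"
  let ?X = "factorizations l n d w"
  let ?act = "\<lambda>\<tau> (u, v). (permute_list \<tau> u, permute_list \<tau> v)"
  let ?F = "\<lambda>(u, v). eps u v * lookup x u * lookup y v"
  have len: "length w = d" using w by (rule words_length)
  have ran: "\<sigma> i < d" if "\<sigma> permutes {..<d}" "i < d" for \<sigma> i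
    using permutes_in_image[OF that(1), of i] that(2) by simp
  have cG: "card ?G = cfact l n w"
  proof -
    have "card ?G = (\<Prod>a\<in>?C. fact (card {i. i < d \<and> w ! i \<in> ?C \<and> w ! i = a}))"
      unfolding lab_def by (rule card_partial_color_preserving) simp_all
    also have "\<dots> = cfact l n w" unfolding cfact_eq count_list_card len
      by (intro prod.cong refl arg_cong[of _ _ fact] arg_cong[of _ _ card]) auto
    finally show ?thesis .
  qed
  have stab: "permute_list \<sigma> w = w" if "\<sigma> \<in> ?G" for \<sigma>
    using that len by (intro nth_equalityI) (auto simp: permute_list_nth lab_def split: if_splits)
  \<comment> \<open>An odd letter is never a letter with entry \<open>c\<close>, so the group fixes
    its position.\<close>
  have sign: "psign \<sigma> w = (1::'k)" if \<sigma>: "\<sigma> \<in> ?G" for \<sigma>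
  proof -
    have "pinv \<sigma> i = i" if i: "i < d" "odd_letter (w ! i)" for i
    proof -
      have "w ! i \<notin> ?C" using i by (auto simp: odd_letter_def path_length_def c_letters_iff)
      then have "lab i = Inr i" by (simp add: lab_def)
      then have "lab (\<sigma> i) = Inr i" using \<sigma> i by auto
      then have "\<sigma> i = i" by (auto simp: lab_def split: if_splits)
      moreover have "\<sigma> permutes {..<d}" using \<sigma> by simp
      ultimately show ?thesis using permutes_inverses(2)[of \<sigma> "{..<d}" i] by simp
    qed
    then show ?thesis by (auto simp: psign_prod[OF len] intro!: prod.neutral)
  qed
  have Gp: "g permutes {..<d}" and Gl: "i < d \<Longrightarrow> lab (g i) = lab i" if "g \<in> ?G" for g i
    using that by auto
  have GI: "g \<in> ?G" if "g permutes {..<d}" "\<And>i. i < d \<Longrightarrow> lab (g i) = lab i" for g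
    using that by auto
  have "of_nat (card ?G) dvd (\<Sum>p\<in>?X. ?F p)"
  proof (rule orbit_sum_dvd[where act = ?act])
    show "finite ?G" by (rule finite_subset[OF _ finite_permutations[of "{..<d}"]]) auto
    show "id \<in> ?G" by (simp add: permutes_id)
    show "g \<circ> h \<in> ?G" if g: "g \<in> ?G" and h: "h \<in> ?G" for g h
    proof (rule GI)
      show "g \<circ> h permutes {..<d}" by (rule permutes_compose[OF Gp[OF h] Gp[OF g]])
      show "lab ((g \<circ> h) i) = lab i" if "i < d" for i
        using Gl[OF g ran[OF Gp[OF h] that]] Gl[OF h that] by simp
    qed
    show "bij g" if "g \<in> ?G" for g by (rule permutes_bij[OF Gp[OF that]])
    show "pinv g \<in> ?G" if g: "g \<in> ?G" for g
    proof (rule GI)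
      show p: "pinv g permutes {..<d}" by (rule permutes_inv[OF Gp[OF g]])
      show "lab (pinv g i) = lab i" if "i < d" for i
        using Gl[OF g ran[OF p that]] permutes_inverses(1)[OF Gp[OF g], of i] by simp
    qed
    show "finite ?X" by simp
    fix p assume p: "p \<in> ?X"
    then obtain u v where uv: "p = (u, v)" "u \<in> words l n d" "v \<in> words l n d" "wmul l u v = Some w"
      by (auto simp: factorizations_def)
    have luv: "length u = d" "length v = d" using uv by (auto simp: words_length)
    show "?act id p = p" using uv by simp
    show "?act (g \<circ> h) p = ?act h (?act g p)" if "h \<in> ?G" for g h
      using uv luv Gp[OF that] by (simp add: permute_list_compose)
    show "?act g p \<in> ?X" if g: "g \<in> ?G" for g
      using factorizations_permute[of u v l n d w g] p uv Gp[OF g] stab[OF g] by simp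
    show "?F (?act g p) = ?F p" if g: "g \<in> ?G" for g
      using tmul_term_permute[OF sx sy, of u v w g] p uv Gp[OF g] sign[OF g] by simp
    show "of_nat (card {g \<in> ?G. ?act g p = p}) dvd ?F p"
    proof (cases "lookup x u = 0 \<or> lookup y v = 0")
      case False
      have Tri: "u \<in> Tri l n d" "v \<in> Tri l n d" using False supersym_Tri sx sy by blast+
      have lm: "lmul l (u ! i) (v ! i) = Some (w ! i)" if "i < d" for i
        using uv(4) that len by (simp add: wmul_iff)
      have uvL: "u ! i \<in> ?L" "v ! i \<in> ?L" if "i < d" for i
        using that uv words_nth by blast+
      \<comment> \<open>The stabiliser of a factorization is a group of the same kind, with the
        pairs of factors as colours.\<close>
      let ?lab' = "\<lambda>i. if w ! i \<in> ?C then Inl (u ! i, v ! i) else Inr i"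
      let ?N = "\<lambda>a. card {i. i < d \<and> w ! i \<in> ?C \<and> (u ! i, v ! i) = a}"
      have stab_eq: "{g \<in> ?G. ?act g p = p} = {\<sigma>. \<sigma> permutes {..<d} \<and> (\<forall>i\<in>{..<d}. ?lab' (\<sigma> i) = ?lab' i)}"
      proof (intro equalityI subsetI)
        fix g assume g: "g \<in> {g \<in> ?G. ?act g p = p}"
        have "?lab' (g i) = ?lab' i" if i: "i < d" for i
        proof -
          from g i have "permute_list g u = u" "permute_list g v = v" "g permutes {..<d}" "lab (g i) = lab i"
            using uv by auto
          moreover from this have "u ! g i = u ! i" "v ! g i = v ! i"
            using i luv permute_list_nth[of g u i] permute_list_nth[of g v i] by auto
          ultimately show ?thesis by (auto simp: lab_def split: if_splits)
        qed
        then show "g \<in> {\<sigma>. \<sigma> permutes {..<d} \<and> (\<forall>i\<in>{..<d}. ?lab' (\<sigma> i) = ?lab' i)}"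
          using g by auto
      next
        fix \<sigma> assume "\<sigma> \<in> {\<sigma>. \<sigma> permutes {..<d} \<and> (\<forall>i\<in>{..<d}. ?lab' (\<sigma> i) = ?lab' i)}"
        then have \<sigma>: "\<sigma> permutes {..<d}" and lab': "\<And>i. i < d \<Longrightarrow> ?lab' (\<sigma> i) = ?lab' i" by auto
        have eq: "u ! \<sigma> i = u ! i" "v ! \<sigma> i = v ! i" if "i < d" for i
          using lab'[OF that] by (auto split: if_splits)
        have "w ! \<sigma> i = w ! i" if "i < d" for i
          using lm[OF that] lm[OF ran[OF \<sigma> that]] eq[OF that] by simp
        then have "lab (\<sigma> i) = lab i" if "i < d" for i
          using that lab'[OF that] by (auto simp: lab_def split: if_splits)
        then have "\<sigma> \<in> ?G" using \<sigma> by auto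
        moreover have "permute_list \<sigma> u = u" "permute_list \<sigma> v = v"
          using eq luv \<sigma> by (auto intro!: nth_equalityI simp: permute_list_nth)
        ultimately show "\<sigma> \<in> {g \<in> ?G. ?act g p = p}" using uv by simp
      qed
      have "card {g \<in> ?G. ?act g p = p} = (\<Prod>a\<in>?L \<times> ?L. fact (?N a))"
        unfolding stab_eq
        by (rule card_partial_color_preserving[where Q = "\<lambda>i. w ! i \<in> ?C" and h = "\<lambda>i. (u ! i, v ! i)"])
          (simp_all add: uvL)
      also have "\<dots> dvd cfact l n u * cfact l n v"
      proof -
        \<comment> \<open>The pairs of factors are sorted into those with a letter \<open>c\<close>
          on the left, those with one only on the right, and those with none. The three products of
          factorials divide \<open>cfact l n u\<close>, divide \<open>cfact l n v\<close>, and equal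
          one, respectively.\<close>
        let ?R = "?L - ?C"
        have CL: "?C \<subseteq> ?L" by (rule subsetI) (simp only: c_letters_iff)
        have fR: "finite ?R" and fC: "finite ?C" by simp_all
        have dis: "(?C \<times> ?L) \<inter> (?R \<times> ?C) = {}" "(?C \<times> ?L \<union> ?R \<times> ?C) \<inter> (?R \<times> ?R) = {}" by blast+
        have "?L \<times> ?L = (?C \<times> ?L \<union> ?R \<times> ?C) \<union> ?R \<times> ?R" using CL by blast
        then have split: "prod f (?L \<times> ?L) = prod f (?C \<times> ?L) * prod f (?R \<times> ?C) * prod f (?R \<times> ?R)"
          for f :: "letter \<times> letter \<Rightarrow> nat"
          using prod.union_disjoint[OF _ _ dis(2), of f] prod.union_disjoint[OF _ _ dis(1), of f] fC fR
          by simp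
        have "(\<Prod>a\<in>?L \<times> ?L. fact (?N a) :: nat)
            = (\<Prod>a\<in>?C \<times> ?L. fact (?N a)) * (\<Prod>a\<in>?R \<times> ?C. fact (?N a)) * (\<Prod>a\<in>?R \<times> ?R. fact (?N a))"
          by (rule split)
        moreover have "(\<Prod>a\<in>?R \<times> ?R. fact (?N a)) = (1::nat)"
        proof (rule prod.neutral, rule ballI)
          fix a assume a: "a \<in> ?R \<times> ?R"
          have "i = j" if "i < d" "j < d" "w ! i \<in> ?C" "(u ! i, v ! i) = a" "(u ! j, v ! j) = a" for i j
          proof (rule ccontr)
            assume "i \<noteq> j"
            have "odd_letter (u ! i)"
              using a that(4) by (intro odd_factor_of_c_letter[OF lm[OF that(1)] uvL[OF that(1)] that(3)]) auto
            moreover have "u ! i = u ! j" using that(4,5) by auto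
            ultimately show False using Tri(1) that(1,2) \<open>i \<noteq> j\<close> unfolding Tri_def by blast
          qed
          then have "\<forall>i\<in>S. \<forall>j\<in>S. i = j" if "S = {i. i < d \<and> w ! i \<in> ?C \<and> (u ! i, v ! i) = a}" for S
            using that by simp
          then have "?N a \<le> Suc 0" by (subst card_le_Suc0_iff_eq) simp_all
          then show "fact (?N a) = (1::nat)" by (intro fact_eq_1) simp
        qed
        moreover have "(\<Prod>a\<in>?C \<times> ?L. fact (?N a) :: nat) dvd cfact l n u"
        proof -
          \<comment> \<open>For fixed \<open>c\<close> the counted positions are distributed among
            the right factors \<open>e\<close>, so their total is at most the multiplicity of
            \<open>c\<close> in \<open>u\<close>.\<close>
          have "(\<Prod>e\<in>?L. fact (?N (c, e)) :: nat) dvd fact (count_list u c)" for c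
          proof -
            have "(\<Prod>e\<in>?L. fact (?N (c, e)) :: nat) dvd fact (\<Sum>e\<in>?L. ?N (c, e))"
              by (intro prod_fact_dvd_fact_sum) simp
            also have "(\<Sum>e\<in>?L. ?N (c, e)) = card (\<Union>e\<in>?L. {i. i < d \<and> w ! i \<in> ?C \<and> (u ! i, v ! i) = (c, e)})"
              by (subst card_UN_disjoint) auto
            also have "fact \<dots> dvd (fact (count_list u c) :: nat)"
              unfolding count_list_card luv by (intro fact_dvd card_mono) auto
            finally show ?thesis .
          qed
          then have "(\<Prod>c\<in>?C. \<Prod>e\<in>?L. fact (?N (c, e)) :: nat) dvd cfact l n u"
            unfolding cfact_eq by (intro prod_dvd_prod)
          then show ?thesis unfolding prod_Times .
        qed
        moreover have "(\<Prod>a\<in>?R \<times> ?C. fact (?N a) :: nat) dvd cfact l n v"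
        proof -
          have "(\<Prod>e\<in>?R. fact (?N (e, c)) :: nat) dvd fact (count_list v c)" for c
          proof -
            have "(\<Prod>e\<in>?R. fact (?N (e, c)) :: nat) dvd fact (\<Sum>e\<in>?R. ?N (e, c))"
              by (intro prod_fact_dvd_fact_sum) simp
            also have "(\<Sum>e\<in>?R. ?N (e, c)) = card (\<Union>e\<in>?R. {i. i < d \<and> w ! i \<in> ?C \<and> (u ! i, v ! i) = (e, c)})"
              by (subst card_UN_disjoint) auto
            also have "fact \<dots> dvd (fact (count_list v c) :: nat)"
              unfolding count_list_card luv by (intro fact_dvd card_mono) auto
            finally show ?thesis .
          qed
          then have "(\<Prod>c\<in>?C. \<Prod>e\<in>?R. fact (?N (e, c)) :: nat) dvd cfact l n v"
            unfolding cfact_eq by (intro prod_dvd_prod)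
          moreover have "(\<Prod>a\<in>?R \<times> ?C. fact (?N a) :: nat) = (\<Prod>c\<in>?C. \<Prod>e\<in>?R. fact (?N (e, c)))"
            unfolding prod_Times by (rule prod.swap)
          ultimately show ?thesis by simp
        qed
        ultimately show ?thesis by (simp add: mult_dvd_mono)
      qed
      finally have "of_nat (card {g \<in> ?G. ?act g p = p}) dvd (of_nat (cfact l n u * cfact l n v) :: 'k)"
        by (elim dvdE) simp
      also have "\<dots> dvd lookup x u * lookup y v"
        using x y uv unfolding Tset_def of_nat_mult by (intro mult_dvd_mono) auto
      also have "\<dots> dvd ?F p" using uv by (simp add: mult.assoc)
      finally show ?thesis .
    qed (use uv in auto)
  qed
  then show ?thesis
    using cG by (simp add: lookup_tmul[OF l1 supersymD(1)[OF sx] supersymD(1)[OF sy]])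
qed

section \<open>The ring structure of \<open>T\<close>\<close>

lemma Tset_supersym: "x \<in> Tset l n d \<Longrightarrow> x \<in> supersym l n d"
  by (simp add: Tset_def)

lemma Tset_keys: "x \<in> Tset l n d \<Longrightarrow> keys x \<subseteq> words l n d"
  by (simp add: Tset_def supersym_def)

lemma Tset_tmul:
  fixes x y :: "tensor_word \<Rightarrow>\<^sub>0 'k::{idom, ring_char_0}"
  assumes "l \<ge> 1" "x \<in> Tset l n d" "y \<in> Tset l n d"
  shows "tmul l n x y \<in> Tset l n d"
  unfolding Tset_def using cfact_tmul[OF assms] supersym_tmul[OF assms(1) assms(2,3)[THEN Tset_supersym]]
  by blast

lemma tmul_assoc:
  fixes x y z :: "tensor_word \<Rightarrow>\<^sub>0 'k::comm_ring_1"
  assumes l1: "l \<ge> 1" and k: "keys x \<subseteq> words l n d" "keys y \<subseteq> words l n d" "keys z \<subseteq> words l n d"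
  shows "tmul l n (tmul l n x y) z = tmul l n x (tmul l n y z)"
proof (rule bilin_extend_assoc)
  fix u v w assume "u \<in> keys x" "v \<in> keys y" "w \<in> keys z"
  then have W: "u \<in> words l n d" "v \<in> words l n d" "w \<in> words l n d" using k by auto
  note assoc = wmul_assoc[OF W]
  show "lin_extend (\<lambda>t. word_mult l n t w) (word_mult l n u v)
      = (lin_extend (word_mult l n u) (word_mult l n v w) :: _ \<Rightarrow>\<^sub>0 'k)"
  proof (cases "wmul l u v"; cases "wmul l v w")
    fix t t' assume t: "wmul l u v = Some t" "wmul l v w = Some t'"
    have T: "t \<in> words l n d" "t' \<in> words l n d"
      using wmul_SomeD(1)[OF t(1) W(1,2)] wmul_SomeD(1)[OF t(2) W(2,3)] by auto
    have "eps u v * eps t w = (eps v w * eps u t' :: 'k)"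
      using words_length[OF W(1)] words_length[OF W(2)] words_length[OF W(3)] words_length[OF T(1)]
        words_length[OF T(2)] wmul_odd[OF t(1) W(1,2)] wmul_odd[OF t(2) W(2,3)]
      by (intro eps_cocycle[of u d]) auto
    moreover have "wmul l t w = wmul l u t'" using assoc t by simp
    ultimately show ?thesis
      using t W T by (cases "wmul l u t'") (simp_all add: word_mult_eq[OF l1] scale_single)
  next
    fix t assume t: "wmul l u v = Some t" "wmul l v w = None"
    have T: "t \<in> words l n d" using wmul_SomeD(1)[OF t(1) W(1,2)] .
    show ?thesis using t assoc W T by (simp add: word_mult_eq[OF l1])
  next
    fix t' assume t: "wmul l u v = None" "wmul l v w = Some t'"
    have T: "t' \<in> words l n d" using wmul_SomeD(1)[OF t(2) W(2,3)] .
    show ?thesis using t assoc[symmetric] W T by (simp add: word_mult_eq[OF l1])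
  next
    assume "wmul l u v = None" "wmul l v w = None"
    then show ?thesis using W by (simp add: word_mult_eq[OF l1])
  qed
qed

text \<open>The unit and the idempotent of the double centralizer property have this form.\<close>

definition is_diagonal :: "nat \<Rightarrow> nat \<Rightarrow> nat \<Rightarrow> (nat \<Rightarrow> bool) \<Rightarrow> (tensor_word \<Rightarrow>\<^sub>0 'k::comm_ring_1) \<Rightarrow> bool"
  where "is_diagonal l n d Q z \<longleftrightarrow> (\<forall>i. Q i \<longrightarrow> i \<le> l) \<and> (\<forall>w. lookup z w =
    (if length w = d \<and> (\<forall>i<d. \<exists>p. w ! i = idl p \<and> Q (fst p) \<and> snd p \<in> {1..n}) then 1 else 0))"

lemma idl_inject: "idl p = idl q \<longleftrightarrow> p = q"
  by (metis idl_simps(1))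

lemma is_diagonal_lookup:
  "is_diagonal l n d Q z \<Longrightarrow> lookup z w =
    (if length w = d \<and> (\<forall>i<d. \<exists>p. w ! i = idl p \<and> Q (fst p) \<and> snd p \<in> {1..n}) then 1 else 0)"
  by (simp add: is_diagonal_def)

lemma is_diagonal_keys:
  assumes "is_diagonal l n d Q z"
  shows "keys z \<subseteq> words l n d"
proof
  fix w assume "w \<in> keys z"
  then have "length w = d" "\<forall>i<d. \<exists>p. w ! i = idl p \<and> Q (fst p) \<and> snd p \<in> {1..n}"
    using is_diagonal_lookup[OF assms, of w] by (auto simp: in_keys_iff split: if_splits)
  then show "w \<in> words l n d"
    using assms by (intro wordsI) (auto simp: is_diagonal_def idl_in_letters)
qed

lemma is_diagonal_Tset:
  assumes z: "is_diagonal l n d Q z"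
  shows "z \<in> Tset l n d"
  unfolding Tset_def supersym_def
proof (intro CollectI conjI allI impI ballI is_diagonal_keys[OF z])
  let ?P = "\<lambda>x. \<exists>p. x = idl p \<and> Q (fst p) \<and> snd p \<in> {1..n}"
  fix w assume w: "w \<in> words l n d"
  then have len: "length w = d" by (rule words_length)
  have eq: "(\<forall>i<d. ?P (w ! i)) \<longleftrightarrow> (\<forall>x\<in>set w. ?P x)" using len by (simp add: all_set_conv_all_nth)
  {
    fix \<sigma> assume \<sigma>: "\<sigma> permutes {..<d}"
    have eq': "(\<forall>i<d. ?P (permute_list \<sigma> w ! i)) \<longleftrightarrow> (\<forall>x\<in>set (permute_list \<sigma> w). ?P x)"
      using len by (simp add: all_set_conv_all_nth)
    have "psign \<sigma> w = (1::'a)" if "\<forall>i<d. ?P (w ! i)"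
      using that by (force simp: psign_prod[OF len] intro!: prod.neutral)
    then show "lookup z (permute_list \<sigma> w) = psign \<sigma> w * lookup z w"
      unfolding is_diagonal_lookup[OF z] eq' using \<sigma> len eq by auto
  }
  show "of_nat (cfact l n w) dvd lookup z w"
  proof (cases "\<forall>x\<in>set w. ?P x")
    case True
    have "x \<notin> set w" if "x \<in> c_letters l n" for x
    proof
      assume "x \<in> set w"
      with True obtain p where "x = idl p" by blast
      with that show False unfolding c_letters_iff by simp
    qed
    then have "cfact l n w = 1" unfolding cfact_eq
      by (intro prod.neutral) (auto simp: count_list_0_iff[symmetric] simp del: count_list_0_iff)
    then show ?thesis by simp
  next
    case False
    then show ?thesis unfolding is_diagonal_lookup[OF z] eq by (simp only: if_False simp_thms dvd_0_right)
  qed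
qed

text \<open>The only word of identities that can stand to the left in a factorization of
  \<open>w\<close> is the one at the sources of \<open>w\<close>. Hence multiplication by
  \<open>z\<close> projects onto the words whose sources satisfy \<open>Q\<close>.\<close>

lemma diagonal_tmul_left:
  fixes x z :: "tensor_word \<Rightarrow>\<^sub>0 'k::comm_ring_1"
  assumes l1: "l \<ge> 1" and z: "is_diagonal l n d Q z" and x: "keys x \<subseteq> words l n d"
  shows "lookup (tmul l n z x) w = (if \<forall>i<d. Q (fst (src (w ! i))) then lookup x w else 0)"
proof (cases "w \<in> words l n d")
  case False
  then show ?thesis
    by (simp add: lookup_notin_words[OF x] lookup_notin_words[OF keys_tmul[OF l1 is_diagonal_keys[OF z] x]])
next
  case w: True
  have len: "length w = d" using w by (rule words_length)
  let ?u = "map (\<lambda>a. idl (src a)) w"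
  have u: "?u \<in> words l n d"
    using len src_letter[OF words_nth[OF w]] by (intro wordsI) (simp_all add: idl_in_letters)
  have uw: "(?u, w) \<in> factorizations l n d w"
    using len words_nth[OF w] u w by (auto simp: factorizations_def wmul_iff intro: lmul_idl_left)
  have zu: "lookup z ?u = (if \<forall>i<d. Q (fst (src (w ! i))) then 1 else 0)"
    using len src_letter[OF words_nth[OF w]] by (simp add: is_diagonal_lookup[OF z] idl_inject)
  have e1: "eps ?u w = (1::'k)" using len by (intro eps_even_left) auto
  have "lookup (tmul l n z x) w = (\<Sum>p\<in>factorizations l n d w.
      if p = (?u, w) then lookup z ?u * lookup x w else 0)"
    unfolding lookup_tmul[OF l1 is_diagonal_keys[OF z] x]
  proof (rule sum.cong[OF refl])
    fix p assume p: "p \<in> factorizations l n d w"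
    then obtain u v where uv: "p = (u, v)" "u \<in> words l n d" "v \<in> words l n d" "wmul l u v = Some w"
      by (auto simp: factorizations_def)
    have "u = ?u \<and> v = w" if "lookup z u \<noteq> 0"
    proof -
      have "\<forall>i<d. \<exists>p. u ! i = idl p \<and> Q (fst p) \<and> snd p \<in> {1..n}"
        using \<open>lookup z u \<noteq> 0\<close> unfolding is_diagonal_lookup[OF z] by argo
      then have id: "\<exists>p. u ! i = idl p" if "i < d" for i using that by blast
      have "u ! i = idl (src (w ! i)) \<and> v ! i = w ! i" if i: "i < d" for i
      proof -
        obtain p where p: "u ! i = idl p" using id i by blast
        have lm: "lmul l (idl p) (v ! i) = Some (w ! i)" using uv(4) i len p by (auto simp: wmul_iff)
        have V: "v ! i \<in> letters l n" using uv(3) i by (rule words_nth)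
        have "src (v ! i) = p" using lm lmul_None[of "idl p" "v ! i" l] by force
        then show ?thesis using lm lmul_idl_left[OF V] p by auto
      qed
      then show ?thesis using u w uv len by (auto intro!: word_eqI[of _ l n d])
    qed
    then show "(case p of (u, v) \<Rightarrow> eps u v * lookup z u * lookup x v)
        = (if p = (?u, w) then lookup z ?u * lookup x w else 0)"
      using uv(1) e1 by (cases "lookup z u = 0") auto
  qed
  also have "\<dots> = lookup z ?u * lookup x w" using uw by simp
  finally show ?thesis unfolding zu
    by (simp only: split: if_split) (simp only: mult_1_left mult_1_right mult_zero_left mult_zero_right simp_thms, blast)
qed

lemma diagonal_tmul_right:
  fixes x z :: "tensor_word \<Rightarrow>\<^sub>0 'k::comm_ring_1"
  assumes l1: "l \<ge> 1" and z: "is_diagonal l n d Q z" and x: "keys x \<subseteq> words l n d"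
  shows "lookup (tmul l n x z) w = (if \<forall>i<d. Q (fst (tgt (w ! i))) then lookup x w else 0)"
proof (cases "w \<in> words l n d")
  case False
  then show ?thesis
    by (simp add: lookup_notin_words[OF x] lookup_notin_words[OF keys_tmul[OF l1 x is_diagonal_keys[OF z]]])
next
  case w: True
  have len: "length w = d" using w by (rule words_length)
  let ?u = "map (\<lambda>a. idl (tgt a)) w"
  have u: "?u \<in> words l n d"
    using len tgt_letter[OF words_nth[OF w]] by (intro wordsI) (simp_all add: idl_in_letters)
  have uw: "(w, ?u) \<in> factorizations l n d w"
    using len words_nth[OF w] u w by (auto simp: factorizations_def wmul_iff intro: lmul_idl_right)
  have zu: "lookup z ?u = (if \<forall>i<d. Q (fst (tgt (w ! i))) then 1 else 0)"
    using len tgt_letter[OF words_nth[OF w]] by (simp add: is_diagonal_lookup[OF z] idl_inject)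
  have e1: "eps w ?u = (1::'k)" using len by (intro eps_even_right) auto
  have "lookup (tmul l n x z) w = (\<Sum>p\<in>factorizations l n d w.
      if p = (w, ?u) then lookup x w * lookup z ?u else 0)"
    unfolding lookup_tmul[OF l1 x is_diagonal_keys[OF z]]
  proof (rule sum.cong[OF refl])
    fix p assume p: "p \<in> factorizations l n d w"
    then obtain v u where uv: "p = (v, u)" "v \<in> words l n d" "u \<in> words l n d" "wmul l v u = Some w"
      by (auto simp: factorizations_def)
    have "u = ?u \<and> v = w" if "lookup z u \<noteq> 0"
    proof -
      have "\<forall>i<d. \<exists>p. u ! i = idl p \<and> Q (fst p) \<and> snd p \<in> {1..n}"
        using \<open>lookup z u \<noteq> 0\<close> unfolding is_diagonal_lookup[OF z] by argo
      then have id: "\<exists>p. u ! i = idl p" if "i < d" for i using that by blast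
      have "u ! i = idl (tgt (w ! i)) \<and> v ! i = w ! i" if i: "i < d" for i
      proof -
        obtain p where p: "u ! i = idl p" using id i by blast
        have lm: "lmul l (v ! i) (idl p) = Some (w ! i)" using uv(4) i len p by (auto simp: wmul_iff)
        have V: "v ! i \<in> letters l n" using uv(2) i by (rule words_nth)
        have "tgt (v ! i) = p" using lm lmul_None[of "v ! i" "idl p" l] by force
        then show ?thesis using lm lmul_idl_right[OF V] p by auto
      qed
      then show ?thesis using u w uv len by (auto intro!: word_eqI[of _ l n d])
    qed
    then show "(case p of (v, u) \<Rightarrow> eps v u * lookup x v * lookup z u)
        = (if p = (w, ?u) then lookup x w * lookup z ?u else 0)"
      using uv(1) e1 by (cases "lookup z u = 0") auto
  qed
  also have "\<dots> = lookup x w * lookup z ?u" using uw by simp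
  finally show ?thesis unfolding zu
    by (simp only: split: if_split) (simp only: mult_1_left mult_1_right mult_zero_left mult_zero_right simp_thms, blast)
qed

lemma T_algebra_simps:
  "carrier (T_algebra l n d) = (Tset l n d :: (_ \<Rightarrow>\<^sub>0 'k::{idom, ring_char_0}) set)"
  "x \<otimes>\<^bsub>T_algebra l n d\<^esub> y = tmul l n x (y :: _ \<Rightarrow>\<^sub>0 'k)"
  "x \<oplus>\<^bsub>T_algebra l n d\<^esub> y = x + y"
  "\<zero>\<^bsub>T_algebra l n d\<^esub> = (0 :: _ \<Rightarrow>\<^sub>0 'k)"
  "\<one>\<^bsub>T_algebra l n d\<^esub> = (tensor l n (replicate d \<one>\<^bsub>matrix_ring (ext_zigzag l) n\<^esub>) :: _ \<Rightarrow>\<^sub>0 'k)"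
  by (simp_all add: T_algebra_def schur_algebra_def tensor_power_def span_eta)

lemma is_diagonal_one:
  assumes "l \<ge> 1"
  shows "is_diagonal l n d (\<lambda>i. i \<le> l) \<one>\<^bsub>T_algebra l n d :: (_ \<Rightarrow>\<^sub>0 'k::{idom, ring_char_0}) ring\<^esub>"
  using lookup_tensor_one[OF assms, of n d] unfolding is_diagonal_def T_algebra_simps by blast

lemma is_diagonal_xi_e:
  assumes "l \<ge> 1"
  shows "is_diagonal l n d (\<lambda>i. i < l) (xi_e l n d :: _ \<Rightarrow>\<^sub>0 'k::{idom, ring_char_0})"
  using lookup_xi_e[OF assms, of n d, where 'k = 'k] unfolding is_diagonal_def by (simp add: less_imp_le)

lemma T_algebra_ring:
  assumes l1: "l \<ge> 1"
  shows "ring (T_algebra l n d :: (_ \<Rightarrow>\<^sub>0 'k::{idom, ring_char_0}) ring)"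
proof (rule ringI)
  let ?T = "T_algebra l n d :: (_ \<Rightarrow>\<^sub>0 'k) ring"
  show "abelian_group ?T"
  proof (rule abelian_groupI)
    fix x assume "x \<in> carrier ?T"
    then show "\<exists>y\<in>carrier ?T. y \<oplus>\<^bsub>?T\<^esub> x = \<zero>\<^bsub>?T\<^esub>"
      unfolding T_algebra_simps by (intro bexI[of _ "- x"] Tset_uminus) auto
  qed (simp_all add: T_algebra_simps Tset_add Tset_zero ac_simps)
  note one = is_diagonal_one[OF l1, of n d, where 'k = 'k]
  show "Group.monoid ?T"
  proof (rule Group.monoidI)
    show "\<one>\<^bsub>?T\<^esub> \<in> carrier ?T" using is_diagonal_Tset[OF one] by (simp add: T_algebra_simps)
    fix x assume "x \<in> carrier ?T"
    then have x: "keys x \<subseteq> words l n d" by (simp add: T_algebra_simps Tset_keys)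
    have le: "\<forall>i<d. fst (src (w ! i)) \<le> l" "\<forall>i<d. fst (tgt (w ! i)) \<le> l" if "w \<in> words l n d" for w
      using src_letter tgt_letter words_nth[OF that] by blast+
    show "\<one>\<^bsub>?T\<^esub> \<otimes>\<^bsub>?T\<^esub> x = x"
    proof (rule poly_mapping_eqI)
      fix w
      show "lookup (\<one>\<^bsub>?T\<^esub> \<otimes>\<^bsub>?T\<^esub> x) w = lookup x w"
        using le(1)[of w] lookup_notin_words[OF x, of w]
        unfolding T_algebra_simps(2) diagonal_tmul_left[OF l1 one x] by (cases "w \<in> words l n d") auto
    qed
    show "x \<otimes>\<^bsub>?T\<^esub> \<one>\<^bsub>?T\<^esub> = x"
    proof (rule poly_mapping_eqI)
      fix w
      show "lookup (x \<otimes>\<^bsub>?T\<^esub> \<one>\<^bsub>?T\<^esub>) w = lookup x w"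
        using le(2)[of w] lookup_notin_words[OF x, of w]
        unfolding T_algebra_simps(2) diagonal_tmul_right[OF l1 one x] by (cases "w \<in> words l n d") auto
    qed
  next
    fix x y z assume "x \<in> carrier ?T" "y \<in> carrier ?T" "z \<in> carrier ?T"
    then show "x \<otimes>\<^bsub>?T\<^esub> y \<otimes>\<^bsub>?T\<^esub> z = x \<otimes>\<^bsub>?T\<^esub> (y \<otimes>\<^bsub>?T\<^esub> z)"
      unfolding T_algebra_simps by (intro tmul_assoc[OF l1] Tset_keys)
  qed (simp_all add: T_algebra_simps Tset_tmul[OF l1])
qed (simp_all add: T_algebra_simps bilin_extend_add_left bilin_extend_add_right)


section \<open>Generating words\<close>


text \<open>The target determines the letter, so such a word is the only rearrangement of itself
  with its sequence of targets (\<open>separated_eqI\<close>). Letters may still repeat.\<close>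

definition separated :: "tensor_word \<Rightarrow> bool"
  where "separated w \<longleftrightarrow> (\<forall>x\<in>set w. \<forall>y\<in>set w. tgt x = tgt y \<longrightarrow> x = y)"

lemma separatedI:
  "(\<And>i j. i < length w \<Longrightarrow> j < length w \<Longrightarrow> tgt (w ! i) = tgt (w ! j) \<Longrightarrow> w ! i = w ! j) \<Longrightarrow> separated w"
  unfolding separated_def by (metis in_set_conv_nth)

lemma separated_eqI:
  assumes \<kappa>: "separated \<kappa>" and "mset w = mset \<kappa>" and tgt: "map tgt w = map tgt \<kappa>"
  shows "w = \<kappa>"
proof (rule nth_equalityI)
  show len: "length w = length \<kappa>" using tgt by (rule map_eq_imp_length_eq)
  fix i assume i: "i < length w"
  then have "w ! i \<in> set \<kappa>" using assms(2) by (metis mset_eq_setD nth_mem)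
  moreover have "\<kappa> ! i \<in> set \<kappa>" using i len by simp
  moreover have "tgt (w ! i) = tgt (\<kappa> ! i)" using i len tgt by (metis nth_map)
  ultimately show "w ! i = \<kappa> ! i" using \<kappa> by (simp add: separated_def)
qed

lemma xi_word_support: "w \<in> Tri l n d \<Longrightarrow> lookup (xi_word w) v \<noteq> (0::'k::comm_ring_1) \<Longrightarrow> mset v = mset w"
  using lookup_xi_word(2) by blast

lemma keys_xi_word: "w \<in> Tri l n d \<Longrightarrow> keys (xi_word w :: _ \<Rightarrow>\<^sub>0 'k::comm_ring_1) \<subseteq> words l n d"
  by (rule supersymD(1)[OF xi_word_supersym])

text \<open>In a contributing factorization the right factor is a rearrangement of \<kappa> with the
  targets of \<kappa>, hence \<kappa> itself, and cancellation makes the left factor unique. So the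
  sum for the coefficient has at most one nonzero term, and multiplication by
  \<open>xi_word \<kappa>\<close> reads off coefficients of \<open>x\<close>.\<close>

lemma tmul_xi_word:
  fixes x :: "_ \<Rightarrow>\<^sub>0 'k::comm_ring_1"
  assumes l1: "l \<ge> 1" and x: "keys x \<subseteq> words l n d" and \<kappa>: "\<kappa> \<in> Tri l n d" "separated \<kappa>"
    and tgt: "map tgt w = map tgt \<kappa>"
  shows "u \<in> words l n d \<Longrightarrow> wmul l u \<kappa> = Some w \<Longrightarrow>
      lookup (tmul l n x (xi_word \<kappa>)) w = eps u \<kappa> * lookup x u"
    and "(\<And>u. u \<in> words l n d \<Longrightarrow> wmul l u \<kappa> \<noteq> Some w) \<Longrightarrow> lookup (tmul l n x (xi_word \<kappa>)) w = 0"
proof -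
  let ?F = "\<lambda>(u, v). eps u v * lookup x u * (lookup (xi_word \<kappa>) v :: 'k)"
  note L = lookup_tmul[OF l1 x keys_xi_word[OF \<kappa>(1)]]
  have *: "v = \<kappa>" if "(u, v) \<in> factorizations l n d w" "lookup (xi_word \<kappa>) v \<noteq> (0::'k)" for u v
  proof (rule separated_eqI[OF \<kappa>(2) xi_word_support[OF \<kappa>(1) that(2)]])
    show "map tgt v = map tgt \<kappa>"
      using that(1) wmul_SomeD(3) tgt unfolding factorizations_def by fastforce
  qed
  {
    assume u: "u \<in> words l n d" "wmul l u \<kappa> = Some w"
    have "lookup (tmul l n x (xi_word \<kappa>)) w
        = (\<Sum>p\<in>factorizations l n d w. if p = (u, \<kappa>) then eps u \<kappa> * lookup x u else 0)"
      unfolding L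
    proof (rule sum.cong[OF refl])
      fix p assume p: "p \<in> factorizations l n d w"
      obtain u' v where uv: "p = (u', v)" by (cases p)
      show "?F p = (if p = (u, \<kappa>) then eps u \<kappa> * lookup x u else 0)"
      proof (cases "v = \<kappa>")
        case True
        have u': "u' \<in> words l n d" "wmul l u' \<kappa> = Some w"
          using p uv True by (simp_all add: factorizations_def)
        have "u' = u" by (rule wmul_right_cancel[OF u'(2) u(2) u'(1) u(1) Tri_words[OF \<kappa>(1)]])
        then show ?thesis using True uv by (simp add: lookup_xi_word_self[OF \<kappa>(1)])
      next
        case False
        then have "lookup (xi_word \<kappa>) v = (0::'k)" using * p uv by blast
        then show ?thesis using False uv by simp
      qed
    qed
    also have "\<dots> = eps u \<kappa> * lookup x u"
    proof -
      have "(u, \<kappa>) \<in> factorizations l n d w"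
        using u Tri_words[OF \<kappa>(1)] by (simp add: factorizations_def)
      then show ?thesis by simp
    qed
    finally show "lookup (tmul l n x (xi_word \<kappa>)) w = eps u \<kappa> * lookup x u" .
  }
  {
    assume "\<And>u. u \<in> words l n d \<Longrightarrow> wmul l u \<kappa> \<noteq> Some w"
    then have "lookup (xi_word \<kappa>) v = (0::'k)" if "(u, v) \<in> factorizations l n d w" for u v
      using *[OF that] that by (auto simp: factorizations_def)
    then show "lookup (tmul l n x (xi_word \<kappa>)) w = 0"
      unfolding L by (intro sum.neutral) auto
  }
qed

lemma tmul_tgt_support:
  fixes x y :: "_ \<Rightarrow>\<^sub>0 'k::comm_ring_1"
  assumes l1: "l \<ge> 1" and x: "keys x \<subseteq> words l n d" and y: "keys y \<subseteq> words l n d"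
    and ne: "lookup (tmul l n x y) w \<noteq> 0"
  obtains u v where "u \<in> words l n d" "v \<in> words l n d" "wmul l u v = Some w"
    "lookup x u \<noteq> 0" "lookup y v \<noteq> 0"
proof -
  from ne obtain p where p: "p \<in> factorizations l n d w"
    "(case p of (u, v) \<Rightarrow> eps u v * lookup x u * lookup y v) \<noteq> 0"
    unfolding lookup_tmul[OF l1 x y] by (meson sum.not_neutral_contains_not_neutral)
  obtain u v where "p = (u, v)" by (cases p)
  with p show thesis by (intro that[of u v]) (auto simp: factorizations_def)
qed

lemma tmul_xi_word_support:
  fixes x :: "_ \<Rightarrow>\<^sub>0 'k::comm_ring_1"
  assumes l1: "l \<ge> 1" and x: "keys x \<subseteq> words l n d" and \<kappa>: "\<kappa> \<in> Tri l n d"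
    and ne: "lookup (tmul l n x (xi_word \<kappa>)) w \<noteq> 0"
  shows "mset (map tgt w) = mset (map tgt \<kappa>)"
proof -
  from tmul_tgt_support[OF l1 x keys_xi_word[OF \<kappa>] ne] obtain u v where
    uv: "u \<in> words l n d" "v \<in> words l n d" "wmul l u v = Some w" "lookup (xi_word \<kappa>) v \<noteq> (0::'k)" by blast
  have "mset v = mset \<kappa>" by (rule xi_word_support[OF \<kappa> uv(4)])
  then show ?thesis using wmul_SomeD(3)[OF uv(3,1,2)] by (simp only: mset_map)
qed

text \<open>Every word of the support can be rearranged so that its targets appear in the order
  \<open>q\<close>, with the same sign for \<open>x\<close> and \<open>y\<close>. This matters
  because \<open>tmul_xi_word\<close> gives access only to coefficients with targets in a prescribed
  order.\<close>

lemma supersym_eqI: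
  fixes x y :: "_ \<Rightarrow>\<^sub>0 'k::comm_ring_1"
  assumes x: "x \<in> supersym l n d" and y: "y \<in> supersym l n d"
    and sx: "\<And>w. lookup x w \<noteq> 0 \<Longrightarrow> mset (map tgt w) = mset q"
    and sy: "\<And>w. lookup y w \<noteq> 0 \<Longrightarrow> mset (map tgt w) = mset q"
    and eq: "\<And>w. w \<in> words l n d \<Longrightarrow> map tgt w = q \<Longrightarrow> lookup x w = lookup y w"
  shows "x = y"
proof (rule poly_mapping_eqI)
  fix w
  show "lookup x w = lookup y w"
  proof (cases "w \<in> words l n d \<and> mset (map tgt w) = mset q")
    case True
    then have w: "w \<in> words l n d" and "mset q = mset (map tgt w)" by auto
    then obtain \<sigma> where \<sigma>: "\<sigma> permutes {..<length (map tgt w)}" "q = permute_list \<sigma> (map tgt w)"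
      using mset_eq_permute by blast
    have p: "\<sigma> permutes {..<d}" using \<sigma>(1) words_length[OF w] by simp
    have "map tgt (permute_list \<sigma> w) = q"
      using \<sigma> by (simp add: permute_list_map)
    then have "lookup x (permute_list \<sigma> w) = lookup y (permute_list \<sigma> w)"
      by (intro eq permute_list_words[OF w p])
    then have "psign \<sigma> w * (psign \<sigma> w * lookup x w) = psign \<sigma> w * (psign \<sigma> w * lookup y w)"
      using supersymD(2)[OF x p w] supersymD(2)[OF y p w] by simp
    then show ?thesis unfolding mult.assoc[symmetric] by simp
  next
    case False
    then show ?thesis
      using sx[of w] sy[of w] lookup_notin_words[OF supersymD(1)[OF x]]
        lookup_notin_words[OF supersymD(1)[OF y]] by metis
  qed
qed

lemma cfact_eq_1:
  assumes "\<And>i j. i < length w \<Longrightarrow> j < length w \<Longrightarrow> w ! i = w ! j \<Longrightarrow> w ! i \<in> c_letters l n \<Longrightarrow> i = j"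
  shows "cfact l n w = 1"
  unfolding cfact_eq
proof (rule prod.neutral, rule ballI)
  fix x assume x: "x \<in> c_letters l n"
  have "\<forall>i\<in>{i. i < length w \<and> w ! i = x}. \<forall>j\<in>{i. i < length w \<and> w ! i = x}. i = j"
    using assms x by auto
  then have "count_list w x \<le> Suc 0" unfolding count_list_card by (subst card_le_Suc0_iff_eq) auto
  then show "fact (count_list w x) = (1::nat)" by (intro fact_eq_1) simp
qed

lemma wmul_exists:
  assumes "length u = length v" "\<And>i. i < length v \<Longrightarrow> \<exists>z. lmul l (u ! i) (v ! i) = Some z"
  shows "\<exists>w. wmul l u v = Some w"
proof -
  obtain f where f: "\<And>i. i < length v \<Longrightarrow> lmul l (u ! i) (v ! i) = Some (f i)"
    using assms(2) by metis
  have "wmul l u v = Some (map f [0..<length v])" using f assms(1) by (simp add: wmul_iff)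
  then show ?thesis by blast
qed


declare split_paired_Ex [simp del] split_paired_All [simp del]

section \<open>Arrows out of the vertex \<open>l\<close> and generating words\<close>

definition arr :: "nat \<Rightarrow> nat \<Rightarrow> nat \<Rightarrow> letter"
  where "arr l r s = ([l, l - 1], r, s)"

text \<open>
  Words whose basis elements generate \<open>T f\<close> as a right \<open>f T f\<close>-module: each strand that starts at
  the vertex \<open>l\<close> is moved to an unoccupied place at the vertex \<open>l - 1\<close>.
\<close>

definition generating :: "nat \<Rightarrow> nat \<Rightarrow> nat \<Rightarrow> tensor_word \<Rightarrow> bool"
  where "generating l n d w \<longleftrightarrow> w \<in> words l n d \<and>
    (\<forall>i<d. (\<exists>p. fst p < l \<and> w ! i = idl p) \<or>
      (\<exists>r s. w ! i = arr l r s \<and> (\<forall>k<d. k \<noteq> i \<longrightarrow> tgt (w ! k) \<noteq> (l - 1, s))))"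

lemma arr_simps [simp]: "src (arr l r s) = (l, r)" "tgt (arr l r s) = (l - 1, s)" "odd_letter (arr l r s)"
  "fst (arr l r s) = [l, l - 1]"
  by (simp_all add: arr_def src_def tgt_def odd_letter_def path_length_def)

lemma arr_in_letters: "l \<ge> 1 \<Longrightarrow> arr l r s \<in> letters l n \<longleftrightarrow> r \<in> {1..n} \<and> s \<in> {1..n}"
  by (auto simp: arr_def letters_def zigzag_basis_def basis_z_def basis_c_def basis_1_def)

text \<open>The basis paths ending at \<open>l\<close> are \<open>[l]\<close> and
  \<open>[l - 1, l]\<close>. Followed by the arrow they give the arrow itself and the cycle at
  \<open>l - 1\<close>, both nonzero.\<close>

lemma lmul_arr_right:
  assumes l1: "l \<ge> 1" and "v \<in> letters l n" "tgt v = (l, r)"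
  shows "\<exists>z. lmul l v (arr l r s) = Some z"
proof -
  obtain b r0 where v: "v = (b, r0, r)" using assms(3) by (cases v) (auto simp: tgt_def)
  have "b = [l] \<or> b = [l - 1, l]"
    using assms unfolding v
    by (auto simp: letters_def zigzag_basis_def basis_z_def basis_c_def basis_1_def tgt_def)
  then show ?thesis using l1 v by (auto simp: arr_def lmul_def bmul_def nf_def)
qed

context
  fixes l n d :: nat
  assumes l1: "l \<ge> 1" and dn: "d \<le> n"
begin

lemma generating_words: "generating l n d w \<Longrightarrow> w \<in> words l n d"
  by (simp add: generating_def)

lemma generating_length: "generating l n d w \<Longrightarrow> length w = d"
  by (rule words_length[OF generating_words])

lemma generating_cases:
  assumes "generating l n d w" "i < d"
  obtains p where "fst p < l" "w ! i = idl p"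
    | r s where "w ! i = arr l r s" "\<And>k. k < d \<Longrightarrow> k \<noteq> i \<Longrightarrow> tgt (w ! k) \<noteq> (l - 1, s)"
  using assms unfolding generating_def by blast

text \<open>An arrow is alone at its target, and an identity is determined by its target.\<close>

lemma generating_tgt_eq:
  assumes "generating l n d w" "i < d" "j < d" "tgt (w ! i) = tgt (w ! j)"
  shows "w ! i = w ! j" "odd_letter (w ! i) \<Longrightarrow> i = j"
proof -
  have *: "w ! i = w ! j \<and> (odd_letter (w ! i) \<longrightarrow> i = j)"
    using assms(1,2)
  proof (cases rule: generating_cases)
    case (1 p)
    show ?thesis using assms(1,3)
    proof (cases rule: generating_cases)
      case (2 r s)
      then have "tgt (w ! i) = (l - 1, s)" using assms(4) by simp
      then have "i = j" using 2(2)[of i] assms(2) by blast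
      then show ?thesis by simp
    next
      case (1 q)
      then show ?thesis using \<open>w ! i = idl p\<close> assms(4) by simp
    qed
  next
    case (2 r s)
    have "tgt (w ! j) = (l - 1, s)" unfolding assms(4)[symmetric] 2(1) by simp
    then have "j = i" using 2(2)[of j] assms(3) by blast
    then show ?thesis by simp
  qed
  from * show "w ! i = w ! j" by (rule conjunct1)
  from * show "odd_letter (w ! i) \<Longrightarrow> i = j" by blast
qed

lemma generating_separated:
  assumes w: "generating l n d w"
  shows "separated w"
proof (rule separatedI)
  fix i j assume ij: "i < length w" "j < length w" and eq: "tgt (w ! i) = tgt (w ! j)"
  from ij have "i < d" "j < d" by (simp_all add: generating_length[OF w])
  then show "w ! i = w ! j" using eq by (rule generating_tgt_eq(1)[OF w])
qed

lemma generating_Tri: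
  assumes w: "generating l n d w"
  shows "w \<in> Tri l n d"
  unfolding Tri_def
proof (intro CollectI conjI allI impI generating_words[OF w])
  fix i j assume ij: "i < d" "j < d" "i \<noteq> j \<and> w ! i = w ! j"
  then have "tgt (w ! i) = tgt (w ! j)" by simp
  then show "\<not> odd_letter (w ! i)" using generating_tgt_eq(2)[OF w ij(1,2)] ij(3) by blast
qed

text \<open>All letters are identities or arrows. Consequently \<open>xi_word w\<close> coincides
  with the eta of \<open>w\<close> and lies in \<open>T\<close>.\<close>

lemma generating_cfact:
  assumes w: "generating l n d w"
  shows "cfact l n w = 1"
proof (rule cfact_eq_1)
  fix i j assume i: "i < length w" and c: "w ! i \<in> c_letters l n"
  from i have "i < d" using generating_length[OF w] by simp
  with w show "i = j"
    by (cases rule: generating_cases) (use c in \<open>auto simp: c_letters_iff\<close>)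
qed

lemma generating_tgt:
  assumes w: "generating l n d w" and i: "i < d"
  shows "fst (tgt (w ! i)) < l"
  using assms by (cases rule: generating_cases) (use l1 in auto)

lemma generating_odd:
  assumes w: "generating l n d w" and i: "i < d"
  shows "odd_letter (w ! i) \<longleftrightarrow> fst (src (w ! i)) = l"
  using assms by (cases rule: generating_cases) auto

lemma generating_src:
  assumes w: "generating l n d w" and i: "i < d"
  shows "fst (src (w ! i)) \<noteq> l \<Longrightarrow> w ! i = idl (src (w ! i))"
    and "fst (src (w ! i)) = l \<Longrightarrow> \<exists>s. w ! i = arr l (snd (src (w ! i))) s"
  using assms by (cases rule: generating_cases; auto)+

lemma generating_permute:
  assumes w: "generating l n d w" and \<sigma>: "\<sigma> permutes {..<d}"
  shows "generating l n d (permute_list \<sigma> w)"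
  unfolding generating_def
proof (intro conjI allI impI)
  show "permute_list \<sigma> w \<in> words l n d" by (rule permute_list_words[OF generating_words[OF w] \<sigma>])
  have ran: "\<sigma> i < d" if "i < d" for i using permutes_in_image[OF \<sigma>, of i] that by simp
  have inj: "\<sigma> i \<noteq> \<sigma> j" if "i \<noteq> j" for i j using permutes_inj[OF \<sigma>] that by (auto dest: injD)
  have nth: "permute_list \<sigma> w ! i = w ! \<sigma> i" if "i < d" for i
    using that \<sigma> generating_length[OF w] by (simp add: permute_list_nth)
  fix i assume i: "i < d"
  from w ran[OF i] show "(\<exists>p. fst p < l \<and> permute_list \<sigma> w ! i = idl p) \<or>
      (\<exists>r s. permute_list \<sigma> w ! i = arr l r s \<and>
        (\<forall>k<d. k \<noteq> i \<longrightarrow> tgt (permute_list \<sigma> w ! k) \<noteq> (l - 1, s)))"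
  proof (cases rule: generating_cases)
    case (1 p)
    then show ?thesis using nth[OF i] by auto
  next
    case (2 r s)
    then have "\<forall>k<d. k \<noteq> i \<longrightarrow> tgt (permute_list \<sigma> w ! k) \<noteq> (l - 1, s)"
      using ran inj by (auto simp: nth)
    then show ?thesis using 2(1) nth[OF i] by auto
  qed
qed

text \<open>Neither an identity nor, by \<open>lmul_arr_right\<close>, an arrow out of
  \<open>l\<close> annihilates a letter that ends at its source. Hence every coefficient of an
  element of \<open>T\<close> is visible in its product with some generator.\<close>

lemma generating_wmul:
  assumes w: "generating l n d w" and v: "v \<in> words l n d" "map tgt v = map src w"
  shows "\<exists>z. wmul l v w = Some z"
proof (rule wmul_exists)
  have len: "length w = d" "length v = d" using w v by (simp_all add: generating_length words_length)
  then show "length v = length w" by simp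
  fix i assume "i < length w"
  then have i: "i < d" using len by simp
  have t: "tgt (v ! i) = src (w ! i)" using v(2) i len by (metis nth_map)
  from w i show "\<exists>z. lmul l (v ! i) (w ! i) = Some z"
  proof (cases rule: generating_cases)
    case (1 p)
    then show ?thesis using lmul_idl_right[OF words_nth[OF v(1) i], of p] t by auto
  next
    case (2 r s)
    then show ?thesis using lmul_arr_right[OF l1 words_nth[OF v(1) i], of r s] t by auto
  qed
qed

text \<open>The bound \<open>d \<le> n\<close> guarantees that there are enough unoccupied places.\<close>

lemma generating_exists:
  assumes p: "length p = d" "\<And>i. i < d \<Longrightarrow> fst (p ! i) \<le> l \<and> snd (p ! i) \<in> {1..n}"
  shows "\<exists>w. generating l n d w \<and> map src w = p"
proof -
  let ?L = "{i. i < d \<and> fst (p ! i) = l}"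
  \<comment> \<open>The indices of all strands away from \<open>l\<close> are avoided, not only of
    those at \<open>l - 1\<close>. As \<open>?L\<close> and the remaining positions together number
    \<open>d\<close>, which is at most \<open>n\<close>, the complement of \<open>?R\<close> still
    has room for an injection of \<open>?L\<close>.\<close>
  let ?R = "(\<lambda>i. snd (p ! i)) ` {i. i < d \<and> fst (p ! i) \<noteq> l}"
  have "card ?R \<le> card {i. i < d \<and> fst (p ! i) \<noteq> l}" by (rule card_image_le) simp
  moreover have "card ?L + card {i. i < d \<and> fst (p ! i) \<noteq> l} = d"
  proof -
    have "{..<d} = ?L \<union> {i. i < d \<and> fst (p ! i) \<noteq> l}" by auto
    then have "d = card (?L \<union> {i. i < d \<and> fst (p ! i) \<noteq> l})" by (metis card_lessThan)
    also have "\<dots> = card ?L + card {i. i < d \<and> fst (p ! i) \<noteq> l}" by (rule card_Un_disjoint) auto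
    finally show ?thesis ..
  qed
  moreover have "card ({1..n} - ?R) \<ge> n - card ?R" using diff_card_le_card_Diff[of ?R "{1..n}"] by simp
  ultimately have "card ?L \<le> card ({1..n} - ?R)" using dn by linarith
  then obtain s where s: "s ` ?L \<subseteq> {1..n} - ?R" "inj_on s ?L"
    using card_le_inj[of ?L "{1..n} - ?R"] by auto
  define w where "w = map (\<lambda>i. if fst (p ! i) = l then arr l (snd (p ! i)) (s i) else idl (p ! i)) [0..<d]"
  have nth: "w ! i = (if fst (p ! i) = l then arr l (snd (p ! i)) (s i) else idl (p ! i))" if "i < d" for i
    using that by (simp add: w_def)
  have len: "length w = d" by (simp add: w_def)
  have sr: "s i \<in> {1..n}" if "i < d" "fst (p ! i) = l" for i using s that by blast
  have "w \<in> words l n d"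
  proof (rule wordsI[OF len])
    fix i assume i: "i < d"
    show "w ! i \<in> letters l n"
      using p(2)[OF i] sr[OF i] by (simp add: nth[OF i] arr_in_letters[OF l1] idl_in_letters)
  qed
  moreover have "(\<exists>p. fst p < l \<and> w ! i = idl p) \<or>
      (\<exists>r s. w ! i = arr l r s \<and> (\<forall>k<d. k \<noteq> i \<longrightarrow> tgt (w ! k) \<noteq> (l - 1, s)))" if i: "i < d" for i
  proof (cases "fst (p ! i) = l")
    case True
    have "tgt (w ! k) \<noteq> (l - 1, s i)" if k: "k < d" "k \<noteq> i" for k
    proof (cases "fst (p ! k) = l")
      case kl: True
      then have "s k \<noteq> s i" using inj_onD[OF s(2), of k i] True i k by auto
      then show ?thesis using kl nth[OF k(1)] by simp
    next
      case False
      then have "snd (p ! k) \<in> ?R" using k by auto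
      moreover have "s i \<notin> ?R" using s(1) True i by auto
      ultimately have "snd (p ! k) \<noteq> s i" by metis
      then show ?thesis using False nth[OF k(1)] by auto
    qed
    then show ?thesis using True nth[OF i] by auto
  next
    case False
    then have "fst (p ! i) < l" using p(2)[OF i] by auto
    then show ?thesis using False nth[OF i] by auto
  qed
  moreover have "map src w = p"
  proof (rule nth_equalityI)
    show "length (map src w) = length p" using len p(1) by simp
    fix i assume "i < length (map src w)"
    then have i: "i < d" using len by simp
    show "map src w ! i = p ! i"
    proof (cases "fst (p ! i) = l")
      case True
      then show ?thesis using i len nth[OF i] by (cases "p ! i") simp
    next
      case False
      then show ?thesis using i len nth[OF i] by simp
    qed
  qed
  ultimately show ?thesis unfolding generating_def by blast
qed

end


section \<open>Endomorphisms of T f\<close>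


text \<open>Descriptions by support: \<open>left_ideal_T\<close> identifies \<open>Tf\<close> with
  the left ideal of the idempotent, and \<open>fTf_corner\<close> places \<open>fTf\<close> inside
  its corner.\<close>

definition Tf :: "nat \<Rightarrow> nat \<Rightarrow> nat \<Rightarrow> (tensor_word \<Rightarrow>\<^sub>0 'k::comm_ring_1) set"
  where "Tf l n d = {x \<in> Tset l n d. \<forall>w. lookup x w \<noteq> 0 \<longrightarrow> (\<forall>i<d. fst (tgt (w ! i)) < l)}"

definition fTf :: "nat \<Rightarrow> nat \<Rightarrow> nat \<Rightarrow> (tensor_word \<Rightarrow>\<^sub>0 'k::comm_ring_1) set"
  where "fTf l n d = {x \<in> Tf l n d. \<forall>w. lookup x w \<noteq> 0 \<longrightarrow> (\<forall>i<d. fst (src (w ! i)) < l)}"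

lemma all_nth_mset_cong:
  assumes "mset v = mset w" "length w = d" "\<forall>i<d. P (w ! i)"
  shows "\<forall>i<d. P (v ! i)"
proof -
  have "length v = d" using assms(1,2) by (metis mset_eq_length)
  moreover have "\<forall>x\<in>set w. P x" using assms(2,3) by (auto simp: in_set_conv_nth)
  then have "\<forall>x\<in>set v. P x" using assms(1) by (metis mset_eq_setD)
  ultimately show ?thesis by simp
qed

lemma eta_word_support:
  "w \<in> Tri l n d \<Longrightarrow> lookup (eta_word l n w) v \<noteq> (0::'k::comm_ring_1) \<Longrightarrow> mset v = mset w"
  using xi_word_support[of w l n d v, where 'k = 'k]
  by (cases "lookup (xi_word w) v = (0::'k)") (auto simp: eta_word_eq)

lemma eta_word_Tf:
  assumes w: "w \<in> Tri l n d" and t: "\<forall>i<d. fst (tgt (w ! i)) < l"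
  shows "(eta_word l n w :: _ \<Rightarrow>\<^sub>0 'k::comm_ring_1) \<in> Tf l n d"
  unfolding Tf_def using eta_word_Tset[OF w] all_nth_mset_cong[OF eta_word_support[OF w] Tri_length[OF w] t]
  by blast

lemma eta_word_fTf:
  assumes w: "w \<in> Tri l n d" and t: "\<forall>i<d. fst (tgt (w ! i)) < l" and s: "\<forall>i<d. fst (src (w ! i)) < l"
  shows "(eta_word l n w :: _ \<Rightarrow>\<^sub>0 'k::comm_ring_1) \<in> fTf l n d"
  unfolding fTf_def using eta_word_Tf[OF w t] all_nth_mset_cong[OF eta_word_support[OF w] Tri_length[OF w] s]
  by blast

lemma xi_word_eq_eta: "cfact l n w = 1 \<Longrightarrow> xi_word w = eta_word l n w"
  by (simp add: eta_word_eq)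

text \<open>The words by which generators are multiplied on the right. The conditions on endpoints
  and \<open>cfact\<close> put \<open>xi_word \<kappa>\<close> into the corner, and separation lets
  \<open>tmul_xi_word\<close> read off coefficients.\<close>

definition connecting :: "nat \<Rightarrow> nat \<Rightarrow> nat \<Rightarrow> tensor_word \<Rightarrow> bool"
  where "connecting l n d \<kappa> \<longleftrightarrow> \<kappa> \<in> Tri l n d \<and> separated \<kappa> \<and> cfact l n \<kappa> = 1 \<and>
    (\<forall>i<d. fst (tgt (\<kappa> ! i)) < l) \<and> (\<forall>i<d. fst (src (\<kappa> ! i)) < l)"

lemma connecting_xi_fTf:
  "connecting l n d \<kappa> \<Longrightarrow> (xi_word \<kappa> :: _ \<Rightarrow>\<^sub>0 'k::comm_ring_1) \<in> fTf l n d"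
  using eta_word_fTf[of \<kappa> l n d, where 'k = 'k] xi_word_eq_eta[of l n \<kappa>, where 'a = 'k]
  by (simp add: connecting_def)

text \<open>Among words with the targets of \<kappa> in order, both sides live only at
  \<open>w1\<close>, because all three words are separated; \<open>supersym_eqI\<close> does the
  rest.\<close>

lemma tmul_xi_xi:
  assumes l1: "l \<ge> 1" and u0: "u0 \<in> Tri l n d" "separated u0" and \<kappa>: "\<kappa> \<in> Tri l n d" "separated \<kappa>"
    and w1: "w1 \<in> Tri l n d" "separated w1" and mul: "wmul l u0 \<kappa> = Some w1"
  shows "tmul l n (xi_word u0) (xi_word \<kappa>) = scale (eps u0 \<kappa>) (xi_word w1 :: _ \<Rightarrow>\<^sub>0 'k::comm_ring_1)"
proof (rule supersym_eqI)
  note k0 = keys_xi_word[OF u0(1), where 'k = 'k]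
  note D = wmul_SomeD[OF mul Tri_words[OF u0(1)] Tri_words[OF \<kappa>(1)]]
  show "tmul l n (xi_word u0) (xi_word \<kappa>) \<in> (supersym l n d :: (_ \<Rightarrow>\<^sub>0 'k) set)"
    by (intro supersym_tmul[OF l1] xi_word_supersym u0 \<kappa>)
  show "scale (eps u0 \<kappa>) (xi_word w1) \<in> (supersym l n d :: (_ \<Rightarrow>\<^sub>0 'k) set)"
    by (intro supersym_scale xi_word_supersym w1)
  show "mset (map tgt w) = mset (map tgt \<kappa>)" if "lookup (tmul l n (xi_word u0) (xi_word \<kappa>)) w \<noteq> (0::'k)" for w
    by (rule tmul_xi_word_support[OF l1 k0 \<kappa>(1) that])
  show "mset (map tgt w) = mset (map tgt \<kappa>)" if "lookup (scale (eps u0 \<kappa>) (xi_word w1)) w \<noteq> (0::'k)" for w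
  proof -
    have "lookup (xi_word w1) w \<noteq> (0::'k)" using that by auto
    then have "mset w = mset w1" by (rule xi_word_support[OF w1(1)])
    then show ?thesis using D(3) by (simp only: mset_map flip: D(3))
  qed
  fix w assume w: "w \<in> words l n d" and t: "map tgt w = map tgt \<kappa>"
  note R = tmul_xi_word[OF l1 k0 \<kappa> t]
  show "lookup (tmul l n (xi_word u0) (xi_word \<kappa>)) w = (lookup (scale (eps u0 \<kappa>) (xi_word w1)) w :: 'k)"
  proof (cases "w = w1")
    case True
    have "lookup (tmul l n (xi_word u0) (xi_word \<kappa>)) w = (eps u0 \<kappa> * lookup (xi_word u0) u0 :: 'k)"
      using mul True by (intro R(1) Tri_words[OF u0(1)]) simp
    then show ?thesis using True by (simp add: lookup_xi_word_self[OF u0(1)] lookup_xi_word_self[OF w1(1)])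
  next
    case False
    have "lookup (xi_word w1) w = (0::'k)"
    proof (rule ccontr)
      assume "lookup (xi_word w1) w \<noteq> (0::'k)"
      from separated_eqI[OF w1(2) xi_word_support[OF w1(1) this]] False t D(3) show False by simp
    qed
    moreover have "lookup (tmul l n (xi_word u0) (xi_word \<kappa>)) w = (0::'k)"
    proof (cases "\<exists>u. u \<in> words l n d \<and> wmul l u \<kappa> = Some w")
      case True
      then obtain u where u: "u \<in> words l n d" "wmul l u \<kappa> = Some w" by blast
      have "lookup (xi_word u0) u = (0::'k)"
      proof (rule ccontr)
        assume "lookup (xi_word u0) u \<noteq> (0::'k)"
        moreover have "map tgt u = map tgt u0"
          using wmul_SomeD(4)[OF u(2,1) Tri_words[OF \<kappa>(1)]] D(4) by simp
        ultimately have "u = u0" using separated_eqI[OF u0(2) xi_word_support[OF u0(1)]] by blast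
        then show False using u(2) mul False by simp
      qed
      then show ?thesis using R(1)[OF u] by simp
    next
      case False
      then show ?thesis using R(2) by blast
    qed
    ultimately show ?thesis by simp
  qed
qed


text \<open>The properties of an endomorphism from which its preimage is built. Compatibility with
  scalars is derived where the locale is interpreted, from linearity over the corner.\<close>

locale corner_linear =
  fixes l n d :: nat and \<phi> :: "(tensor_word \<Rightarrow>\<^sub>0 'k::{idom, ring_char_0}) \<Rightarrow> (tensor_word \<Rightarrow>\<^sub>0 'k)"
  assumes l1: "l \<ge> 1" and dn: "d \<le> n"
    and \<phi>_Tset: "\<And>x. x \<in> Tf l n d \<Longrightarrow> \<phi> x \<in> Tset l n d"
    and \<phi>_add: "\<And>x y. x \<in> Tf l n d \<Longrightarrow> y \<in> Tf l n d \<Longrightarrow> \<phi> (x + y) = \<phi> x + \<phi> y"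
    and \<phi>_scale: "\<And>c x. x \<in> Tf l n d \<Longrightarrow> \<phi> (scale c x) = scale c (\<phi> x)"
    and \<phi>_tmul: "\<And>x y. x \<in> Tf l n d \<Longrightarrow> y \<in> fTf l n d \<Longrightarrow> \<phi> (tmul l n x y) = tmul l n (\<phi> x) y"
begin

section \<open>Images of the generators under an endomorphism\<close>

lemmas gen_words = generating_words[OF l1 dn]
lemmas gen_length = generating_length[OF l1 dn]
lemmas gen_cases = generating_cases[OF l1 dn, consumes 2, case_names 1 2]
lemmas gen_Tri = generating_Tri[OF l1 dn]
lemmas gen_separated = generating_separated[OF l1 dn]

abbreviation Y where "Y w \<equiv> \<phi> (xi_word w)"

lemma xi_Tf: "generating l n d w \<Longrightarrow> xi_word w \<in> Tf l n d"
  using eta_word_Tf[OF gen_Tri] generating_tgt[OF l1 dn] xi_word_eq_eta generating_cfact[OF l1 dn] by metis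

lemma Y_Tset: "generating l n d w \<Longrightarrow> Y w \<in> Tset l n d"
  by (intro \<phi>_Tset xi_Tf)

lemma Y_keys: "generating l n d w \<Longrightarrow> keys (Y w) \<subseteq> words l n d"
  by (rule Tset_keys[OF Y_Tset])

lemma \<phi>_zero: "\<phi> 0 = 0"
proof -
  have "(0 :: _ \<Rightarrow>\<^sub>0 'k) \<in> Tf l n d" by (simp add: Tf_def Tset_zero)
  from \<phi>_scale[OF this, of 0] show ?thesis by simp
qed

text \<open>The relation between the two generators given by \<open>tmul_xi_xi\<close> passes to
  their images; evenness of \<kappa> makes its sign trivial.\<close>

lemma Y_connecting:
  assumes w0: "generating l n d w0" and w1: "generating l n d w1" and \<kappa>: "connecting l n d \<kappa>"
    and mul: "wmul l w0 \<kappa> = Some w1" and even: "\<And>i. i < d \<Longrightarrow> \<not> odd_letter (\<kappa> ! i)"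
  shows "Y w1 = tmul l n (Y w0) (xi_word \<kappa>)"
proof -
  have "eps w0 \<kappa> = (1::'k)" using even gen_length[OF w0] by (intro eps_even_right) auto
  then have "xi_word w1 = tmul l n (xi_word w0) (xi_word \<kappa> :: _ \<Rightarrow>\<^sub>0 'k)"
    using tmul_xi_xi[OF l1 gen_Tri[OF w0] gen_separated[OF w0] _ _ gen_Tri[OF w1] gen_separated[OF w1] mul, where 'k = 'k] \<kappa>
    by (simp add: connecting_def)
  then show ?thesis using \<phi>_tmul[OF xi_Tf[OF w0] connecting_xi_fTf[OF \<kappa>]] by simp
qed

lemma identity_connecting:
  assumes w: "generating l n d w"
  shows "connecting l n d (map (\<lambda>x. idl (tgt x)) w)" (is "connecting l n d ?\<iota>")
    and "wmul l w (map (\<lambda>x. idl (tgt x)) w) = Some w"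
proof -
  have nth: "?\<iota> ! i = idl (tgt (w ! i))" if "i < d" for i using that gen_length[OF w] by simp
  have W: "?\<iota> \<in> words l n d"
    using gen_length[OF w] tgt_letter[OF words_nth[OF gen_words[OF w]]]
    by (intro wordsI) (simp_all add: idl_in_letters)
  have "?\<iota> \<in> Tri l n d" using W by (simp add: Tri_def nth)
  moreover have "separated ?\<iota>" by (auto simp: separated_def)
  moreover have "cfact l n ?\<iota> = 1" by (rule cfact_eq_1) (auto simp: c_letters_iff)
  ultimately show "connecting l n d ?\<iota>"
    unfolding connecting_def using generating_tgt[OF l1 dn w] by (simp add: nth)
  show "wmul l w ?\<iota> = Some w"
    using words_nth[OF gen_words[OF w]] gen_length[OF w] by (auto simp: wmul_iff intro: lmul_idl_right)
qed

text \<open>A generator is fixed by right multiplication with the symmetrised word of identities at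
  its targets. Its image is fixed too, and this confines the support.\<close>

lemma Y_support:
  assumes w: "generating l n d w" and ne: "lookup (Y w) v \<noteq> 0"
  shows "mset (map tgt v) = mset (map tgt w)"
proof -
  let ?\<iota> = "map (\<lambda>x. idl (tgt x)) w"
  note \<iota> = identity_connecting[OF w]
  have "Y w = tmul l n (Y w) (xi_word ?\<iota>)"
    using gen_length[OF w] by (intro Y_connecting[OF w w \<iota>]) simp
  then have "mset (map tgt v) = mset (map tgt ?\<iota>)"
    using tmul_xi_word_support[OF l1 Y_keys[OF w], of ?\<iota> v] \<iota>(1) ne by (simp add: connecting_def)
  then show ?thesis by (simp add: comp_def)
qed

text \<open>The element \<open>xi_word \<kappa>\<close> kills \<open>xi_word w0\<close> and
  therefore \<open>Y w0\<close>. The coefficient of the vanishing product at \<open>z\<close> is, up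
  to sign, that of \<open>Y w0\<close> at \<open>w\<close>.\<close>

lemma Y_annihilate:
  assumes w0: "generating l n d w0" and \<kappa>: "connecting l n d \<kappa>" "map src \<kappa> = map tgt w0"
    and none: "wmul l w0 \<kappa> = None" and w: "w \<in> words l n d" "wmul l w \<kappa> = Some z"
  shows "lookup (Y w0) w = 0"
proof -
  have \<kappa>': "\<kappa> \<in> Tri l n d" "separated \<kappa>" using \<kappa>(1) by (simp_all add: connecting_def)
  note k0 = keys_xi_word[OF gen_Tri[OF w0], where 'k = 'k]
  have "tmul l n (xi_word w0) (xi_word \<kappa>) = (0 :: _ \<Rightarrow>\<^sub>0 'k)"
  proof (rule supersym_eqI[OF _ supersym_zero])
    show "tmul l n (xi_word w0) (xi_word \<kappa>) \<in> (supersym l n d :: (_ \<Rightarrow>\<^sub>0 'k) set)"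
      by (intro supersym_tmul[OF l1] xi_word_supersym gen_Tri[OF w0] \<kappa>')
    show "mset (map tgt w) = mset (map tgt \<kappa>)" if "lookup (tmul l n (xi_word w0) (xi_word \<kappa>)) w \<noteq> (0::'k)" for w
      by (rule tmul_xi_word_support[OF l1 k0 \<kappa>'(1) that])
    fix v assume t: "map tgt v = map tgt \<kappa>"
    note R = tmul_xi_word[OF l1 k0 \<kappa>' t]
    show "lookup (tmul l n (xi_word w0) (xi_word \<kappa>)) v = (lookup 0 v :: 'k)"
    proof (cases "\<exists>u. u \<in> words l n d \<and> wmul l u \<kappa> = Some v")
      case True
      then obtain u where u: "u \<in> words l n d" "wmul l u \<kappa> = Some v" by blast
      have "map tgt u = map tgt w0"
        using wmul_SomeD(4)[OF u(2,1) Tri_words[OF \<kappa>'(1)]] \<kappa>(2) by simp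
      then have "lookup (xi_word w0) u = (0::'k)"
        using separated_eqI[OF gen_separated[OF w0] xi_word_support[OF gen_Tri[OF w0]], of u] u(2) none
        by fastforce
      then show ?thesis using R(1)[OF u] by simp
    next
      case False
      then show ?thesis using R(2) by auto
    qed
  qed simp
  then have "tmul l n (Y w0) (xi_word \<kappa>) = 0"
    using \<phi>_tmul[OF xi_Tf[OF w0] connecting_xi_fTf[OF \<kappa>(1)]] \<phi>_zero by simp
  moreover have "map tgt z = map tgt \<kappa>" by (rule wmul_SomeD(3)[OF w(2,1) Tri_words[OF \<kappa>'(1)]])
  ultimately have "eps w \<kappa> * lookup (Y w0) w = 0"
    using tmul_xi_word(1)[OF l1 Y_keys[OF w0] \<kappa>' _ w] by simp
  then have "eps w \<kappa> * eps w \<kappa> * lookup (Y w0) w = 0" by (simp only: mult.assoc mult_zero_right)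
  then show ?thesis by simp
qed

text \<open>All strands but \<open>i\<close> carry identities, so that multiplication by this word
  tests strand \<open>i\<close> alone. The target of \<open>k\<close> must be free on the other
  strands to keep the word separated.\<close>

lemma replaced_connecting:
  assumes w0: "generating l n d w0" and i: "i < d" and k: "k \<in> letters l n" "src k = tgt (w0 ! i)"
      "fst (tgt k) < l" and fresh: "\<And>j. j < d \<Longrightarrow> j \<noteq> i \<Longrightarrow> tgt (w0 ! j) \<noteq> tgt k"
  defines "\<kappa> \<equiv> (map (\<lambda>x. idl (tgt x)) w0)[i := k]"
  shows "connecting l n d \<kappa>" "map src \<kappa> = map tgt w0"
proof -
  have len: "length w0 = d" by (rule gen_length[OF w0])
  have nth: "\<kappa> ! j = (if j = i then k else idl (tgt (w0 ! j)))" if "j < d" for j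
    using that len by (simp add: \<kappa>_def nth_list_update)
  have l\<kappa>: "length \<kappa> = d" using len by (simp add: \<kappa>_def)
  have W: "\<kappa> \<in> words l n d"
    using k(1) tgt_letter[OF words_nth[OF gen_words[OF w0]]]
    by (intro wordsI l\<kappa>) (simp add: nth idl_in_letters)
  have eq: "ja = jb" if "ja < d" "jb < d" "\<kappa> ! ja = \<kappa> ! jb" "odd_letter (\<kappa> ! ja) \<or> \<kappa> ! ja \<in> c_letters l n" for ja jb
    using that by (auto simp: nth c_letters_iff split: if_splits)
  have "\<kappa> \<in> Tri l n d" unfolding Tri_def using W eq by blast
  moreover have "separated \<kappa>"
  proof (rule separatedI)
    fix a b assume ab: "a < length \<kappa>" "b < length \<kappa>" "tgt (\<kappa> ! a) = tgt (\<kappa> ! b)"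
    then show "\<kappa> ! a = \<kappa> ! b" using fresh[of a] fresh[of b] l\<kappa> by (auto simp: nth split: if_splits)
  qed
  moreover have "cfact l n \<kappa> = 1" using eq l\<kappa> by (intro cfact_eq_1) auto
  moreover have "\<forall>j<d. fst (tgt (\<kappa> ! j)) < l" "\<forall>j<d. fst (src (\<kappa> ! j)) < l"
    using k generating_tgt[OF l1 dn w0] i by (auto simp: nth)
  ultimately show "connecting l n d \<kappa>" by (simp add: connecting_def)
  show "map src \<kappa> = map tgt w0" using len l\<kappa> k by (auto intro!: nth_equalityI simp: nth)
qed

lemma Y_replaced:
  assumes w0: "generating l n d w0" and w: "w \<in> words l n d" "map tgt w = map tgt w0" and i: "i < d"
    and k: "k \<in> letters l n" "src k = tgt (w0 ! i)" "fst (tgt k) < l"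
    and fresh: "\<And>j. j < d \<Longrightarrow> j \<noteq> i \<Longrightarrow> tgt (w0 ! j) \<noteq> tgt k"
    and none: "lmul l (w0 ! i) k = None" and some: "lmul l (w ! i) k \<noteq> None"
  shows "lookup (Y w0) w = 0"
proof -
  let ?\<kappa> = "(map (\<lambda>x. idl (tgt x)) w0)[i := k]"
  have len: "length w0 = d" "length w = d" using gen_length[OF w0] words_length[OF w(1)] by auto
  note \<kappa> = replaced_connecting[OF w0 i k fresh]
  have t: "tgt (w ! j) = tgt (w0 ! j)" if "j < d" for j using w(2) that len by (metis nth_map)
  have "wmul l w0 ?\<kappa> = None"
  proof (rule ccontr)
    assume "wmul l w0 ?\<kappa> \<noteq> None"
    then obtain z where z: "wmul l w0 ?\<kappa> = Some z" by blast
    then have "length z = d" using len by (simp add: wmul_iff)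
    with z i have "lmul l (w0 ! i) (?\<kappa> ! i) = Some (z ! i)" by (simp only: wmul_iff)
    then show False using none i len by simp
  qed
  moreover have "\<exists>z. wmul l w ?\<kappa> = Some z"
  proof (rule wmul_exists)
    fix j assume "j < length ?\<kappa>"
    then have j: "j < d" using len by simp
    show "\<exists>z. lmul l (w ! j) (?\<kappa> ! j) = Some z"
      using some j i len t[OF j] lmul_idl_right[OF words_nth[OF w(1) j]] by (cases "j = i") auto
  qed (use len in simp)
  ultimately show ?thesis using Y_annihilate[OF w0 \<kappa>] w(1) by blast
qed

text \<open>
  A word with the targets of \<open>w0\<close> that is not a multiple of \<open>w0\<close> has an offending letter; it
  survives multiplication by a letter that kills the corresponding letter of \<open>w0\<close>.
\<close>

lemma Y_not_multiple:
  assumes w0: "generating l n d w0" and w: "w \<in> words l n d" "map tgt w = map tgt w0"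
    and none: "\<And>v. v \<in> words l n d \<Longrightarrow> wmul l v w0 \<noteq> Some w"
  shows "lookup (Y w0) w = 0"
proof -
  have len: "length w0 = d" "length w = d" using gen_length[OF w0] words_length[OF w(1)] by auto
  have t: "tgt (w ! j) = tgt (w0 ! j)" if "j < d" for j using w(2) that len by (metis nth_map)
  have "\<exists>i<d. \<forall>v\<in>letters l n. lmul l v (w0 ! i) \<noteq> Some (w ! i)"
  proof (rule ccontr)
    assume "\<not> ?thesis"
    then have "\<forall>i<d. \<exists>v\<in>letters l n. lmul l v (w0 ! i) = Some (w ! i)" by blast
    then obtain f where f: "\<And>i. i < d \<Longrightarrow> f i \<in> letters l n \<and> lmul l (f i) (w0 ! i) = Some (w ! i)"
      by metis
    have "map f [0..<d] \<in> words l n d" using f by (intro wordsI) simp_all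
    moreover have "wmul l (map f [0..<d]) w0 = Some w" using f len by (simp add: wmul_iff)
    ultimately show False using none by blast
  qed
  then obtain i where i: "i < d" and no: "\<And>v. v \<in> letters l n \<Longrightarrow> lmul l v (w0 ! i) \<noteq> Some (w ! i)"
    by blast
  have wi: "w ! i \<in> letters l n" using w(1) i by (rule words_nth)
  from w0 i show ?thesis
  proof (cases rule: gen_cases)
    case (1 p)
    then have "lmul l (w ! i) (w0 ! i) = Some (w ! i)"
      using lmul_idl_right[OF wi, of p] t[OF i] by simp
    with no[OF wi] show ?thesis by blast
  next
    case (2 r s)
    have rs: "r \<in> {1..n}" "s \<in> {1..n}"
      using words_nth[OF gen_words[OF w0] i] unfolding 2(1) arr_in_letters[OF l1] by auto
    obtain b r0 where b: "w ! i = (b, r0, s)" "last b = l - 1"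
      using t[OF i] unfolding 2(1) by (cases "w ! i") (auto simp: tgt_def arr_def)
    have bB: "b \<in> zigzag_basis l" and r0: "r0 \<in> {1..n}" using wi b by (auto simp: letters_def)
    \<comment> \<open>All basis paths ending at \<open>l - 1\<close>. The second and third are left
      multiples of the arrow, by \<open>[l]\<close> and by \<open>[l - 1, l]\<close>; the other two
      are the offending ones.\<close>
    have "b = [l - 1] \<or> b = [l, l - 1] \<or> b = [l - 1, l, l - 1] \<or> (l \<ge> 2 \<and> b = [l - 2, l - 1])"
      using bB b(2) l1 by (auto simp: zigzag_basis_def basis_z_def basis_c_def basis_1_def)
    moreover have "b \<noteq> [l, l - 1]"
    proof
      assume "b = [l, l - 1]"
      then have "lmul l ([l], r0, r) (w0 ! i) = Some (w ! i)"
        unfolding 2(1) b(1) by (simp add: arr_def lmul_def bmul_def nf_def)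
      moreover have "([l], r0, r) \<in> letters l n"
        using r0 rs by (auto simp: letters_def zigzag_basis_def basis_z_def)
      ultimately show False using no by blast
    qed
    moreover have "b \<noteq> [l - 1, l, l - 1]"
    proof
      assume "b = [l - 1, l, l - 1]"
      then have "lmul l ([l - 1, l], r0, r) (w0 ! i) = Some (w ! i)"
        unfolding 2(1) b(1) using l1 by (simp add: arr_def lmul_def bmul_def nf_def)
      moreover have "([l - 1, l], r0, r) \<in> letters l n"
        using r0 rs l1 by (auto simp: letters_def zigzag_basis_def basis_1_def intro!: exI[of _ "l - 1"])
      ultimately show False using no by blast
    qed
    ultimately consider "b = [l - 1]" | "l \<ge> 2" "b = [l - 2, l - 1]" by blast
    then show ?thesis
    proof cases
      case 1
      \<comment> \<open>The cycle at \<open>l - 1\<close> kills the arrow from \<open>l\<close>,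
        since the product has three arrows, but not the idempotent at \<open>l - 1\<close>. Its
        target is that of strand \<open>i\<close>, which no other strand shares.\<close>
      let ?k = "([l - 1, l, l - 1], s, s) :: letter"
      have "?k \<in> letters l n"
        using rs l1 by (auto simp: letters_def zigzag_basis_def basis_c_def intro!: exI[of _ "l - 1"])
      moreover have "src ?k = tgt (w0 ! i)" unfolding 2(1) by (simp add: src_def)
      moreover have "tgt ?k = (l - 1, s)" by (simp add: tgt_def)
      moreover have "lmul l (w0 ! i) ?k = None"
        unfolding 2(1) by (simp add: arr_def lmul_def bmul_def nf_def)
      moreover have "lmul l (w ! i) ?k \<noteq> None"
        unfolding b(1) 1 using l1 by (simp add: lmul_def bmul_def nf_def)
      ultimately show ?thesis using 2(2) l1 by (intro Y_replaced[OF w0 w i, of ?k]) auto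
    next
      case B: 2
      \<comment> \<open>The other strands occupy at most \<open>d - 1\<close> indices, fewer than
        \<open>n\<close>.\<close>
      have "\<exists>s'\<in>{1..n}. s' \<notin> (\<lambda>j. snd (tgt (w0 ! j))) ` ({..<d} - {i})"
      proof (rule ccontr)
        assume "\<not> ?thesis"
        then have "{1..n} \<subseteq> (\<lambda>j. snd (tgt (w0 ! j))) ` ({..<d} - {i})" by blast
        then have "card {1..n} \<le> card ((\<lambda>j. snd (tgt (w0 ! j))) ` ({..<d} - {i}))"
          by (intro card_mono) auto
        also have "\<dots> \<le> card ({..<d} - {i})" by (rule card_image_le) simp
        also have "\<dots> < d" using i by simp
        finally show False using dn by simp
      qed
      then obtain s' where s': "s' \<in> {1..n}" "s' \<notin> (\<lambda>j. snd (tgt (w0 ! j))) ` ({..<d} - {i})" by blast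
      \<comment> \<open>The arrow to \<open>l - 2\<close> prolongs the arrow from \<open>l\<close>
        to a path of length two that is not a cycle, hence zero, whereas it closes the arrow from
        \<open>l - 2\<close> to the nonzero cycle at \<open>l - 2\<close>.\<close>
      let ?k = "([l - 1, l - 2], s, s') :: letter"
      have "[l - 1, l - 2] \<in> basis_1 l"
        using B(1) by (auto simp: basis_1_def intro!: exI[of _ "l - 2"])
      then have "?k \<in> letters l n" using rs s' by (auto simp: letters_def zigzag_basis_def)
      moreover have "src ?k = tgt (w0 ! i)" unfolding 2(1) by (simp add: src_def)
      moreover have tk: "tgt ?k = (l - 2, s')" by (simp add: tgt_def)
      moreover have "lmul l (w0 ! i) ?k = None"
        unfolding 2(1) using B(1) by (simp add: arr_def lmul_def bmul_def nf_def)
      moreover have "lmul l (w ! i) ?k \<noteq> None"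
        unfolding b(1) B(2) using B(1) by (simp add: lmul_def bmul_def nf_def)
      moreover have "tgt (w0 ! j) \<noteq> tgt ?k" if "j < d" "j \<noteq> i" for j
      proof
        assume "tgt (w0 ! j) = tgt ?k"
        then have "s' = snd (tgt (w0 ! j))" using tk by simp
        then show False using s'(2) that by blast
      qed
      ultimately show ?thesis using B(1) by (intro Y_replaced[OF w0 w i, of ?k]) auto
    qed
  qed
qed

text \<open>Generating words with the same sources differ only in the places chosen at
  \<open>l - 1\<close>. The letters \<open>k i\<close>, which change the index but not the vertex,
  form an even connecting word that carries \<open>w0\<close> to \<open>w1\<close>. So
  \<open>Y w1\<close> is \<open>Y w0\<close> times an element of the corner, and the coefficients
  can be compared.\<close>

lemma Y_independent:
  assumes w0: "generating l n d w0" and w1: "generating l n d w1" and src: "map src w0 = map src w1"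
    and v: "v \<in> words l n d" "wmul l v w0 = Some a" "wmul l v w1 = Some b"
  shows "eps v w0 * lookup (Y w0) a = eps v w1 * lookup (Y w1) b"
proof -
  have len: "length w0 = d" "length w1 = d" "length v = d"
    using gen_length w0 w1 words_length[OF v(1)] by auto
  have W: "w0 \<in> words l n d" "w1 \<in> words l n d" using gen_words w0 w1 by auto
  have s: "src (w0 ! i) = src (w1 ! i)" if "i < d" for i using src that len by (metis nth_map)
  have same: "fst (tgt (w0 ! i)) = fst (tgt (w1 ! i))" if i: "i < d" for i
    using generating_src[OF l1 dn w0 i] generating_src[OF l1 dn w1 i] s[OF i]
    by (metis arr_simps(2) fst_conv idl_simps(2))
  have odd: "odd_letter (w0 ! i) = odd_letter (w1 ! i)" if "i < d" for i
    using generating_odd[OF l1 dn w0 that] generating_odd[OF l1 dn w1 that] s[OF that] by simp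
  define k where "k i = ([fst (tgt (w0 ! i))], snd (tgt (w0 ! i)), snd (tgt (w1 ! i)))" for i
  have sk: "src (k i) = tgt (w0 ! i)" for i by (simp add: k_def src_def)
  have tk: "tgt (k i) = tgt (w1 ! i)" if "i < d" for i
    using same[OF that] by (simp add: k_def tgt_def[of "k i"] prod_eq_iff) (simp add: k_def tgt_def)
  have ek: "\<not> odd_letter (k i)" "k i \<notin> c_letters l n" for i
    by (simp_all add: k_def odd_letter_def path_length_def c_letters_iff)
  let ?\<kappa> = "map k [0..<d]"
  have kL: "k i \<in> letters l n" if i: "i < d" for i
    using tgt_letter[OF words_nth[OF W(1) i]] tgt_letter[OF words_nth[OF W(2) i]]
    by (auto simp: k_def letters_def zigzag_basis_def basis_z_def)
  have mulk: "lmul l (w0 ! i) (k i) = Some (w1 ! i)" if i: "i < d" for i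
  proof (cases "fst (src (w0 ! i)) = l")
    case True
    from generating_src(2)[OF l1 dn w0 i True] obtain s0 where "w0 ! i = arr l (snd (src (w0 ! i))) s0" ..
    moreover from True have "fst (src (w1 ! i)) = l" unfolding s[OF i] .
    from generating_src(2)[OF l1 dn w1 i this] obtain s1 where "w1 ! i = arr l (snd (src (w0 ! i))) s1"
      unfolding s[OF i] ..
    ultimately obtain r s0 s1 where "w0 ! i = arr l r s0" "w1 ! i = arr l r s1" by blast
    then show ?thesis by (simp add: k_def) (simp add: arr_def lmul_def bmul_def nf_def)
  next
    case False
    have "w0 ! i = idl (src (w0 ! i))" by (rule generating_src(1)[OF l1 dn w0 i False])
    moreover have "w1 ! i = idl (src (w0 ! i))"
      using generating_src(1)[OF l1 dn w1 i] False unfolding s[OF i] by blast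
    ultimately obtain p where "w0 ! i = idl p" "w1 ! i = idl p" by blast
    then show ?thesis by (simp add: k_def) (simp add: idl_def lmul_def bmul_def nf_def)
  qed
  \<comment> \<open>Equal targets in \<open>w1\<close> mean equal letters there. If these are
    arrows, the positions agree; if they are identities, the sources agree, and with them the
    letters of \<open>w0\<close>.\<close>
  have keq: "k i = k j" if ij: "i < d" "j < d" "tgt (k i) = tgt (k j)" for i j
  proof -
    have "tgt (w1 ! i) = tgt (w1 ! j)" using tk ij by simp
    from generating_tgt_eq[OF l1 dn w1 ij(1,2) this]
    have *: "w1 ! i = w1 ! j" "odd_letter (w1 ! i) \<Longrightarrow> i = j" by auto
    show ?thesis
    proof (cases "odd_letter (w1 ! i)")
      case False
      then have "fst (src (w1 ! i)) \<noteq> l" "fst (src (w1 ! j)) \<noteq> l"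
        using generating_odd[OF l1 dn w1 ij(1)] * by auto
      then have "w0 ! i = idl (src (w0 ! i))" "w0 ! j = idl (src (w0 ! j))"
        using generating_src(1)[OF l1 dn w0 ij(1)] generating_src(1)[OF l1 dn w0 ij(2)]
        unfolding s[OF ij(1)] s[OF ij(2)] by blast+
      moreover have "src (w0 ! i) = src (w0 ! j)" unfolding s[OF ij(1)] s[OF ij(2)] *(1) ..
      ultimately have "w0 ! i = w0 ! j" by (metis (no_types))
      then show ?thesis using *(1) by (simp add: k_def)
    qed (use *(2) in simp)
  qed
  have "connecting l n d ?\<kappa>"
    unfolding connecting_def
  proof (intro conjI allI impI)
    show "?\<kappa> \<in> Tri l n d"
      unfolding Tri_def using kL ek by (auto intro!: wordsI)
    show "separated ?\<kappa>" using keq by (intro separatedI) simp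
    show "cfact l n ?\<kappa> = 1" using ek by (intro cfact_eq_1) simp
    show "fst (tgt (?\<kappa> ! i)) < l" "fst (src (?\<kappa> ! i)) < l" if "i < d" for i
      using that generating_tgt[OF l1 dn w0 that] generating_tgt[OF l1 dn w1 that] by (simp_all add: tk sk)
  qed
  note \<kappa> = this
  have \<kappa>': "?\<kappa> \<in> Tri l n d" "separated ?\<kappa>" using \<kappa> by (simp_all add: connecting_def)
  have mul: "wmul l w0 ?\<kappa> = Some w1" using mulk len by (simp add: wmul_iff)
  have Y: "Y w1 = tmul l n (Y w0) (xi_word ?\<kappa>)"
    using ek by (intro Y_connecting[OF w0 w1 \<kappa> mul]) simp
  have aW: "a \<in> words l n d" by (rule wmul_SomeD(1)[OF v(2,1) W(1)])
  have ab: "wmul l a ?\<kappa> = Some b"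
    using wmul_assoc[OF v(1) W(1) Tri_words[OF \<kappa>'(1)]] v(2,3) mul by simp
  have "map tgt b = map tgt ?\<kappa>" by (rule wmul_SomeD(3)[OF ab aW Tri_words[OF \<kappa>'(1)]])
  then have "lookup (Y w1) b = eps a ?\<kappa> * lookup (Y w0) a"
    unfolding Y by (rule tmul_xi_word(1)[OF l1 Y_keys[OF w0] \<kappa>' _ aW ab])
  moreover have "eps a ?\<kappa> = (1::'k)"
    using ek words_length[OF aW] by (intro eps_even_right) simp
  moreover have "eps v w0 = (eps v w1 :: 'k)" using odd len by (intro eps_cong) auto
  ultimately show ?thesis by simp
qed

end


lemma wmul_nthD:
  assumes "wmul l u v = Some w" "u \<in> words l n d" "v \<in> words l n d" "i < d"
  shows "src (w ! i) = src (u ! i)" "tgt (w ! i) = tgt (v ! i)" "tgt (u ! i) = src (v ! i)"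
proof -
  note D = wmul_SomeD[OF assms(1-3)]
  have len: "length w = d" "length u = d" "length v = d"
    by (rule words_length[OF D(1)], rule words_length[OF assms(2)], rule words_length[OF assms(3)])
  show "src (w ! i) = src (u ! i)" "tgt (w ! i) = tgt (v ! i)" "tgt (u ! i) = src (v ! i)"
    using arg_cong[OF D(2), of "\<lambda>x. x ! i"] arg_cong[OF D(3), of "\<lambda>x. x ! i"]
      arg_cong[OF D(4), of "\<lambda>x. x ! i"] len assms(4) by simp_all
qed

lemma Tf_add:
  assumes "x \<in> Tf l n d" "y \<in> Tf l n d"
  shows "x + y \<in> Tf l n d"
  unfolding Tf_def
proof (intro CollectI conjI allI impI)
  show "x + y \<in> Tset l n d" using assms by (simp add: Tf_def Tset_add)
  fix w i assume "lookup (x + y) w \<noteq> 0" "i < d"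
  then have "lookup x w \<noteq> 0 \<or> lookup y w \<noteq> 0" by (auto simp: lookup_add)
  then show "fst (tgt (w ! i)) < l" using assms \<open>i < d\<close> unfolding Tf_def by blast
qed

lemma Tf_tmul:
  fixes x y :: "tensor_word \<Rightarrow>\<^sub>0 'k::{idom, ring_char_0}"
  assumes l1: "l \<ge> 1" and x: "x \<in> Tset l n d" and y: "y \<in> Tf l n d"
  shows "tmul l n x y \<in> Tf l n d"
  unfolding Tf_def
proof (intro CollectI conjI allI impI)
  have yT: "y \<in> Tset l n d" using y by (simp add: Tf_def)
  show "tmul l n x y \<in> Tset l n d" by (rule Tset_tmul[OF l1 x yT])
  fix w i assume ne: "lookup (tmul l n x y) w \<noteq> 0" and i: "i < d"
  obtain u v where uv: "u \<in> words l n d" "v \<in> words l n d" "wmul l u v = Some w" "lookup y v \<noteq> 0"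
    by (rule tmul_tgt_support[OF l1 Tset_keys[OF x] Tset_keys[OF yT] ne])
  have len: "length w = d" "length v = d"
    using words_length[OF wmul_SomeD(1)[OF uv(3,1,2)]] words_length[OF uv(2)] by auto
  then have "tgt (w ! i) = tgt (v ! i)" using wmul_SomeD(3)[OF uv(3,1,2)] i by (metis nth_map)
  moreover have "fst (tgt (v ! i)) < l" using y uv(4) i unfolding Tf_def by blast
  ultimately show "fst (tgt (w ! i)) < l" by simp
qed

section \<open>The preimage of an endomorphism\<close>

context corner_linear
begin

definition gen :: "tensor_word \<Rightarrow> tensor_word"
  where "gen v = (SOME w. generating l n d w \<and> map src w = map tgt v)"

lemma gen:
  assumes v: "v \<in> words l n d"
  shows "generating l n d (gen v)" "map src (gen v) = map tgt v"
proof -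
  have "\<exists>w. generating l n d w \<and> map src w = map tgt v"
    using tgt_letter[OF words_nth[OF v]] words_length[OF v] by (intro generating_exists[OF l1 dn]) auto
  from someI_ex[OF this] show "generating l n d (gen v)" "map src (gen v) = map tgt v"
    unfolding gen_def by auto
qed

text \<open>The only possible coefficients: at the product of \<open>v\<close> and
  \<open>gen v\<close>, the image of the generator must have \<open>eps\<close> times the
  coefficient of the preimage at \<open>v\<close>, and \<open>eps\<close> is its own inverse. By
  \<open>generating_wmul\<close> the product exists, so \<open>the\<close> is harmless;
  \<open>lookup_lift\<close> removes the dependence on the choice made by
  \<open>gen\<close>.\<close>

definition lift :: "tensor_word \<Rightarrow>\<^sub>0 'k"
  where "lift = (\<Sum>v\<in>words l n d. single v (eps v (gen v) * lookup (Y (gen v)) (the (wmul l v (gen v)))))"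

lemma lookup_lift_aux:
  "lookup lift v = (if v \<in> words l n d then eps v (gen v) * lookup (Y (gen v)) (the (wmul l v (gen v))) else 0)"
  by (simp add: lift_def lookup_sum lookup_single when_def)

lemma lookup_lift:
  assumes v: "v \<in> words l n d" and w0: "generating l n d w0" "map src w0 = map tgt v" "wmul l v w0 = Some a"
  shows "lookup lift v = eps v w0 * lookup (Y w0) a"
proof -
  obtain b where b: "wmul l v (gen v) = Some b"
    using generating_wmul[OF l1 dn gen(1)[OF v] v] gen(2)[OF v] by auto
  have "map src (gen v) = map src w0" using gen(2)[OF v] w0(2) by simp
  from Y_independent[OF gen(1)[OF v] w0(1) this v b w0(3)] show ?thesis
    using v b by (simp add: lookup_lift_aux)
qed

lemma lift_keys: "keys lift \<subseteq> words l n d"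
  by (auto simp: in_keys_iff lookup_lift_aux split: if_splits)

lemma xi_word_permute:
  assumes w: "w \<in> Tri l n d" and \<sigma>: "\<sigma> permutes {..<d}"
  shows "xi_word w = scale (psign \<sigma> w) (xi_word (permute_list \<sigma> w) :: _ \<Rightarrow>\<^sub>0 'k)"
proof -
  have "xi_word w = scale (lookup (xi_word w) (permute_list \<sigma> w)) (xi_word (permute_list \<sigma> w) :: _ \<Rightarrow>\<^sub>0 'k)"
  proof (rule supersym_single_orbit[OF xi_word_supersym[OF w] Tri_permute[OF w \<sigma>]])
    fix v assume "lookup (xi_word w) v \<noteq> (0::'k)"
    then show "mset v = mset (permute_list \<sigma> w)"
      using xi_word_support[OF w] \<sigma> Tri_length[OF w] by auto
  qed
  then show ?thesis by (simp add: lookup_xi_word(1)[OF w \<sigma>])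
qed

text \<open>Since the choice of generating word is free, the permuted \<open>v\<close> may be tested
  against the permuted generating word. The symmetry of \<open>Y ?w\<close> and
  \<open>eps_permute\<close> then account for all signs.\<close>

lemma lift_supersym: "lift \<in> supersym l n d"
  unfolding supersym_def
proof (intro CollectI conjI allI impI lift_keys)
  fix \<sigma> v assume \<sigma>: "\<sigma> permutes {..<d}" and v: "v \<in> words l n d"
  let ?w = "gen v"
  note w = gen[OF v]
  note \<sigma>w = generating_permute[OF l1 dn w(1) \<sigma>]
  have W: "?w \<in> words l n d" by (rule gen_words[OF w(1)])
  have len: "length v = d" "length ?w = d" using words_length v W by auto
  obtain a where a: "wmul l v ?w = Some a" using generating_wmul[OF l1 dn w(1) v] w(2) by auto
  have aW: "a \<in> words l n d" by (rule wmul_SomeD(1)[OF a v W])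
  have len_a: "length a = d" by (rule words_length[OF aW])
  have "map src (permute_list \<sigma> ?w) = map tgt (permute_list \<sigma> v)"
    using w(2) \<sigma> len by (simp flip: permute_list_map)
  then have 1: "lookup lift (permute_list \<sigma> v)
      = eps (permute_list \<sigma> v) (permute_list \<sigma> ?w) * lookup (Y (permute_list \<sigma> ?w)) (permute_list \<sigma> a)"
    by (intro lookup_lift permute_list_words v \<sigma> \<sigma>w wmul_permute[OF \<sigma> a len(1)])
  have "Y ?w = scale (psign \<sigma> ?w) (Y (permute_list \<sigma> ?w))"
    using xi_word_permute[OF gen_Tri[OF w(1)] \<sigma>] \<phi>_scale[OF xi_Tf[OF \<sigma>w], of "psign \<sigma> ?w"] by simp
  then have "psign \<sigma> ?w * lookup (Y (permute_list \<sigma> ?w)) (permute_list \<sigma> a) = lookup (Y ?w) (permute_list \<sigma> a)"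
    by simp
  also have "\<dots> = psign \<sigma> a * lookup (Y ?w) a"
    by (rule supersymD(2)[OF Tset_supersym[OF Y_Tset[OF w(1)]] \<sigma> aW])
  finally have 2: "psign \<sigma> ?w * lookup (Y (permute_list \<sigma> ?w)) (permute_list \<sigma> a) = psign \<sigma> a * lookup (Y ?w) a" .
  have 3: "psign \<sigma> v * psign \<sigma> ?w * eps (permute_list \<sigma> v) (permute_list \<sigma> ?w) = (eps v ?w * psign \<sigma> a :: 'k)"
    using wmul_odd[OF a v W] by (intro eps_permute[OF \<sigma> len len_a])
  have "psign \<sigma> v * lookup lift (permute_list \<sigma> v)
      = psign \<sigma> v * (psign \<sigma> ?w * psign \<sigma> ?w) * eps (permute_list \<sigma> v) (permute_list \<sigma> ?w) *
        lookup (Y (permute_list \<sigma> ?w)) (permute_list \<sigma> a)"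
    unfolding 1 by (simp add: mult.assoc)
  also have "\<dots> = (psign \<sigma> v * psign \<sigma> ?w * eps (permute_list \<sigma> v) (permute_list \<sigma> ?w)) *
        (psign \<sigma> ?w * lookup (Y (permute_list \<sigma> ?w)) (permute_list \<sigma> a))"
    by (simp only: mult_ac)
  also have "\<dots> = (psign \<sigma> a * psign \<sigma> a) * (eps v ?w * lookup (Y ?w) a)"
    unfolding 2 3 by (simp only: mult_ac)
  also have "\<dots> = lookup lift v" using lookup_lift[OF v w(1,2) a] by simp
  finally have "psign \<sigma> v * (psign \<sigma> v * lookup lift (permute_list \<sigma> v)) = psign \<sigma> v * lookup lift v" by simp
  then show "lookup lift (permute_list \<sigma> v) = psign \<sigma> v * lookup lift v"
    unfolding mult.assoc[symmetric] by simp
qed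

lemma c_letters_tgt: "x \<in> c_letters l n \<Longrightarrow> fst (tgt x) < l"
  by (auto simp: c_letters_def basis_c_def tgt_def)

text \<open>A letter with entry \<open>c\<close> ends below \<open>l\<close>, so the generating word
  meets it with an identity and it reappears in the product \<open>a\<close> at the same position.
  Hence \<open>cfact l n v\<close> divides \<open>cfact l n a\<close>, which divides the coefficient
  of \<open>Y ?w\<close> at \<open>a\<close>.\<close>

lemma lift_Tset: "lift \<in> Tset l n d"
  unfolding Tset_def
proof (intro CollectI conjI ballI lift_supersym)
  fix v assume v: "v \<in> words l n d"
  let ?w = "gen v"
  note w = gen[OF v]
  have W: "?w \<in> words l n d" by (rule gen_words[OF w(1)])
  have len: "length v = d" "length ?w = d" using words_length v W by auto
  obtain a where a: "wmul l v ?w = Some a" using generating_wmul[OF l1 dn w(1) v] w(2) by auto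
  have aW: "a \<in> words l n d" by (rule wmul_SomeD(1)[OF a v W])
  have len_a: "length a = d" by (rule words_length[OF aW])
  have "a ! i = v ! i" if i: "i < d" and c: "v ! i \<in> c_letters l n" for i
  proof -
    have eq: "src (?w ! i) = tgt (v ! i)" using w(2) i len by (metis nth_map)
    then have "?w ! i = idl (tgt (v ! i))"
      using generating_src(1)[OF l1 dn w(1) i] c_letters_tgt[OF c] by simp
    then have "lmul l (v ! i) (?w ! i) = Some (v ! i)"
      using lmul_idl_right[OF words_nth[OF v i]] by simp
    then show ?thesis using a i len_a by (simp add: wmul_iff)
  qed
  then have "count_list v x \<le> count_list a x" if "x \<in> c_letters l n" for x
    unfolding count_list_card using that len len_a by (intro card_mono) auto
  then have "cfact l n v dvd cfact l n a"
    unfolding cfact_eq by (intro prod_dvd_prod fact_dvd)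
  then have "(of_nat (cfact l n v) :: 'k) dvd of_nat (cfact l n a)" by (elim dvdE) simp
  also have "\<dots> dvd lookup (Y ?w) a" using Y_Tset[OF w(1)] aW by (simp add: Tset_def)
  also have "\<dots> dvd lookup lift v" unfolding lookup_lift[OF v w a] by simp
  finally show "of_nat (cfact l n v) dvd lookup lift v" .
qed

text \<open>At left multiples of \<open>w\<close> the coefficients agree by
  \<open>lookup_lift\<close>. At other words with the same targets the left side vanishes for lack
  of a factorization and the right side by \<open>Y_not_multiple\<close>.\<close>

lemma tmul_lift_xi:
  assumes w: "generating l n d w"
  shows "tmul l n lift (xi_word w) = Y w"
proof (rule supersym_eqI)
  show "tmul l n lift (xi_word w) \<in> supersym l n d"
    by (intro supersym_tmul[OF l1] lift_supersym xi_word_supersym gen_Tri w)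
  show "Y w \<in> supersym l n d" by (rule Tset_supersym[OF Y_Tset[OF w]])
  show "mset (map tgt v) = mset (map tgt w)" if "lookup (tmul l n lift (xi_word w)) v \<noteq> 0" for v
    by (rule tmul_xi_word_support[OF l1 lift_keys gen_Tri[OF w] that])
  show "mset (map tgt v) = mset (map tgt w)" if "lookup (Y w) v \<noteq> 0" for v
    by (rule Y_support[OF w that])
  fix v assume v: "v \<in> words l n d" "map tgt v = map tgt w"
  note R = tmul_xi_word[OF l1 lift_keys gen_Tri[OF w] gen_separated[OF w] v(2)]
  show "lookup (tmul l n lift (xi_word w)) v = lookup (Y w) v"
  proof (cases "\<exists>u. u \<in> words l n d \<and> wmul l u w = Some v")
    case True
    then obtain u where u: "u \<in> words l n d" "wmul l u w = Some v" by blast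
    have "map src w = map tgt u" using wmul_SomeD(4)[OF u(2,1) gen_words[OF w]] by simp
    from lookup_lift[OF u(1) w this u(2)] have "lookup (tmul l n lift (xi_word w)) v
        = eps u w * eps u w * lookup (Y w) v" using R(1)[OF u] by (simp only: mult.assoc)
    then show ?thesis by simp
  next
    case False
    then show ?thesis using R(2) Y_not_multiple[OF w v] by auto
  qed
qed

end

text \<open>Each strand of \<open>w\<close> from \<open>l\<close> is an arrow and factors through
  the place that \<open>w0\<close> assigns to it: \<open>v\<close> moves it from there to its final
  index at the vertex \<open>l - 1\<close> and agrees with \<open>w\<close> elsewhere. Letters with
  entry \<open>c\<close> are untouched, so \<open>v\<close> and \<open>w\<close> have the same
  factorials and a factorization of \<open>xi_word w\<close> gives one of its eta.\<close>

lemma eta_word_factor: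
  assumes l1: "l \<ge> 1" and dn: "d \<le> n" and w: "w \<in> Tri l n d" and t: "\<forall>i<d. fst (tgt (w ! i)) < l"
  obtains c w0 y where "generating l n d w0" "y \<in> fTf l n d"
    "(eta_word l n w :: _ \<Rightarrow>\<^sub>0 'k::{idom, ring_char_0}) = scale c (tmul l n (xi_word w0) y)"
proof -
  have W: "w \<in> words l n d" by (rule Tri_words[OF w])
  have len: "length w = d" by (rule words_length[OF W])
  have wL: "w ! i \<in> letters l n" if "i < d" for i using that by (rule words_nth[OF W])
  obtain w0 where w0: "generating l n d w0" "map src w0 = map src w"
    using generating_exists[OF l1 dn, of "map src w"] src_letter[OF wL] len by auto
  have len0: "length w0 = d" by (rule generating_length[OF l1 dn w0(1)])
  note W0 = generating_words[OF l1 dn w0(1)]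
  have s: "src (w0 ! i) = src (w ! i)" if "i < d" for i using w0(2) that len len0 by (metis nth_map)
  have arrow: "w ! i = arr l (snd (src (w ! i))) (snd (tgt (w ! i)))"
    if i: "i < d" and "fst (src (w ! i)) = l" for i
  proof -
    obtain b r s where b: "w ! i = (b, r, s)" by (metis prod_cases3)
    then have "b \<in> zigzag_basis l" "hd b = l" "last b < l"
      using wL[OF i] that t by (auto simp: letters_def src_def tgt_def)
    then have "b = [l, l - 1]"
      by (auto simp: zigzag_basis_def basis_z_def basis_c_def basis_1_def)
    then show ?thesis using b by (simp add: arr_def src_def tgt_def)
  qed
  define v where "v = map (\<lambda>i. if fst (src (w ! i)) = l
      then ([l - 1], snd (tgt (w0 ! i)), snd (tgt (w ! i))) else w ! i) [0..<d]"
  have nth: "v ! i = (if fst (src (w ! i)) = l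
      then ([l - 1], snd (tgt (w0 ! i)), snd (tgt (w ! i))) else w ! i)" if "i < d" for i
    using that by (simp add: v_def)
  have lenv: "length v = d" by (simp add: v_def)
  have arrow0: "\<exists>s. w0 ! i = arr l (snd (src (w ! i))) s" if "i < d" "fst (src (w ! i)) = l" for i
    using generating_src(2)[OF l1 dn w0(1) that(1)] that(2) unfolding s[OF that(1)] by blast
  have id0: "w0 ! i = idl (src (w ! i))" if "i < d" "fst (src (w ! i)) \<noteq> l" for i
    using generating_src(1)[OF l1 dn w0(1) that(1)] that(2) unfolding s[OF that(1)] by blast
  have sv: "src (v ! i) = tgt (w0 ! i)" if i: "i < d" for i
  proof (cases "fst (src (w ! i)) = l")
    case True
    with arrow0[OF i] obtain s0 where "w0 ! i = arr l (snd (src (w ! i))) s0" by blast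
    then have "fst (tgt (w0 ! i)) = l - 1" by (metis arr_simps(2) fst_conv)
    then show ?thesis using True by (simp add: nth[OF i] src_def prod_eq_iff)
  next
    case False
    then show ?thesis using id0[OF i] nth[OF i] by simp
  qed
  have tv: "tgt (v ! i) = tgt (w ! i)" if i: "i < d" for i
  proof (cases "fst (src (w ! i)) = l")
    case True
    have "fst (tgt (w ! i)) = l - 1"
      using arg_cong[OF arrow[OF i True], of "\<lambda>x. fst (tgt x)"] by simp
    moreover have "tgt ([l - 1], a, b) = (l - 1, b)" for a b by (simp add: tgt_def)
    ultimately show ?thesis using True by (simp add: nth[OF i] prod_eq_iff)
  qed (simp add: nth[OF i])
  have vW: "v \<in> words l n d"
  proof (rule wordsI[OF lenv])
    fix i assume i: "i < d"
    show "v ! i \<in> letters l n"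
      using wL[OF i] tgt_letter[OF wL[OF i]] tgt_letter[OF words_nth[OF W0 i]]
      by (auto simp: nth[OF i] letters_def zigzag_basis_def basis_z_def)
  qed
  have mul: "wmul l w0 v = Some w"
    unfolding wmul_iff
  proof (intro conjI allI impI)
    show "length w0 = length w" "length v = length w" using len len0 lenv by simp_all
    fix i assume "i < length w"
    then have i: "i < d" using len by simp
    show "lmul l (w0 ! i) (v ! i) = Some (w ! i)"
    proof (cases "fst (src (w ! i)) = l")
      case True
      with arrow0[OF i] obtain s0 where 0: "w0 ! i = arr l (snd (src (w ! i))) s0" by blast
      have "v ! i = ([l - 1], s0, snd (tgt (w ! i)))"
        using nth[OF i] True 0 by simp
      then have "lmul l (w0 ! i) (v ! i) = Some (arr l (snd (src (w ! i))) (snd (tgt (w ! i))))"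
        unfolding 0 by (simp add: arr_def lmul_def bmul_def nf_def)
      then show ?thesis using arrow[OF i True] by metis
    next
      case False
      then show ?thesis using id0[OF i] nth[OF i] lmul_idl_left[OF wL[OF i]] by simp
    qed
  qed
  have vTri: "v \<in> Tri l n d"
    unfolding Tri_def
  proof (intro CollectI conjI allI impI vW)
    fix i j assume ij: "i < d" "j < d" "i \<noteq> j \<and> v ! i = v ! j"
    show "\<not> odd_letter (v ! i)"
    proof
      assume odd: "odd_letter (v ! i)"
      have *: "fst (src (w ! k)) \<noteq> l" if "k < d" "odd_letter (v ! k)" for k
        using that(2) unfolding nth[OF that(1)] by (auto simp: odd_letter_def path_length_def)
      have "odd_letter (v ! j)" using odd ij(3) by simp
      then have "fst (src (w ! i)) \<noteq> l" "fst (src (w ! j)) \<noteq> l" using * odd ij(1,2) by blast+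
      then have "w ! i = w ! j" "odd_letter (w ! i)" using ij odd nth by auto
      then show False using w ij by (auto simp: Tri_def)
    qed
  qed
  have "count_list v x = count_list w x" if "x \<in> c_letters l n" for x
  proof -
    have "v ! i = x \<longleftrightarrow> w ! i = x" if i: "i < d" for i
    proof (cases "fst (src (w ! i)) = l")
      case True
      have "length (fst (w ! i)) = 2"
        using arg_cong[OF arrow[OF i True], of "\<lambda>x. length (fst x)"] by simp
      then have "w ! i \<noteq> x" "v ! i \<noteq> x"
        using \<open>x \<in> c_letters l n\<close> nth[OF i] True by (auto simp: c_letters_iff)
      then show ?thesis by simp
    qed (simp add: nth[OF i])
    then show ?thesis unfolding count_list_card len lenv by (metis (lifting))
  qed
  then have cf: "cfact l n v = cfact l n w" unfolding cfact_eq by (intro prod.cong) auto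
  note T0 = generating_Tri[OF l1 dn w0(1)] and S0 = generating_separated[OF l1 dn w0(1)]
  let ?z = "tmul l n (xi_word w0) (xi_word v) :: _ \<Rightarrow>\<^sub>0 'k"
  have z: "?z \<in> supersym l n d" by (intro supersym_tmul[OF l1] xi_word_supersym T0 vTri)
  \<comment> \<open>For a word in the support of the product, \<sigma> aligns its left factor with
    \<open>w0\<close>, and \<rho> relates the right factor to \<open>v\<close>. Targets determine
    the letters of \<open>w0\<close>, so \<rho> fixes \<open>w0\<close>, and the permuted
    \<open>w'\<close> is the product of \<open>w0\<close> and \<open>v\<close> permuted by
    \<rho>.\<close>
  have "mset w' = mset w" if ne: "lookup ?z w' \<noteq> 0" for w'
  proof -
    obtain u' v' where uv: "u' \<in> words l n d" "v' \<in> words l n d" "wmul l u' v' = Some w'"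
      "lookup (xi_word w0) u' \<noteq> (0::'k)" "lookup (xi_word v) v' \<noteq> (0::'k)"
      by (rule tmul_tgt_support[OF l1 keys_xi_word[OF T0] keys_xi_word[OF vTri] ne])
    have m: "mset w0 = mset u'" "mset v' = mset v"
      using xi_word_support[OF T0 uv(4)] xi_word_support[OF vTri uv(5)] by auto
    have lu: "length u' = d" "length v' = d" using uv words_length by auto
    obtain \<sigma> where \<sigma>: "\<sigma> permutes {..<length u'}" "w0 = permute_list \<sigma> u'" by (rule mset_eq_permute[OF m(1)])
    then have \<sigma>d: "\<sigma> permutes {..<d}" using lu by simp
    let ?v = "permute_list \<sigma> v'" and ?w = "permute_list \<sigma> w'"
    have mul': "wmul l w0 ?v = Some ?w" using wmul_permute[OF \<sigma>d uv(3) lu(1)] \<sigma>(2) by simp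
    have vW': "?v \<in> words l n d" by (rule permute_list_words[OF uv(2) \<sigma>d])
    have "mset v = mset ?v" using m(2) \<sigma>d lu by simp
    then have "mset ?v = mset v" ..
    then obtain \<rho> where \<rho>: "\<rho> permutes {..<length v}" "?v = permute_list \<rho> v" by (rule mset_eq_permute)
    then have \<rho>d: "\<rho> permutes {..<d}" using lenv by simp
    have ran: "\<rho> i < d" if "i < d" for i using permutes_in_image[OF \<rho>d, of i] that by simp
    have "permute_list \<rho> w0 = w0"
    proof (rule nth_equalityI)
      fix i assume "i < length (permute_list \<rho> w0)"
      then have i: "i < d" using len0 by simp
      have "map src ?v = map tgt w0" using wmul_SomeD(4)[OF mul' W0 vW'] by simp
      then have "src (?v ! i) = tgt (w0 ! i)" using i len0 \<open>?v = _\<close> lenv by (metis length_permute_list nth_map)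
      moreover have "?v ! i = v ! \<rho> i" using \<rho>(2) \<rho>d lenv i by (simp add: permute_list_nth)
      ultimately have "tgt (w0 ! \<rho> i) = tgt (w0 ! i)" using sv[OF ran[OF i]] by simp
      then have "w0 ! \<rho> i = w0 ! i" by (rule generating_tgt_eq(1)[OF l1 dn w0(1) ran[OF i] i])
      then show "permute_list \<rho> w0 ! i = w0 ! i" using \<rho>d len0 i by (simp add: permute_list_nth)
    qed simp
    then have "wmul l w0 ?v = Some (permute_list \<rho> w)"
      using wmul_permute[OF \<rho>d mul len0] \<rho>(2) by simp
    then have "permute_list \<sigma> w' = permute_list \<rho> w" using mul' by simp
    moreover have "length w' = d" using words_length wmul_SomeD(1)[OF uv(3,1,2)] by blast
    ultimately show ?thesis using \<sigma>d \<rho>d len mset_permute_list by metis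
  qed
  then have zw: "?z = scale (lookup ?z w) (xi_word w)" by (rule supersym_single_orbit[OF z w])
  have "lookup ?z w = (\<Sum>p\<in>factorizations l n d w. if p = (w0, v) then eps w0 v else 0)"
    unfolding lookup_tmul[OF l1 keys_xi_word[OF T0] keys_xi_word[OF vTri]]
  proof (rule sum.cong[OF refl])
    fix p assume p: "p \<in> factorizations l n d w"
    then obtain u' v' where uv: "p = (u', v')" "u' \<in> words l n d" "v' \<in> words l n d" "wmul l u' v' = Some w"
      by (auto simp: factorizations_def)
    have "p = (w0, v)" if ne: "lookup (xi_word w0) u' \<noteq> (0::'k)" "lookup (xi_word v) v' \<noteq> (0::'k)"
    proof -
      have m: "set u' = set w0" "set v' = set v"
        by (rule mset_eq_setD[OF xi_word_support[OF T0 ne(1)]])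
          (rule mset_eq_setD[OF xi_word_support[OF vTri ne(2)]])
      have lu: "length u' = d" "length v' = d" using uv words_length by auto
      have su: "src (u' ! i) = src (w ! i)" "tgt (v' ! i) = tgt (w ! i)" "tgt (u' ! i) = src (v' ! i)" if "i < d" for i
        using wmul_nthD[OF uv(4,2,3) that] by simp_all
      \<comment> \<open>The case to exclude is that \<open>u' ! i\<close> is an arrow of
        \<open>w0\<close> from another position \<open>k\<close>. Its target is alone, so it
        continues with strand \<open>k\<close> of \<open>v\<close>, and strands \<open>i\<close> and
        \<open>k\<close> of \<open>w\<close> have the same source and target. They are equal odd
        letters, so \<open>k = i\<close>.\<close>
      have "u' ! i = w0 ! i" if i: "i < d" for i
      proof -
        have "u' ! i \<in> set w0" using nth_mem[of i u'] m(1) i lu(1) by simp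
        then obtain k where k: "k < d" "u' ! i = w0 ! k" using len0 by (auto simp: in_set_conv_nth)
        have "v' ! i \<in> set v" using nth_mem[of i v'] m(2) i lu(2) by simp
        then obtain j where j: "j < d" "v' ! i = v ! j" using lenv by (auto simp: in_set_conv_nth)
        have src_k: "src (w ! k) = src (w ! i)" using su(1)[OF i] k(2) s[OF k(1)] by simp
        show ?thesis
        proof (cases "fst (src (w ! i)) = l")
          case False
          then have "fst (src (w ! k)) \<noteq> l" using src_k by simp
          from id0[OF k(1) this] id0[OF i False] show ?thesis unfolding k(2) src_k by simp
        next
          case True
          then have True_k: "fst (src (w ! k)) = l" using src_k by simp
          have "tgt (w0 ! j) = tgt (w0 ! k)" using su(3)[OF i] j k sv[OF j(1)] by simp
          moreover have "odd_letter (w0 ! k)" using arrow0[OF k(1) True_k] by auto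
          ultimately have "k = j" using generating_tgt_eq(2)[OF l1 dn w0(1) k(1) j(1)] by simp
          then have "tgt (w ! k) = tgt (w ! i)" using su(2)[OF i] j tv[OF j(1)] by simp
          moreover have "length (fst (w ! k)) = length (fst (w ! i))"
            using arg_cong[OF arrow[OF i True], of "\<lambda>x. length (fst x)"]
              arg_cong[OF arrow[OF k(1) True_k], of "\<lambda>x. length (fst x)"] by simp
          ultimately have eq: "w ! k = w ! i" by (intro letter_unique[OF wL[OF k(1)] wL[OF i] src_k])
          have "odd_letter (w ! i)" using arg_cong[OF arrow[OF i True], of odd_letter] by simp
          then have "k = i" using w eq i k(1) unfolding Tri_def by fastforce
          then show ?thesis using k(2) by simp
        qed
      qed
      then have "u' = w0" using uv(2) W0 by (intro word_eqI[of _ l n d])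
      moreover from this have "v' = v" using wmul_left_cancel[OF _ mul uv(3) vW W0] uv(4) by simp
      ultimately show ?thesis using uv(1) by simp
    qed
    then show "(case p of (u, v') \<Rightarrow> eps u v' * lookup (xi_word w0) u * lookup (xi_word v) v')
        = (if p = (w0, v) then eps w0 v else (0::'k))"
      using uv(1) by (auto simp: lookup_xi_word_self[OF T0] lookup_xi_word_self[OF vTri])
  qed
  also have "\<dots> = eps w0 v"
  proof -
    have "(w0, v) \<in> factorizations l n d w" using W0 vW mul by (simp add: factorizations_def)
    then show ?thesis by simp
  qed
  finally have "?z = scale (eps w0 v) (xi_word w)" using zw by simp
  then have "scale (eps w0 v) ?z = xi_word w" by simp
  then have "scale (eps w0 v) (tmul l n (xi_word w0) (eta_word l n v)) = (eta_word l n w :: _ \<Rightarrow>\<^sub>0 'k)"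
    unfolding eta_word_eq cf bilin_extend_scale_right by (metis free_module.scale_left_commute)
  moreover have "(eta_word l n v :: _ \<Rightarrow>\<^sub>0 'k) \<in> fTf l n d"
    using t tv sv generating_tgt[OF l1 dn w0(1)] by (intro eta_word_fTf[OF vTri]) auto
  ultimately show thesis using that[OF w0(1)] by metis
qed

lemma (in corner_linear) \<phi>_eq_lift:
  assumes x: "x \<in> Tf l n d"
  shows "\<phi> x = tmul l n lift x"
proof -
  have xT: "x \<in> Tset l n d" using x by (simp add: Tf_def)
  \<comment> \<open>Membership in \<open>Tf\<close> is carried through the induction because \<phi>
    is assumed additive only there.\<close>
  have "x \<in> Tf l n d \<and> \<phi> x = tmul l n lift x"
    using xT
  proof (induction x rule: Tset_induct[where Q = "\<lambda>w. \<forall>i<d. fst (tgt (w ! i)) < l"])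
    case (support w)
    then show ?case using x by (auto simp: Tf_def)
  next
    case zero
    show ?case using \<phi>_zero by (simp add: Tf_def Tset_zero)
  next
    case (add c w y)
    obtain c' w0 z where z: "generating l n d w0" "z \<in> fTf l n d"
      "(eta_word l n w :: _ \<Rightarrow>\<^sub>0 'k) = scale c' (tmul l n (xi_word w0) z)"
      by (rule eta_word_factor[OF l1 dn add(1,2)])
    have T: "tmul l n (xi_word w0) z \<in> Tf l n d"
      using xi_Tf[OF z(1)] z(2) by (intro Tf_tmul[OF l1]) (auto simp: Tf_def fTf_def)
    have e: "eta_word l n w \<in> Tf l n d" by (rule eta_word_Tf[OF add(1,2)])
    have "z \<in> Tset l n d" using z(2) by (simp add: fTf_def Tf_def)
    then have zk: "keys z \<subseteq> words l n d" by (rule Tset_keys)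
    have "\<phi> (eta_word l n w) = scale c' (tmul l n (Y w0) z)"
      unfolding z(3) by (simp add: \<phi>_scale[OF T] \<phi>_tmul[OF xi_Tf[OF z(1)] z(2)])
    also have "\<dots> = scale c' (tmul l n lift (tmul l n (xi_word w0) z))"
      using tmul_assoc[OF l1 lift_keys keys_xi_word[OF gen_Tri[OF z(1)]] zk] tmul_lift_xi[OF z(1)] by simp
    also have "\<dots> = tmul l n lift (eta_word l n w)" unfolding z(3) bilin_extend_scale_right ..
    finally have *: "\<phi> (eta_word l n w) = tmul l n lift (eta_word l n w)" .
    have se: "scale c (eta_word l n w) \<in> Tf l n d"
      using e by (auto simp: Tf_def Tset_scale)
    have "scale c (eta_word l n w) + y \<in> Tf l n d"
      using se add(3) by (intro Tf_add) auto
    then show ?case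
      using add(3) * \<phi>_add[OF se] \<phi>_scale[OF e] by (simp add: bilin_extend_add_right bilin_extend_scale_right)
  qed
  then show ?thesis ..
qed

lemma annihilator_trivial:
  fixes s :: "tensor_word \<Rightarrow>\<^sub>0 'k::{idom, ring_char_0}"
  assumes l1: "l \<ge> 1" and dn: "d \<le> n" and s: "s \<in> Tset l n d"
    and zero: "\<And>x. x \<in> Tf l n d \<Longrightarrow> tmul l n s x = 0"
  shows "s = 0"
proof (rule poly_mapping_eqI)
  fix v
  show "lookup s v = lookup 0 v"
  proof (cases "v \<in> words l n d")
    case v: True
    obtain w where w: "generating l n d w" "map src w = map tgt v"
      using generating_exists[OF l1 dn, of "map tgt v"] tgt_letter[OF words_nth[OF v]] words_length[OF v] by auto
    obtain a where a: "wmul l v w = Some a" using generating_wmul[OF l1 dn w(1) v] w(2) by auto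
    note T = generating_Tri[OF l1 dn w(1)]
    have "(xi_word w :: _ \<Rightarrow>\<^sub>0 'k) \<in> Tf l n d"
      unfolding xi_word_eq_eta[OF generating_cfact[OF l1 dn w(1)]]
      using generating_tgt[OF l1 dn w(1)] by (intro eta_word_Tf[OF T]) auto
    then have "tmul l n s (xi_word w) = 0" by (rule zero)
    moreover have "map tgt a = map tgt w" by (rule wmul_SomeD(3)[OF a v Tri_words[OF T]])
    ultimately have "eps v w * lookup s v = 0"
      using tmul_xi_word(1)[OF l1 Tset_keys[OF s] T generating_separated[OF l1 dn w(1)] _ v a] by simp
    then have "eps v w * eps v w * lookup s v = 0" by (simp only: mult.assoc mult_zero_right)
    then show ?thesis by simp
  qed (simp add: lookup_notin_words[OF Tset_keys[OF s]])
qed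


section \<open>Double centralizer idempotents\<close>


lemma left_ideal_ofI: "s \<in> carrier S \<Longrightarrow> s \<otimes>\<^bsub>S\<^esub> f \<in> left_ideal_of S f"
  by (auto simp: left_ideal_of_def)

lemma cornerI: "s \<in> carrier S \<Longrightarrow> f \<otimes>\<^bsub>S\<^esub> s \<otimes>\<^bsub>S\<^esub> f \<in> corner S f"
  by (auto simp: corner_def)

context ring
begin

lemma left_ideal_of_carrier: "f \<in> carrier R \<Longrightarrow> x \<in> left_ideal_of R f \<Longrightarrow> x \<in> carrier R"
  by (auto simp: left_ideal_of_def)

lemma corner_carrier: "f \<in> carrier R \<Longrightarrow> x \<in> corner R f \<Longrightarrow> x \<in> carrier R"
  by (auto simp: corner_def)

lemma left_ideal_of_mult:
  assumes f: "f \<in> carrier R" and s: "s \<in> carrier R" and x: "x \<in> left_ideal_of R f"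
  shows "s \<otimes> x \<in> left_ideal_of R f"
proof -
  obtain t where t: "t \<in> carrier R" "x = t \<otimes> f" using x by (auto simp: left_ideal_of_def)
  then have "s \<otimes> x = (s \<otimes> t) \<otimes> f" using s f by (simp add: m_assoc)
  then show ?thesis using s t by (simp only: left_ideal_ofI m_closed)
qed

lemma left_ideal_of_add:
  assumes f: "f \<in> carrier R" and x: "x \<in> left_ideal_of R f" and y: "y \<in> left_ideal_of R f"
  shows "x \<oplus> y \<in> left_ideal_of R f"
proof -
  obtain t u where tu: "t \<in> carrier R" "x = t \<otimes> f" "u \<in> carrier R" "y = u \<otimes> f"
    using x y by (auto simp: left_ideal_of_def)
  then have "x \<oplus> y = (t \<oplus> u) \<otimes> f" using f by (simp add: l_distr)
  then show ?thesis using tu by (simp only: left_ideal_ofI a_closed)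
qed

lemma left_ideal_of_corner:
  assumes f: "f \<in> carrier R" and x: "x \<in> left_ideal_of R f" and y: "y \<in> corner R f"
  shows "x \<otimes> y \<in> left_ideal_of R f"
proof -
  obtain t where t: "t \<in> carrier R" "y = f \<otimes> t \<otimes> f" using y by (auto simp: corner_def)
  have xc: "x \<in> carrier R" by (rule left_ideal_of_carrier[OF f x])
  have "x \<otimes> y = (x \<otimes> (f \<otimes> t)) \<otimes> f" using f xc t by (simp add: m_assoc)
  then show ?thesis using f t(1) xc by (simp only: left_ideal_ofI m_closed)
qed

end

lemma End_right_carrier:
  "\<phi> \<in> carrier (End_right S f) \<longleftrightarrow> \<phi> \<in> left_ideal_of S f \<rightarrow>\<^sub>E left_ideal_of S f \<and>
    (\<forall>x\<in>left_ideal_of S f. \<forall>y\<in>left_ideal_of S f. \<phi> (x \<oplus>\<^bsub>S\<^esub> y) = \<phi> x \<oplus>\<^bsub>S\<^esub> \<phi> y) \<and>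
    (\<forall>x\<in>left_ideal_of S f. \<forall>y\<in>corner S f. \<phi> (x \<otimes>\<^bsub>S\<^esub> y) = \<phi> x \<otimes>\<^bsub>S\<^esub> y)"
  by (simp add: End_right_def)

text \<open>Left multiplications are endomorphisms of the right module and compose like ring
  elements, so only bijectivity has content. Injectivity is triviality of the annihilator;
  surjectivity can be tested pointwise on the left ideal because endomorphisms are
  extensional.\<close>

lemma double_centralizer_idempotent_iff:
  "double_centralizer_idempotent S f \<longleftrightarrow> ring S \<and> f \<in> carrier S \<and> f \<otimes>\<^bsub>S\<^esub> f = f \<and>
    (\<forall>s\<in>carrier S. (\<forall>x\<in>left_ideal_of S f. s \<otimes>\<^bsub>S\<^esub> x = \<zero>\<^bsub>S\<^esub>) \<longrightarrow> s = \<zero>\<^bsub>S\<^esub>) \<and>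
    (\<forall>\<phi>\<in>carrier (End_right S f). \<exists>s\<in>carrier S. \<forall>x\<in>left_ideal_of S f. \<phi> x = s \<otimes>\<^bsub>S\<^esub> x)"
  (is "_ \<longleftrightarrow> _ \<and> _ \<and> _ \<and> ?inj \<and> ?surj")
proof (cases "ring S \<and> f \<in> carrier S")
  case True
  then interpret ring S by simp
  have f: "f \<in> carrier S" using True by simp
  let ?L = "left_ideal_of S f"
  let ?h = "\<lambda>s. \<lambda>x\<in>?L. s \<otimes>\<^bsub>S\<^esub> x"
  note Lc = left_ideal_of_carrier[OF f] and cc = corner_carrier[OF f] and Lm = left_ideal_of_mult[OF f]
    and La = left_ideal_of_add[OF f] and Lr = left_ideal_of_corner[OF f]
  have hE: "?h s \<in> carrier (End_right S f)" if s: "s \<in> carrier S" for s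
    unfolding End_right_carrier
    using s by (auto simp: Lm La Lr Lc cc r_distr m_assoc)
  have hom: "?h \<in> ring_hom S (End_right S f)"
  proof (rule ring_hom_memI)
    fix s t assume st: "s \<in> carrier S" "t \<in> carrier S"
    show "?h (s \<otimes>\<^bsub>S\<^esub> t) = ?h s \<otimes>\<^bsub>End_right S f\<^esub> ?h t"
      using st by (auto simp: End_right_def compose_def Lm Lc m_assoc intro!: restrict_ext)
    show "?h (s \<oplus>\<^bsub>S\<^esub> t) = ?h s \<oplus>\<^bsub>End_right S f\<^esub> ?h t"
      using st by (auto simp: End_right_def Lc l_distr intro!: restrict_ext)
  next
    show "?h \<one>\<^bsub>S\<^esub> = \<one>\<^bsub>End_right S f\<^esub>"
      by (auto simp: End_right_def Lc intro!: restrict_ext)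
  qed (rule hE)
  have inj: "inj_on ?h (carrier S) \<longleftrightarrow> ?inj"
  proof
    assume inj: "inj_on ?h (carrier S)"
    show ?inj
    proof (intro ballI impI)
      fix s assume s: "s \<in> carrier S" "\<forall>x\<in>?L. s \<otimes>\<^bsub>S\<^esub> x = \<zero>\<^bsub>S\<^esub>"
      then have "?h s = ?h \<zero>\<^bsub>S\<^esub>" by (auto simp: Lc intro!: restrict_ext)
      then show "s = \<zero>\<^bsub>S\<^esub>" using inj s(1) by (auto dest: inj_onD)
    qed
  next
    assume ?inj
    show "inj_on ?h (carrier S)"
    proof (rule inj_onI)
      fix s t assume st: "s \<in> carrier S" "t \<in> carrier S" "?h s = ?h t"
      have "(s \<ominus>\<^bsub>S\<^esub> t) \<otimes>\<^bsub>S\<^esub> x = \<zero>\<^bsub>S\<^esub>" if x: "x \<in> ?L" for x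
      proof -
        have "s \<otimes>\<^bsub>S\<^esub> x = t \<otimes>\<^bsub>S\<^esub> x" using fun_cong[OF st(3), of x] x by simp
        then show ?thesis using st(1,2) Lc[OF x]
          by (simp add: minus_eq l_distr l_minus r_neg)
      qed
      then have "s \<ominus>\<^bsub>S\<^esub> t = \<zero>\<^bsub>S\<^esub>" using \<open>?inj\<close> st(1,2) by simp
      then show "s = t" using minus_equality[of s "\<ominus>\<^bsub>S\<^esub> t"] st(1,2) by (simp add: minus_eq)
    qed
  qed
  have surj: "carrier (End_right S f) \<subseteq> ?h ` carrier S \<longleftrightarrow> ?surj"
  proof
    assume "carrier (End_right S f) \<subseteq> ?h ` carrier S"
    then show ?surj by fastforce
  next
    assume ?surj
    show "carrier (End_right S f) \<subseteq> ?h ` carrier S"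
    proof
      fix \<phi> assume \<phi>: "\<phi> \<in> carrier (End_right S f)"
      then obtain s where s: "s \<in> carrier S" "\<forall>x\<in>?L. \<phi> x = s \<otimes>\<^bsub>S\<^esub> x" using \<open>?surj\<close> by blast
      have "\<phi> = ?h s"
      proof (rule extensionalityI[of _ ?L])
        show "\<phi> \<in> extensional ?L" using \<phi> by (auto simp: End_right_carrier PiE_def)
      qed (use s in auto)
      then show "\<phi> \<in> ?h ` carrier S" using s(1) by blast
    qed
  qed
  have "?h ` carrier S \<subseteq> carrier (End_right S f)" using hE by blast
  then have "?h \<in> ring_iso S (End_right S f) \<longleftrightarrow> ?inj \<and> ?surj"
    unfolding ring_iso_def bij_betw_def using hom inj surj by blast
  then show ?thesis using True unfolding double_centralizer_idempotent_def by blast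
qed (auto simp: double_centralizer_idempotent_def)

text \<open>Serves to pass from \<open>T\<close> with n = d = 1 to the zigzag algebra. An
  endomorphism is conjugated by the isomorphism, realised there as a left multiplication, and the
  multiplier is pulled back.\<close>

lemma double_centralizer_idempotent_transfer:
  assumes S: "ring S" and h: "h \<in> ring_iso S S'" and e: "e \<in> carrier S"
    and dci: "double_centralizer_idempotent S' (h e)"
  shows "double_centralizer_idempotent S e"
proof -
  interpret S: ring S by (rule S)
  let ?f = "h e"
  note D = dci[unfolded double_centralizer_idempotent_iff]
  interpret S': ring S' using D by blast
  have hom: "h \<in> ring_hom S S'" and bij: "bij_betw h (carrier S) (carrier S')"
    using h by (auto simp: ring_iso_def)
  note hm = ring_hom_mult[OF hom] and ha = ring_hom_add[OF hom] and hc = ring_hom_closed[OF hom]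
  have hz: "h \<zero>\<^bsub>S\<^esub> = \<zero>\<^bsub>S'\<^esub>" by (rule ring_hom_zero[OF hom S S'.ring_axioms])
  have hi: "x = y" if "x \<in> carrier S" "y \<in> carrier S" "h x = h y" for x y
    using bij that by (auto simp: bij_betw_def dest: inj_onD)
  have hs: "\<exists>x\<in>carrier S. h x = y" if "y \<in> carrier S'" for y
  proof -
    have "y \<in> h ` carrier S" using bij that by (simp add: bij_betw_def)
    then show ?thesis by blast
  qed
  let ?L = "left_ideal_of S e" and ?L' = "left_ideal_of S' ?f"
  note Lc = S.left_ideal_of_carrier[OF e] and Cc = S.corner_carrier[OF e]
    and La = S.left_ideal_of_add[OF e] and Lr = S.left_ideal_of_corner[OF e]
  have L': "?L' = h ` ?L"
  proof (intro equalityI subsetI)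
    fix y assume "y \<in> ?L'"
    then obtain t' where t': "t' \<in> carrier S'" "y = t' \<otimes>\<^bsub>S'\<^esub> ?f"
      unfolding left_ideal_of_def by blast
    obtain t where t: "t \<in> carrier S" "h t = t'" using hs[OF t'(1)] by blast
    have "y = h (t \<otimes>\<^bsub>S\<^esub> e)" using t t' e by (simp add: hm)
    moreover have "t \<otimes>\<^bsub>S\<^esub> e \<in> ?L" using t(1) by (rule left_ideal_ofI)
    ultimately show "y \<in> h ` ?L" by blast
  next
    fix y assume "y \<in> h ` ?L"
    then obtain t where t: "t \<in> carrier S" "y = h (t \<otimes>\<^bsub>S\<^esub> e)"
      unfolding left_ideal_of_def by blast
    have "y = h t \<otimes>\<^bsub>S'\<^esub> ?f" "h t \<in> carrier S'" using t e by (simp_all add: hm hc)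
    then show "y \<in> ?L'" by (simp only: left_ideal_ofI)
  qed
  have C': "\<exists>c\<in>corner S e. y = h c" if y: "y \<in> corner S' ?f" for y
  proof -
    obtain t' where t': "t' \<in> carrier S'" "y = ?f \<otimes>\<^bsub>S'\<^esub> t' \<otimes>\<^bsub>S'\<^esub> ?f"
      using y unfolding corner_def by blast
    obtain t where t: "t \<in> carrier S" "h t = t'" using hs[OF t'(1)] by blast
    have "y = h (e \<otimes>\<^bsub>S\<^esub> t \<otimes>\<^bsub>S\<^esub> e)" using t t' e by (simp add: hm)
    moreover have "e \<otimes>\<^bsub>S\<^esub> t \<otimes>\<^bsub>S\<^esub> e \<in> corner S e" using t(1) by (rule cornerI)
    ultimately show ?thesis by blast
  qed
  show ?thesis
    unfolding double_centralizer_idempotent_iff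
  proof (intro conjI ballI impI)
    show "ring S" "e \<in> carrier S" by fact+
    show "e \<otimes>\<^bsub>S\<^esub> e = e" using D e by (intro hi) (simp_all add: hm)
  next
    fix s assume s: "s \<in> carrier S" "\<forall>x\<in>?L. s \<otimes>\<^bsub>S\<^esub> x = \<zero>\<^bsub>S\<^esub>"
    have "\<forall>y\<in>?L'. h s \<otimes>\<^bsub>S'\<^esub> y = \<zero>\<^bsub>S'\<^esub>"
      unfolding L' using s Lc hz by (auto simp flip: hm)
    then have "h s = \<zero>\<^bsub>S'\<^esub>" using D hc[OF s(1)] by blast
    then show "s = \<zero>\<^bsub>S\<^esub>" using s(1) hz by (intro hi) simp_all
  next
    fix \<phi> assume "\<phi> \<in> carrier (End_right S e)"
    then have \<phi>: "\<And>x. x \<in> ?L \<Longrightarrow> \<phi> x \<in> ?L"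
        "\<And>x y. x \<in> ?L \<Longrightarrow> y \<in> ?L \<Longrightarrow> \<phi> (x \<oplus>\<^bsub>S\<^esub> y) = \<phi> x \<oplus>\<^bsub>S\<^esub> \<phi> y"
        "\<And>x y. x \<in> ?L \<Longrightarrow> y \<in> corner S e \<Longrightarrow> \<phi> (x \<otimes>\<^bsub>S\<^esub> y) = \<phi> x \<otimes>\<^bsub>S\<^esub> y"
      by (auto simp: End_right_carrier)
    define g where "g = the_inv_into (carrier S) h"
    have g: "g (h x) = x" if "x \<in> carrier S" for x
      unfolding g_def using bij that by (intro the_inv_into_f_f) (auto simp: bij_betw_def)
    define \<psi> where "\<psi> = (\<lambda>y\<in>?L'. h (\<phi> (g y)))"
    have \<psi>: "\<psi> (h x) = h (\<phi> x)" if "x \<in> ?L" for x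
      using that L' g[OF Lc[OF that]] by (simp add: \<psi>_def)
    have "\<psi> \<in> carrier (End_right S' ?f)"
      unfolding End_right_carrier
    proof (intro conjI ballI)
      show "\<psi> \<in> ?L' \<rightarrow>\<^sub>E ?L'"
      proof (rule PiE_I)
        fix y assume "y \<in> ?L'"
        then obtain x where "x \<in> ?L" "y = h x" unfolding L' by blast
        then show "\<psi> y \<in> ?L'" unfolding L' using \<psi> \<phi>(1) by auto
      qed (simp add: \<psi>_def)
    next
      fix y z assume "y \<in> ?L'" "z \<in> ?L'"
      then obtain x w where xw: "x \<in> ?L" "w \<in> ?L" "y = h x" "z = h w" unfolding L' by blast
      have "\<psi> (y \<oplus>\<^bsub>S'\<^esub> z) = \<psi> (h (x \<oplus>\<^bsub>S\<^esub> w))"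
        unfolding xw(3,4) ha[OF Lc[OF xw(1)] Lc[OF xw(2)]] ..
      also have "\<dots> = h (\<phi> x \<oplus>\<^bsub>S\<^esub> \<phi> w)" unfolding \<psi>[OF La[OF xw(1,2)]] \<phi>(2)[OF xw(1,2)] ..
      also have "\<dots> = \<psi> y \<oplus>\<^bsub>S'\<^esub> \<psi> z"
        unfolding xw(3,4) \<psi>[OF xw(1)] \<psi>[OF xw(2)] by (intro ha Lc \<phi>(1) xw(1,2))
      finally show "\<psi> (y \<oplus>\<^bsub>S'\<^esub> z) = \<psi> y \<oplus>\<^bsub>S'\<^esub> \<psi> z" .
    next
      fix y z assume "y \<in> ?L'" "z \<in> corner S' ?f"
      then obtain x w where xw: "x \<in> ?L" "w \<in> corner S e" "y = h x" "z = h w"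
        unfolding L' using C' by blast
      have "\<psi> (y \<otimes>\<^bsub>S'\<^esub> z) = \<psi> (h (x \<otimes>\<^bsub>S\<^esub> w))"
        unfolding xw(3,4) hm[OF Lc[OF xw(1)] Cc[OF xw(2)]] ..
      also have "\<dots> = h (\<phi> x \<otimes>\<^bsub>S\<^esub> w)" unfolding \<psi>[OF Lr[OF xw(1,2)]] \<phi>(3)[OF xw(1,2)] ..
      also have "\<dots> = \<psi> y \<otimes>\<^bsub>S'\<^esub> z"
        unfolding xw(3,4) \<psi>[OF xw(1)] by (intro hm Lc Cc \<phi>(1) xw(1,2))
      finally show "\<psi> (y \<otimes>\<^bsub>S'\<^esub> z) = \<psi> y \<otimes>\<^bsub>S'\<^esub> z" .
    qed
    then obtain s' where s': "s' \<in> carrier S'" "\<forall>y\<in>?L'. \<psi> y = s' \<otimes>\<^bsub>S'\<^esub> y" using D by blast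
    obtain s where s: "s \<in> carrier S" "h s = s'" using hs[OF s'(1)] by blast
    show "\<exists>s\<in>carrier S. \<forall>x\<in>?L. \<phi> x = s \<otimes>\<^bsub>S\<^esub> x"
    proof (intro bexI ballI)
      fix x assume x: "x \<in> ?L"
      have "h (\<phi> x) = h s \<otimes>\<^bsub>S'\<^esub> h x" using \<psi>[OF x] s'(2) L' x s(2) by auto
      also have "\<dots> = h (s \<otimes>\<^bsub>S\<^esub> x)" using s(1) Lc[OF x] by (simp add: hm)
      finally show "\<phi> x = s \<otimes>\<^bsub>S\<^esub> x" using s(1) Lc[OF x] Lc[OF \<phi>(1)[OF x]] by (intro hi) simp_all
    qed (rule s(1))
  qed
qed


section \<open>The double centralizer property of \<open>T\<close>\<close>

lemma left_ideal_T:
  assumes l1: "l \<ge> 1"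
  shows "left_ideal_of (T_algebra l n d) (xi_e l n d) = (Tf l n d :: (_ \<Rightarrow>\<^sub>0 'k::{idom, ring_char_0}) set)"
proof (intro equalityI subsetI)
  note f = is_diagonal_xi_e[OF l1, of n d, where 'k = 'k]
  fix x :: "_ \<Rightarrow>\<^sub>0 'k" assume "x \<in> left_ideal_of (T_algebra l n d) (xi_e l n d)"
  then obtain s where s: "s \<in> Tset l n d" "x = tmul l n s (xi_e l n d)"
    by (auto simp: left_ideal_of_def T_algebra_simps)
  have "x \<in> Tset l n d" unfolding s(2) by (rule Tset_tmul[OF l1 s(1) is_diagonal_Tset[OF f]])
  moreover have "\<forall>i<d. fst (tgt (w ! i)) < l" if "lookup x w \<noteq> 0" for w
    using that unfolding s(2) diagonal_tmul_right[OF l1 f Tset_keys[OF s(1)]] by (simp split: if_splits)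
  ultimately show "x \<in> Tf l n d" unfolding Tf_def by blast
next
  note f = is_diagonal_xi_e[OF l1, of n d, where 'k = 'k]
  fix x :: "_ \<Rightarrow>\<^sub>0 'k" assume x: "x \<in> Tf l n d"
  then have xT: "x \<in> Tset l n d" by (simp add: Tf_def)
  have "x = tmul l n x (xi_e l n d)"
    using x by (intro poly_mapping_eqI)
      (auto simp: diagonal_tmul_right[OF l1 f Tset_keys[OF xT]] Tf_def)
  then show "x \<in> left_ideal_of (T_algebra l n d) (xi_e l n d)"
    using xT by (auto simp: left_ideal_of_def T_algebra_simps)
qed

lemma fTf_corner:
  assumes l1: "l \<ge> 1" and x: "x \<in> fTf l n d"
  shows "x \<in> corner (T_algebra l n d :: (_ \<Rightarrow>\<^sub>0 'k::{idom, ring_char_0}) ring) (xi_e l n d)"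
proof -
  note f = is_diagonal_xi_e[OF l1, of n d, where 'k = 'k]
  have xT: "x \<in> Tset l n d" using x by (simp add: fTf_def Tf_def)
  note k = Tset_keys[OF xT]
  have 1: "tmul l n (xi_e l n d) x = x"
    using x by (intro poly_mapping_eqI) (auto simp: diagonal_tmul_left[OF l1 f k] fTf_def)
  have "tmul l n x (xi_e l n d) = x"
    using x by (intro poly_mapping_eqI) (auto simp: diagonal_tmul_right[OF l1 f k] fTf_def Tf_def)
  then have "x = tmul l n (tmul l n (xi_e l n d) x) (xi_e l n d)" using 1 by simp
  then show ?thesis using xT by (auto simp: corner_def T_algebra_simps)
qed

lemma double_centralizer_T:
  assumes l1: "l \<ge> 1" and dn: "d \<le> n"
  shows "double_centralizer_idempotent (T_algebra l n d :: (_ \<Rightarrow>\<^sub>0 'k::{idom, ring_char_0}) ring) (xi_e l n d)"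
  unfolding double_centralizer_idempotent_iff left_ideal_T[OF l1]
proof (intro conjI ballI impI)
  let ?T = "T_algebra l n d :: (_ \<Rightarrow>\<^sub>0 'k) ring"
  note f = is_diagonal_xi_e[OF l1, of n d, where 'k = 'k]
  note fk = is_diagonal_keys[OF f]
  show "ring ?T" by (rule T_algebra_ring[OF l1])
  show "xi_e l n d \<in> carrier ?T" using is_diagonal_Tset[OF f] by (simp add: T_algebra_simps)
  have ef: "lookup (xi_e l n d :: _ \<Rightarrow>\<^sub>0 'k) w \<noteq> 0 \<Longrightarrow> \<forall>i<d. fst (tgt (w ! i)) < l \<and> fst (src (w ! i)) < l" for w
    unfolding is_diagonal_lookup[OF f] by (auto split: if_splits)
  have fTf: "xi_e l n d \<in> (fTf l n d :: (_ \<Rightarrow>\<^sub>0 'k) set)"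
    unfolding fTf_def Tf_def using is_diagonal_Tset[OF f] ef by blast
  show "xi_e l n d \<otimes>\<^bsub>?T\<^esub> xi_e l n d = xi_e l n d"
    unfolding T_algebra_simps
  proof (rule poly_mapping_eqI)
    fix w show "lookup (tmul l n (xi_e l n d) (xi_e l n d)) w = (lookup (xi_e l n d) w :: 'k)"
      unfolding diagonal_tmul_right[OF l1 f fk] using ef[of w] by auto
  qed
  show "s = \<zero>\<^bsub>?T\<^esub>" if "s \<in> carrier ?T" "\<forall>x\<in>Tf l n d. s \<otimes>\<^bsub>?T\<^esub> x = \<zero>\<^bsub>?T\<^esub>" for s
    unfolding T_algebra_simps
  proof (rule annihilator_trivial[OF l1 dn])
    show "s \<in> Tset l n d" using that(1) unfolding T_algebra_simps .
    show "tmul l n s x = 0" if "x \<in> Tf l n d" for x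
      using \<open>\<forall>x\<in>Tf l n d. _\<close> that unfolding T_algebra_simps by blast
  qed
  fix \<phi> assume "\<phi> \<in> carrier (End_right ?T (xi_e l n d))"
  then have \<phi>: "\<And>x. x \<in> Tf l n d \<Longrightarrow> \<phi> x \<in> Tf l n d"
      "\<And>x y. x \<in> Tf l n d \<Longrightarrow> y \<in> Tf l n d \<Longrightarrow> \<phi> (x + y) = \<phi> x + \<phi> y"
      "\<And>x y. x \<in> Tf l n d \<Longrightarrow> y \<in> corner ?T (xi_e l n d) \<Longrightarrow> \<phi> (tmul l n x y) = tmul l n (\<phi> x) y"
    unfolding End_right_carrier left_ideal_T[OF l1] T_algebra_simps by (elim conjE, blast)+
  have unit: "tmul l n x (xi_e l n d) = x" if x: "x \<in> Tf l n d" for x :: "_ \<Rightarrow>\<^sub>0 'k"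
  proof (rule poly_mapping_eqI)
    have k: "keys x \<subseteq> words l n d" using x Tset_keys unfolding Tf_def by blast
    fix w show "lookup (tmul l n x (xi_e l n d)) w = lookup x w"
      unfolding diagonal_tmul_right[OF l1 f k] using x unfolding Tf_def by auto
  qed
  interpret corner_linear l n d \<phi>
  proof
    show "l \<ge> 1" "d \<le> n" by fact+
    show "\<phi> x \<in> Tset l n d" if "x \<in> Tf l n d" for x using \<phi>(1)[OF that] by (simp add: Tf_def)
    show "\<phi> (x + y) = \<phi> x + \<phi> y" if "x \<in> Tf l n d" "y \<in> Tf l n d" for x y using that by (rule \<phi>(2))
    show "\<phi> (tmul l n x y) = tmul l n (\<phi> x) y" if "x \<in> Tf l n d" "y \<in> fTf l n d" for x y
      using that by (intro \<phi>(3) fTf_corner[OF l1])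
    show "\<phi> (scale c x) = scale c (\<phi> x)" if x: "x \<in> Tf l n d" for c x
    proof -
      \<comment> \<open>On \<open>Tf\<close> the scalar \<open>c\<close> acts as right
        multiplication by the corner element \<open>scale c (xi_e l n d)\<close>, so \<phi> commutes
        with it.\<close>
      have "scale c (xi_e l n d :: _ \<Rightarrow>\<^sub>0 'k) \<in> fTf l n d"
        using fTf by (auto simp: fTf_def Tf_def Tset_scale)
      then have "\<phi> (tmul l n x (scale c (xi_e l n d))) = tmul l n (\<phi> x) (scale c (xi_e l n d))"
        by (intro \<phi>(3) x fTf_corner[OF l1])
      then show ?thesis by (simp add: bilin_extend_scale_right unit x \<phi>(1))
    qed
  qed
  show "\<exists>s\<in>carrier ?T. \<forall>x\<in>Tf l n d. \<phi> x = s \<otimes>\<^bsub>?T\<^esub> x"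
    using lift_Tset \<phi>_eq_lift by (auto simp: T_algebra_simps)
qed


section \<open>The zigzag algebra as the case n = d = 1\<close>

lemma Tset_1_1: "Tset l 1 1 = {x :: _ \<Rightarrow>\<^sub>0 'k::comm_ring_1. keys x \<subseteq> words l 1 1}"
proof -
  \<comment> \<open>A single position admits neither a nontrivial permutation nor a repeated letter,
    so the symmetry and divisibility conditions are vacuous.\<close>
  have "\<sigma> = id" if "\<sigma> permutes {..<1}" for \<sigma> :: "nat \<Rightarrow> nat"
    using that by (simp add: lessThan_Suc)
  moreover have "psign id w = (1::'k)" if "w \<in> words l 1 1" for w
    using psign_id[OF words_length[OF that]] .
  moreover have "cfact l 1 w = 1" if "w \<in> words l 1 1" for w
    using words_length[OF that] by (intro cfact_eq_1) simp
  ultimately show ?thesis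
    by (fastforce simp: Tset_def supersym_def)
qed

lemma words_1_1: "words l 1 1 = (\<lambda>b. [(b, 1, 1)]) ` zigzag_basis l"
  by (auto simp: words_def letters_def length_Suc_conv)

definition to_word :: "(path \<Rightarrow>\<^sub>0 'k::comm_ring_1) \<Rightarrow> (tensor_word \<Rightarrow>\<^sub>0 'k)"
  where "to_word = lin_extend (\<lambda>b. single [(b, 1, 1)] 1)"

lemma zigzag_iso_T:
  assumes l1: "l \<ge> 1"
  shows "(\<lambda>z. to_word (coords l z)) \<in> ring_iso (ext_zigzag l) (T_algebra l 1 1 :: (_ \<Rightarrow>\<^sub>0 'k::{idom, ring_char_0}) ring)"
proof -
  let ?Z = "ext_zigzag l :: (path \<Rightarrow>\<^sub>0 'k) set ring"
  let ?T = "T_algebra l 1 1 :: (_ \<Rightarrow>\<^sub>0 'k) ring"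
  let ?V = "{x :: path \<Rightarrow>\<^sub>0 'k. keys x \<subseteq> zigzag_basis l}"
  have Q: "keys x \<subseteq> quiver_paths l" if "x \<in> ?V" for x using that zigzag_basis_subset[of l] by auto
  have carZ: "carrier ?Z = cls l ` ?V" by (rule ext_zigzag_carrier[OF l1])
  have co: "coords l (cls l x) = x" if "x \<in> ?V" for x using coords_cls[OF l1] that by simp
  have L: "lookup (to_word x) [(b, 1, 1)] = lookup x b" for x :: "path \<Rightarrow>\<^sub>0 'k" and b
    by (simp add: to_word_def lookup_lin_extend lookup_single when_def in_keys_iff if_distrib cong: if_cong)
  have keys: "keys (to_word x) \<subseteq> words l 1 1" if "x \<in> ?V" for x
  proof -
    have "keys (to_word x) \<subseteq> (\<Union>b\<in>keys x. keys (single [(b, 1, 1)] (1::'k)))"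
      unfolding to_word_def by (rule keys_lin_extend)
    also have "\<dots> \<subseteq> words l 1 1" unfolding words_1_1 using that by auto
    finally show ?thesis .
  qed
  have carT: "carrier ?T = {x. keys x \<subseteq> words l 1 1}" by (simp only: T_algebra_simps Tset_1_1)
  have wm: "word_mult l 1 [(p, 1, 1)] [(q, 1, 1)] = (to_word (opt_single 1 (bmul l p q)) :: _ \<Rightarrow>\<^sub>0 'k)"
    if "p \<in> zigzag_basis l" "q \<in> zigzag_basis l" for p q
  proof -
    have "[(p, 1, 1)] \<in> words l 1 1" "[(q, 1, 1)] \<in> words l 1 1"
      unfolding words_1_1 using that by blast+
    moreover have "eps [(p, 1, 1)] [(q, 1, 1)] = (1::'k)" by (simp add: eps_prod[OF refl] lessThan_Suc)
    ultimately show ?thesis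
      by (cases "bmul l p q") (simp_all add: word_mult_eq[OF l1] lmul_def to_word_def)
  qed
  have mult: "to_word (coords l (cls l x \<otimes>\<^bsub>?Z\<^esub> cls l y)) = tmul l 1 (to_word x) (to_word y)"
    if x: "x \<in> ?V" and y: "y \<in> ?V" for x y
  proof -
    have "coords l (cls l x \<otimes>\<^bsub>?Z\<^esub> cls l y) = proj l (bilin_extend path_comp x y)"
      using coords_cls_proj[OF l1 path_algebra_mult_closed[OF Q[OF x] Q[OF y]]]
      by (simp add: ext_zigzag_ops[OF l1 Q[OF x] Q[OF y]])
    also have "\<dots> = bilin_extend (\<lambda>p q. opt_single 1 (bmul l p q)) x y"
      using proj_mult(1)[OF Q[OF x] Q[OF y]] proj_id[of y l] y by simp
    finally have "to_word (coords l (cls l x \<otimes>\<^bsub>?Z\<^esub> cls l y))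
        = bilin_extend (\<lambda>p q. to_word (opt_single 1 (bmul l p q))) x y"
      by (simp add: to_word_def lin_extend_bilin_extend)
    also have "\<dots> = bilin_extend (\<lambda>p q. word_mult l 1 [(p, 1, 1)] [(q, 1, 1)]) x y"
      using x y by (intro bilin_extend_cong wm[symmetric]) auto
    also have "\<dots> = tmul l 1 (to_word x) (to_word y)"
      by (simp add: to_word_def bilin_extend_lin_extend_left bilin_extend_lin_extend_right)
    finally show ?thesis .
  qed
  have add: "to_word (coords l (cls l x \<oplus>\<^bsub>?Z\<^esub> cls l y)) = to_word x + to_word y"
    if x: "x \<in> ?V" and y: "y \<in> ?V" for x y
  proof -
    have "x + y \<in> ?V" using x y Poly_Mapping.keys_add[of x y] by auto
    then show ?thesis
      by (simp add: ext_zigzag_ops[OF l1 Q[OF x] Q[OF y]] co to_word_def lin_extend_add)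
  qed
  have inj: "inj_on to_word ?V"
    by (rule inj_onI) (metis L poly_mapping_eqI)
  have surj: "to_word ` ?V = carrier ?T"
  proof (intro equalityI subsetI)
    fix y assume "y \<in> carrier ?T"
    then have y: "keys y \<subseteq> words l 1 1" unfolding carT by simp
    define x where "x = lin_extend (\<lambda>w. single (fst (hd w)) 1) y"
    have "keys x \<subseteq> (\<Union>w\<in>keys y. keys (single (fst (hd w)) (1::'k)))" unfolding x_def by (rule keys_lin_extend)
    also have "\<dots> \<subseteq> zigzag_basis l" using y unfolding words_1_1 by fastforce
    finally have "x \<in> ?V" by simp
    moreover have "to_word x = y"
      unfolding to_word_def x_def lin_extend_lin_extend using y unfolding words_1_1
      by (intro lin_extend_id_on) auto
    ultimately show "y \<in> to_word ` ?V" by blast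
  qed (use keys carT in auto)
  have hom: "(\<lambda>z. to_word (coords l z)) \<in> ring_hom ?Z ?T"
  proof (rule ring_hom_memI)
    fix z assume "z \<in> carrier ?Z"
    then obtain x where x: "x \<in> ?V" "z = cls l x" unfolding carZ by blast
    then show "to_word (coords l z) \<in> carrier ?T" unfolding carT using keys[OF x(1)] co[OF x(1)] by simp
  next
    fix y z assume "y \<in> carrier ?Z" "z \<in> carrier ?Z"
    then obtain a b where "a \<in> ?V" "b \<in> ?V" "y = cls l a" "z = cls l b" unfolding carZ by blast
    then show "to_word (coords l (y \<otimes>\<^bsub>?Z\<^esub> z)) = to_word (coords l y) \<otimes>\<^bsub>?T\<^esub> to_word (coords l z)"
      "to_word (coords l (y \<oplus>\<^bsub>?Z\<^esub> z)) = to_word (coords l y) \<oplus>\<^bsub>?T\<^esub> to_word (coords l z)"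
      by (simp_all add: mult add co T_algebra_simps)
  next
    interpret Z: ring ?Z by (rule ext_zigzag_ring[OF l1])
    interpret T: ring ?T by (rule T_algebra_ring[OF l1])
    let ?u = "to_word (coords l \<one>\<^bsub>?Z\<^esub>)"
    obtain o1 where o1: "o1 \<in> ?V" "\<one>\<^bsub>?Z\<^esub> = cls l o1" using Z.one_closed unfolding carZ by blast
    have "?u \<in> carrier ?T" using o1 co keys carT by auto
    \<comment> \<open>The image of the unit is a left identity on the image of the map, which is all
      of \<open>T\<close>; this identifies it without comparing coordinates.\<close>
    have "?u \<otimes>\<^bsub>?T\<^esub> y = y" if y: "y \<in> carrier ?T" for y
    proof -
      obtain x where x: "x \<in> ?V" "y = to_word x" using y surj by blast
      have "?u \<otimes>\<^bsub>?T\<^esub> y = to_word (coords l (\<one>\<^bsub>?Z\<^esub> \<otimes>\<^bsub>?Z\<^esub> cls l x))"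
        using x o1 by (simp add: mult co T_algebra_simps)
      also have "\<one>\<^bsub>?Z\<^esub> \<otimes>\<^bsub>?Z\<^esub> cls l x = cls l x" using x(1) carZ by (intro Z.l_one) blast
      finally show ?thesis using x co by simp
    qed
    from this[OF T.one_closed] show "?u = \<one>\<^bsub>?T\<^esub>" using T.r_one[OF \<open>?u \<in> carrier ?T\<close>] by simp
  qed
  have "bij_betw (\<lambda>z. to_word (coords l z)) (carrier ?Z) (carrier ?T)"
    unfolding bij_betw_def
  proof
    show "inj_on (\<lambda>z. to_word (coords l z)) (carrier ?Z)"
      unfolding carZ using inj co by (auto simp: inj_on_def)
    have "(\<lambda>z. to_word (coords l z)) ` carrier ?Z = to_word ` ?V"
      unfolding carZ image_image using co by (intro image_cong) auto
    then show "(\<lambda>z. to_word (coords l z)) ` carrier ?Z = carrier ?T" using surj by simp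
  qed
  with hom show ?thesis by (simp add: ring_iso_def)
qed

lemma to_word_zigzag_e:
  assumes l1: "l \<ge> 1"
  shows "to_word (coords l (zigzag_e l)) = (xi_e l 1 1 :: _ \<Rightarrow>\<^sub>0 'k::{idom, ring_char_0})"
    and "(zigzag_e l :: (path \<Rightarrow>\<^sub>0 'k) set) \<in> carrier (ext_zigzag l)"
proof -
  let ?e = "\<Sum>i\<in>{..<l}. single [i] (1::'k)"
  have k: "keys ?e \<subseteq> zigzag_basis l"
    using keys_sum[of "\<lambda>i. single [i] (1::'k)" "{..<l}"]
    by (fastforce simp: zigzag_basis_def basis_z_def split: if_splits)
  show "(zigzag_e l :: (path \<Rightarrow>\<^sub>0 'k) set) \<in> carrier (ext_zigzag l)"
    using k by (auto simp: zigzag_e_eq[OF l1] ext_zigzag_carrier[OF l1])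
  have e: "to_word (coords l (zigzag_e l)) = (\<Sum>i\<in>{..<l}. single [([i], 1, 1)] (1::'k))"
    by (simp add: zigzag_e_eq[OF l1] coords_cls[OF l1 k] to_word_def lin_extend_sum)
  show "to_word (coords l (zigzag_e l)) = (xi_e l 1 1 :: _ \<Rightarrow>\<^sub>0 'k)"
  proof (rule poly_mapping_eqI)
    fix w :: tensor_word
    have *: "(length w = 1 \<and> (\<forall>i<1. \<exists>p. w ! i = idl p \<and> fst p < l \<and> snd p \<in> {1..1})) \<longleftrightarrow>
        (\<exists>i<l. w = [([i], 1, 1)])"
    proof
      assume "\<exists>i<l. w = [([i], 1, 1)]"
      then obtain i where "i < l" "w = [([i], 1, 1)]" by blast
      then have "w ! 0 = idl (i, 1)" "length w = 1" by (simp_all add: idl_def)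
      then show "length w = 1 \<and> (\<forall>i<1. \<exists>p. w ! i = idl p \<and> fst p < l \<and> snd p \<in> {1..1})"
        using \<open>i < l\<close> by (auto intro!: exI[of _ "(i, 1)"])
    qed (auto simp: length_Suc_conv idl_def)
    have "lookup (\<Sum>i\<in>{..<l}. single [([i], 1, 1)] (1::'k)) w = (\<Sum>i\<in>{..<l}. if w = [([i], 1, 1)] then 1 else 0)"
      unfolding lookup_sum by (intro sum.cong) (auto simp: lookup_single when_def)
    also have "\<dots> = (if \<exists>i<l. w = [([i], 1, 1)] then 1 else 0)"
    proof (cases "\<exists>i<l. w = [([i], 1, 1)]")
      case True
      then obtain j where "j < l" "w = [([j], 1, 1)]" by blast
      then show ?thesis by simp
    qed (auto intro!: sum.neutral)
    finally show "lookup (to_word (coords l (zigzag_e l))) w = lookup (xi_e l 1 1 :: _ \<Rightarrow>\<^sub>0 'k) w"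
      unfolding e lookup_xi_e[OF l1] * .
  qed
qed

theorem theorem6:
  fixes l n d :: nat
    and Z :: "(path \<Rightarrow>\<^sub>0 'k::{idom, ring_char_0}) set ring"
    and T :: "(tensor_word \<Rightarrow>\<^sub>0 'k) ring"
  assumes pid: "\<And>I :: 'k set. module.subspace (*) I \<Longrightarrow> \<exists>a. I = module.span (*) {a}"
    and "l \<ge> 1" and "n \<ge> 1"
  defines "Z \<equiv> ext_zigzag l" and "T \<equiv> T_algebra l n d"
  shows "double_centralizer_idempotent Z (zigzag_e l) \<and>
    (d \<le> n \<longrightarrow> double_centralizer_idempotent T (xi_e l n d))"
proof (intro conjI impI)
  note l1 = \<open>l \<ge> 1\<close>
  show "double_centralizer_idempotent T (xi_e l n d)" if "d \<le> n"
    unfolding T_def by (rule double_centralizer_T[OF l1 that])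
  have "double_centralizer_idempotent (T_algebra l 1 1 :: (_ \<Rightarrow>\<^sub>0 'k) ring) (xi_e l 1 1)"
    by (rule double_centralizer_T[OF l1 order_refl])
  then show "double_centralizer_idempotent Z (zigzag_e l)"
    unfolding Z_def to_word_zigzag_e(1)[OF l1, symmetric]
    by (rule double_centralizer_idempotent_transfer[OF ext_zigzag_ring[OF l1] zigzag_iso_T[OF l1]
          to_word_zigzag_e(2)[OF l1]])
qed

end
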